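(* Let $0<\vartheta\le1$ be such that for every $\epsilon>0$ and every $\mathcal{A}>0$, $\sum_{1\le q\le x^{\vartheta-\epsilon}}\max_{(a,q)=1}|E(x;q,a)|\ll x/\log^{\mathcal{A}}x$ for all sufficiently large $x$. Let $2\le k\le3$, let $\mathbf{j}=(j_1,\dots,j_r)$, $r\ge2$, be distinct integers and $\mathbf{a}=(a_1,\dots,a_r)$ with $a_i\ge1$, $a_r=1$, $\sum a_i=k$. Assume $\max_i|j_i|\ll R^{\epsilon}$. Then for $N^{\epsilon}\ll R\ll N^{\frac{\vartheta}{k-1}-\epsilon}$, $$\tilde{\mathcal{S}}_k(N,\mathbf{j},\mathbf{a})=\big(\mathfrak{S}(\mathbf{j})+o(1)\big)N(\log R)^{k-r}.$$
   Context: $\Lambda$ is the von Mangoldt function; for $R\ge1$, $\Lambda_R(n)=\sum_{d\mid n,\,d\le R}\mu(d)\log(R/d)$ ($n\ge1$), $\Lambda_R(n)=0$ ($n\le0$). $\tilde{\mathcal{S}}_k(N,\mathbf{j},\mathbf{a})=\sum_{n=1}^N\big(\prod_{i=1}^{r-1}\Lambda_R(n+j_i)^{a_i}\big)\Lambda(n+j_r)$. $\psi(x;q,a)=\sum_{n\le x,\,n\equiv a\,(q)}\Lambda(n)$, $E(x;q,a)=\psi(x;q,a)-E_{a,q}x/\phi(q)$ with $E_{a,q}=1$ if $(a,q)=1$, else $0$. $\mathfrak{S}(\mathbf{j})=\prod_p(1-\frac1p)^{-r}(1-\frac{\nu_p(\mathbf{j})}{p})$, $\nu_p(\mathbf{j})$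 the number of distinct residue classes mod $p$ occupied by the $j_i$. $\epsilon>0$ is small and fixed, $N\to\infty$. *)

theory Defs
  imports
    "HOL-Analysis.Analysis"
    "HOL-Number_Theory.Number_Theory"
    "HOL-Computational_Algebra.Squarefree"
    "HOL-Library.Landau_Symbols"
begin

definition moebius :: "nat \<Rightarrow> real" where
  "moebius n = (if squarefree n then (- 1) ^ card (prime_factors n) else 0)"

text \<open>
  Shifted arguments \<open>n + j\<close> may be non-positive integers; both arithmetic functions vanish there.
\<close>

definition Lam :: "int \<Rightarrow> real" where
  "Lam n = (if n \<le> 0 then 0 else mangoldt (nat n))"

definition Lam_R :: "real \<Rightarrow> int \<Rightarrow> real" where
  "Lam_R R n = (if n \<le> 0 then 0
     else \<Sum>d | d dvd nat n \<and> real d \<le> R. moebius d * ln (R / real d))"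

definition psi_prog :: "real \<Rightarrow> nat \<Rightarrow> int \<Rightarrow> real" where
  "psi_prog x q a = (\<Sum>n | 1 \<le> n \<and> real n \<le> x \<and> [int n = a] (mod int q). mangoldt n)"

definition E_prog :: "real \<Rightarrow> nat \<Rightarrow> int \<Rightarrow> real" where
  "E_prog x q a = psi_prog x q a
     - (if coprime a (int q) then 1 else 0) * x / real (totient q)"

text \<open>
  Tuples \<open>(j\<^sub>1, \<dots>, j\<^sub>r)\<close> and \<open>(a\<^sub>1, \<dots>, a\<^sub>r)\<close> are functions of which only the values on
  \<open>{1..r}\<close> matter.
\<close>

definition nu :: "nat \<Rightarrow> (nat \<Rightarrow> int) \<Rightarrow> nat \<Rightarrow> nat" where
  "nu r j p = card ((\<lambda>i. j i mod int p) ` {1..r})"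

text \<open>
  A factor with \<open>\<nu>\<^sub>p = p\<close> vanishes, which is possible only for the finitely many primes \<open>p \<le> r\<close>;
  in that case the value of \<^const>\<open>prodinf\<close> is \<open>0\<close>.
\<close>

definition sing_series :: "nat \<Rightarrow> (nat \<Rightarrow> int) \<Rightarrow> real" where
  "sing_series r j = (\<Prod>p. if prime p
     then (1 - 1 / real p) powi (- int r) * (1 - real (nu r j p) / real p) else 1)"

text \<open>The correlation sum does not use \<open>a r\<close>, the exponent of the last factor being \<open>1\<close>.\<close>

definition S_tilde ::
    "real \<Rightarrow> nat \<Rightarrow> nat \<Rightarrow> (nat \<Rightarrow> int) \<Rightarrow> (nat \<Rightarrow> nat) \<Rightarrow> real" where
  "S_tilde R N r j a =
     (\<Sum>n = 1..N. (\<Prod>i = 1..r - 1. Lam_R R (int n + j i) ^ a i) * Lam (int n + j r))"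

end

theory Submission
  imports Defs "HOL-Real_Asymp.Real_Asymp"
begin

text \<open>
  For modulus \<open>1\<close> the level of distribution hypothesis is the prime number theorem with a
  power-of-log saving; it gives \<open>\<Sum>\<^bsub>d\<le>x\<^esub> \<mu>(d)/d log(x/d) = 1 + O((log x)\<^bsup>-1/4\<^esup>)\<close>,
  and convolution transfers this to the sums \<open>T\<^sub>u(x) = \<Sum>\<^bsub>d\<le>x\<^esub> \<mu>(d) u(d) log(x/d)\<close> for
  multiplicative \<open>u\<close> close to \<open>1/d\<close>, with limit \<open>\<Prod>\<^sub>p (1 - u(p))/(1 - 1/p)\<close>. Rankin's trick makes the
  convolution uniform in the shifts, which are only bounded by a power of \<open>R\<close>.

  Expanding the \<open>\<Lambda>\<^sub>R\<close> and using the hypothesis for the arising progressions reduces the correlation to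
  a sum over one or two divisors. For two divisors Selberg's diagonalisation writes it as
  \<open>\<Sum>\<^sub>e w(e) T(R/e) T'(R/e)\<close>; replacing only the first factor by its limit and resumming over
  \<open>n = e t\<close> leaves a single sum \<open>T\<^sub>u(R)\<close> with an explicit \<open>u\<close>. That sum has \<open>u = 0\<close>, hence equals
  \<open>log R\<close>, when \<open>\<Lambda>\<^sub>R\<close> is squared, and otherwise its Euler product completes the singular series.
\<close>

section \<open>Moebius sums\<close>

text \<open>Uniformity shapes the estimates. The weights of the inner sums depend on
  \<open>e\<close> and on the shifts, so every bound is stated for all large \<open>L\<close>,
  standing for \<open>ln R\<close>, and then for all moduli \<open>Q\<close> with
  \<open>ln Q <= K * L\<close>. Rankin's shift by 1/2 costs a factor exp(O(sqrt(ln Q))). Limits are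
  therefore used only at arguments above exp(L^(3/4)); the exponent 3/4 must exceed 1/2, and it must
  stay below 1 so that the excluded range of \<open>e\<close> near \<open>R\<close> is thin. Only
  one inner sum is replaced by its limit because the other one, kept exact, turns the sum over
  \<open>e\<close> back into a single Moebius sum by an identity without error. In the squared case
  the absolute values of the diagonal weights can grow with ln R, so there is no convergent series
  over \<open>e\<close> to pass to. The prime 2 is delicate throughout, since 1 - 1/(p - 1) vanishes
  there; the parity of the pairwise differences of the shifts keeps even \<open>e\<close> out of the
  diagonal sum.\<close>

definition nats_upto :: "real \<Rightarrow> nat set" where
  "nats_upto x = {n. 0 < n \<and> real n \<le> x}"

lemma mem_nats_upto [simp]: "n \<in> nats_upto x \<longleftrightarrow> 0 < n \<and> real n \<le> x"
  by (simp add: nats_upto_def)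

lemma nats_upto_eq: "nats_upto x = {1..nat \<lfloor>x\<rfloor>}"
proof -
  have "n \<in> nats_upto x \<longleftrightarrow> n \<in> {1..nat \<lfloor>x\<rfloor>}" for n
    by (cases "x \<ge> 0") (auto simp: le_nat_iff le_floor_iff)
  thus ?thesis by blast
qed

lemma finite_nats_upto [simp, intro]: "finite (nats_upto x)"
  by (simp add: nats_upto_eq)

section \<open>Rearranging sums over divisors\<close>

lemma sum_divisors_flip:
  fixes F :: "nat \<Rightarrow> nat \<Rightarrow> 'a::comm_monoid_add"
  assumes "n > 0"
  shows "(\<Sum>d | d dvd n. F d (n div d)) = (\<Sum>d | d dvd n. F (n div d) d)"
  by (rule sum.reindex_bij_witness[of _ "\<lambda>d. n div d" "\<lambda>d. n div d"]) (use assms in auto)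

text \<open>Chains \<open>e dvd d dvd n\<close> correspond to pairs \<open>(e, f)\<close> with
  \<open>e * f dvd n\<close> through \<open>d = e * f\<close>. This is associativity of Dirichlet
  convolution, kept in summed form.\<close>

lemma sum_divisors_assoc:
  fixes F :: "nat \<Rightarrow> nat \<Rightarrow> 'a::comm_monoid_add"
  assumes "n > 0"
  shows "(\<Sum>d | d dvd n. \<Sum>e | e dvd d. F e (d div e)) = (\<Sum>e | e dvd n. \<Sum>f | f dvd n div e. F e f)"
proof -
  have "(\<Sum>d | d dvd n. \<Sum>e | e dvd d. F e (d div e)) =
    (\<Sum>(d,e)\<in>(SIGMA d:{d. d dvd n}. {e. e dvd d}). F e (d div e))"
    using assms by (subst sum.Sigma) (auto dest: dvd_pos_nat intro!: finite_divisors_nat)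
  also have "\<dots> = (\<Sum>(e,f)\<in>(SIGMA e:{e. e dvd n}. {f. f dvd n div e}). F e f)"
  proof (rule sum.reindex_bij_witness[of _ "\<lambda>(e,f). (e*f,e)" "\<lambda>(d,e). (e, d div e)"], goal_cases)
    case (2 a)
    then obtain d e where "a = (d,e)" "d dvd n" "e dvd d" by auto
    moreover from this have "d > 0" "e > 0" using assms by (auto intro: dvd_pos_nat)
    ultimately show ?case by (auto simp: dvd_div_iff_mult intro: dvd_trans)
  next
    case (4 a)
    then obtain e f where a: "a = (e,f)" "e dvd n" "f dvd n div e" by auto
    then have "e > 0" using assms by (auto intro: dvd_pos_nat)
    then have "e * f dvd n" using a by (simp add: dvd_div_iff_mult mult.commute)
    with a \<open>e > 0\<close> show ?case by simp
  next
    case (3 a)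
    then obtain e f where a: "a = (e,f)" "e dvd n" by auto
    then have "e > 0" using assms by (auto intro: dvd_pos_nat)
    then show ?case using a by simp
  qed auto
  also have "\<dots> = (\<Sum>e | e dvd n. \<Sum>f | f dvd n div e. F e f)"
    using assms by (subst sum.Sigma) (auto dest: dvd_pos_nat intro!: finite_divisors_nat simp: dvd_div_eq_0_iff)
  finally show ?thesis .
qed

text \<open>Both sides run over the pairs with \<open>d * e\<close> at most \<open>x\<close>. Since
  the cofactor is an argument of \<open>F\<close>, any summatory function of a convolution can be
  opened in this way.\<close>

lemma sum_divisors_hyperbola:
  fixes F :: "nat \<Rightarrow> nat \<Rightarrow> 'a::comm_monoid_add"
  shows "(\<Sum>n\<in>nats_upto x. \<Sum>d | d dvd n. F d (n div d)) =
         (\<Sum>d\<in>nats_upto x. \<Sum>e\<in>nats_upto (x / real d). F d e)"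
proof -
  have "(\<Sum>n\<in>nats_upto x. \<Sum>d | d dvd n. F d (n div d)) =
     (\<Sum>(n,d)\<in>(SIGMA n:nats_upto x. {d. d dvd n}). F d (n div d))"
    by (subst sum.Sigma) auto
  also have "\<dots> = (\<Sum>(d,e)\<in>(SIGMA d:nats_upto x. nats_upto (x / real d)). F d e)"
  proof (rule sum.reindex_bij_witness[of _ "\<lambda>(d,e). (d*e,d)" "\<lambda>(n,d). (d, n div d)"], goal_cases)
    case (2 a)
    then obtain n d where a: "a = (n,d)" "0 < n" "real n \<le> x" "d dvd n" by auto
    then have d: "d > 0" by (auto intro: dvd_pos_nat)
    obtain e where e: "n = d * e" using a by (elim dvdE)
    have "e > 0" using e a by (cases e) auto
    moreover from this have "real d * 1 \<le> real d * real e" by (intro mult_left_mono) auto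
    ultimately have "e > 0" "real d \<le> real d * real e" by auto
    moreover have "real d * real e \<le> x" using a e by simp
    ultimately have "real d \<le> x" "real e \<le> x / real d"
      using d by (linarith, simp add: field_simps)
    then show ?case using a e d \<open>e > 0\<close> by simp
  next
    case (4 a)
    then obtain d e where a: "a = (d,e)" "0 < d" "0 < e" "real e \<le> x / real d" by auto
    then show ?case by (auto simp: field_simps)
  qed auto
  also have "\<dots> = (\<Sum>d\<in>nats_upto x. \<Sum>e\<in>nats_upto (x / real d). F d e)"
    by (subst sum.Sigma) auto
  finally show ?thesis .
qed

text \<open>The inverse map is the product of a set of primes. Through this bijection a sum over
  squarefree divisors becomes a sum over subsets, and hence a product over primes.\<close>

lemma bij_betw_squarefree_divisors:
  assumes "n > (0::nat)"
  shows "bij_betw prime_factors {d. d dvd n \<and> squarefree d} (Pow (prime_factors n))"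
proof (rule bij_betwI[where g = "\<lambda>A. \<Prod>A"])
  show "prime_factors \<in> {d. d dvd n \<and> squarefree d} \<rightarrow> Pow (prime_factors n)"
    using assms dvd_prime_factors[of n] by auto
  have pf: "prime_factors (\<Prod>A) = A" if "A \<subseteq> prime_factors n" for A
  proof -
    have "finite A" using that finite_subset by blast
    then show ?thesis using that
      by (subst prime_factors_prod) (auto simp: prime_prime_factors subset_iff in_prime_factors_iff
            prime_factorization_prime)
  qed
  show "(\<lambda>A. \<Prod>A) \<in> Pow (prime_factors n) \<rightarrow> {d. d dvd n \<and> squarefree d}"
  proof
    fix A assume A: "A \<in> Pow (prime_factors n)"
    have "\<Prod>A dvd (\<Prod>p\<in>prime_factors n. p)"
      using A by (intro prod_dvd_prod_subset) auto
    also have "(\<Prod>p\<in>prime_factors n. p) dvd (\<Prod>p\<in>prime_factors n. p ^ multiplicity p n)"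
      by (intro prod_dvd_prod dvd_power) (auto simp: prime_factors_multiplicity)
    also have "\<dots> = n" using assms prod_prime_factors[of n] by simp
    finally have "\<Prod>A dvd n" .
    moreover have "squarefree (\<Prod>A)"
      by (rule squarefree_prod_coprime) (use A in \<open>auto intro: primes_coprime squarefree_prime\<close>)
    ultimately show "\<Prod>A \<in> {d. d dvd n \<and> squarefree d}" by simp
  qed
  show "\<Prod>(prime_factors d) = d" if "d \<in> {d. d dvd n \<and> squarefree d}" for d
  proof -
    have "d \<noteq> 0" using that assms by (auto dest: dvd_pos_nat)
    moreover have "\<forall>p\<in>prime_factors d. multiplicity p d = 1"
      using that \<open>d \<noteq> 0\<close> squarefree_factorial_semiring' by blast
    ultimately show ?thesis
      using prod_prime_factors[of d] by simp
  qed
  show "prime_factors (\<Prod>A) = A" if "A \<in> Pow (prime_factors n)" for A using that pf by simp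
qed

lemma sum_squarefree_divisors:
  fixes G :: "nat set \<Rightarrow> 'a::comm_monoid_add"
  assumes "n > 0"
  shows "(\<Sum>d | d dvd n \<and> squarefree d. G (prime_factors d)) = (\<Sum>A\<in>Pow (prime_factors n). G A)"
  by (rule sum.reindex_bij_betw[OF bij_betw_squarefree_divisors[OF assms]])

text \<open>Expanding the right side over subsets of the prime factors gives the left side;
  \<open>moebius\<close> supplies the sign and discards the divisors that are not
  squarefree.\<close>

lemma sum_moebius_prod:
  fixes w :: "nat \<Rightarrow> real"
  assumes "n > 0"
  shows "(\<Sum>d | d dvd n. moebius d * (\<Prod>p\<in>prime_factors d. w p)) = (\<Prod>p\<in>prime_factors n. 1 - w p)"
proof -
  have "(\<Sum>d | d dvd n. moebius d * (\<Prod>p\<in>prime_factors d. w p)) =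
     (\<Sum>d | d dvd n \<and> squarefree d. (- 1) ^ card (prime_factors d) * (\<Prod>p\<in>prime_factors d. w p))"
    using assms by (intro sum.mono_neutral_cong_right) (auto simp: moebius_def)
  also have "\<dots> = (\<Prod>p\<in>prime_factors n. 1 - w p)"
    using sum_squarefree_divisors[OF assms, of "\<lambda>A. (- 1) ^ card A * (\<Prod>p\<in>A. w p)"]
    by (simp add: prod_diff_conv_sum)
  finally show ?thesis .
qed

lemma sum_squarefree_prod:
  fixes w :: "nat \<Rightarrow> real"
  assumes "n > 0"
  shows "(\<Sum>d | d dvd n \<and> squarefree d. (\<Prod>p\<in>prime_factors d. w p)) = (\<Prod>p\<in>prime_factors n. 1 + w p)"
  using sum_squarefree_divisors[OF assms, of "\<lambda>A. \<Prod>p\<in>A. w p"] prod_add[of "prime_factors n" w "\<lambda>_. 1"]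
  by (simp add: add.commute)

lemma prime_factors_eq_empty_nat: "prime_factors n = {} \<longleftrightarrow> n \<le> (1::nat)"
proof
  assume "prime_factors n = {}"
  then have "n = 0 \<or> \<not> (\<exists>p. prime p \<and> p dvd n)" using prime_factors_dvd[of n] by blast
  then show "n \<le> 1" using prime_factor_nat[of n] by auto
next
  assume "n \<le> 1"
  then have "n = 0 \<or> n = 1" by auto
  then show "prime_factors n = {}" by auto
qed

lemma sum_moebius:
  assumes "n > 0"
  shows "(\<Sum>d | d dvd n. moebius d) = (if n = 1 then 1 else 0)"
proof -
  have "(\<Sum>d | d dvd n. moebius d) = (\<Prod>p\<in>prime_factors n. 0)"
    using sum_moebius_prod[OF assms, of "\<lambda>_. 1"] by simp
  also have "\<dots> = (if n = 1 then 1 else 0)"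
  proof (cases "n = 1")
    case False
    then have "prime_factors n \<noteq> {}" using assms prime_factors_eq_empty_nat[of n] by simp
    then have "card (prime_factors n) > 0" by (subst card_gt_0_iff) simp
    then show ?thesis using False by (simp add: zero_power)
  qed simp
  finally show ?thesis .
qed

lemma moebius_1 [simp]: "moebius 1 = 1" "moebius (Suc 0) = 1"
  by (simp_all add: moebius_def)

lemma abs_moebius_le: "\<bar>moebius n\<bar> \<le> 1"
  by (simp add: moebius_def power_abs)

lemma moebius_square: "moebius n * moebius n = (if squarefree n then 1 else 0)"
  by (simp add: moebius_def flip: power_mult_distrib)

lemma prime_factors_mult_nat:
  assumes "a > 0" "b > (0::nat)"
  shows "prime_factors (a * b) = prime_factors a \<union> prime_factors b"
  using assms by (simp add: prime_factors_product)

lemma prime_factors_disjoint: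
  assumes "coprime a (b::nat)"
  shows "prime_factors a \<inter> prime_factors b = {}"
proof -
  have False if "prime p" "p dvd a" "p dvd b" for p
    using that assms coprime_common_divisor not_prime_unit by blast
  thus ?thesis by (auto simp: in_prime_factors_iff)
qed

lemma prod_prime_factors_mult:
  fixes w :: "nat \<Rightarrow> 'a::comm_monoid_mult"
  assumes "coprime a b" "a > 0" "b > 0"
  shows "(\<Prod>p\<in>prime_factors (a * b). w p) = (\<Prod>p\<in>prime_factors a. w p) * (\<Prod>p\<in>prime_factors b. w p)"
  using assms by (subst prime_factors_mult_nat) (auto simp: prod.union_disjoint prime_factors_disjoint)

lemma moebius_mult:
  assumes "coprime a b"
  shows "moebius (a * b) = moebius a * moebius b"
proof (cases "a = 0 \<or> b = 0")
  case False
  then have "card (prime_factors (a * b)) = card (prime_factors a) + card (prime_factors b)"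
    by (simp add: prime_factors_mult_nat card_Un_disjoint prime_factors_disjoint assms)
  then show ?thesis
    using assms squarefree_mult_coprime[of a b] squarefree_multD[of a b]
    by (auto simp: moebius_def power_add)
qed (auto simp: moebius_def)

lemma squarefree_mult_imp_coprime:
  assumes "squarefree (a * b :: nat)"
  shows "coprime a b"
proof (rule coprimeI)
  fix c assume "c dvd a" "c dvd b"
  then have "c ^ 2 dvd a * b" by (simp add: power2_eq_square mult_dvd_mono)
  with assms show "is_unit c" by (rule squarefreeD)
qed

text \<open>Inserting \<open>F\<close> and regrouping by \<open>sum_divisors_assoc\<close> leaves a
  full divisor sum of \<open>moebius\<close> for each \<open>e\<close>, which is zero unless
  \<open>e = n\<close>. The hypothesis is demanded only at divisors of \<open>n\<close>, which are
  positive.\<close>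

lemma moebius_inversion:
  fixes f F :: "nat \<Rightarrow> real"
  assumes "n > 0" and F: "\<And>m. m dvd n \<Longrightarrow> F m = (\<Sum>d | d dvd m. f d)"
  shows "f n = (\<Sum>d | d dvd n. F d * moebius (n div d))"
proof -
  have "(\<Sum>d | d dvd n. F d * moebius (n div d)) = (\<Sum>e | e dvd n. moebius e * F (n div e))"
    using sum_divisors_flip[OF assms(1), of "\<lambda>d e. F d * moebius e"] by (simp add: mult.commute)
  also have "\<dots> = (\<Sum>e | e dvd n. \<Sum>d | d dvd n div e. moebius e * f d)"
    using assms(1) by (intro sum.cong refl) (auto simp: F div_dvd_iff_mult dvd_pos_nat sum_distrib_left)
  also have "\<dots> = (\<Sum>m | m dvd n. \<Sum>e | e dvd m. moebius e * f (m div e))"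
    by (rule sum_divisors_assoc[symmetric, OF assms(1), where F = "\<lambda>e d. moebius e * f d"])
  also have "\<dots> = (\<Sum>m | m dvd n. \<Sum>e | e dvd m. f e * moebius (m div e))"
  proof (intro sum.cong[of "{m. m dvd n}"] refl)
    fix m assume "m \<in> {m. m dvd n}"
    then have "m > 0" using assms(1) by (auto dest: dvd_pos_nat)
    from sum_divisors_flip[OF this, of "\<lambda>d e. moebius d * f e"]
    show "(\<Sum>e | e dvd m. moebius e * f (m div e)) = (\<Sum>e | e dvd m. f e * moebius (m div e))"
      by (simp add: mult.commute)
  qed
  also have "\<dots> = (\<Sum>e | e dvd n. \<Sum>d | d dvd n div e. f e * moebius d)"
    by (rule sum_divisors_assoc[OF assms(1)])
  also have "\<dots> = (\<Sum>e | e dvd n. if e = n then f e else 0)"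
  proof (intro sum.cong refl)
    fix e assume "e \<in> {e. e dvd n}"
    then have *: "n div e > 0" "n div e = 1 \<longleftrightarrow> e = n" using assms(1)
      by (auto simp: dvd_div_eq_0_iff elim!: dvdE)
    show "(\<Sum>d | d dvd n div e. f e * moebius d) = (if e = n then f e else 0)"
      unfolding sum_distrib_left[symmetric] sum_moebius[OF *(1)] using *(2) by simp
  qed
  also have "\<dots> = f n" using assms(1) by (simp add: sum.delta)
  finally show ?thesis by simp
qed

text \<open>These are the coefficients of the derivative of 1/zeta, read as (1/zeta) times (-
  zeta'/zeta). Inverting \<open>mangoldt_sum\<close> shows that \<open>mangoldt\<close> is the
  divisor sum of \<open>- moebius d * ln d\<close>; inverting that relation once more is the
  claim.\<close>

lemma moebius_mangoldt:
  assumes "n > 0"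
  shows "(\<Sum>d | d dvd n. moebius d * mangoldt (n div d)) = - moebius n * ln (real n)"
proof -
  let ?F = "\<lambda>m. - (mangoldt m :: real)"
  have "moebius n * ln (real n) = (\<Sum>d | d dvd n. ?F d * moebius (n div d))"
  proof (rule moebius_inversion[OF assms])
    fix m assume "m dvd n"
    then have m: "m > 0" using assms by (rule dvd_pos_nat[rotated])
    have "(mangoldt m :: real) = (\<Sum>d | d dvd m. ln (real d) * moebius (m div d))"
      by (rule moebius_inversion[OF m]) (use mangoldt_sum[where 'a = real] m in \<open>auto dest: dvd_pos_nat\<close>)
    also have "\<dots> = (\<Sum>d | d dvd m. ln (real (m div d)) * moebius d)"
      by (rule sum_divisors_flip[OF m, of "\<lambda>a b. ln (real a) * moebius b"])
    also have "\<dots> = (\<Sum>d | d dvd m. ln (real m) * moebius d - moebius d * ln (real d))"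
    proof (intro sum.cong refl)
      fix d assume "d \<in> {d. d dvd m}"
      then have "d dvd m" "d > 0" using m by (auto dest: dvd_pos_nat)
      then show "ln (real (m div d)) * moebius d = ln (real m) * moebius d - moebius d * ln (real d)"
        using m by (simp add: real_of_nat_div ln_div algebra_simps)
    qed
    also have "\<dots> = - (\<Sum>d | d dvd m. moebius d * ln (real d))"
      using m by (simp add: sum_subtractf sum_moebius flip: sum_distrib_left)
    finally show "?F m = (\<Sum>d | d dvd m. moebius d * ln (real d))" by simp
  qed
  then show ?thesis
    using sum_divisors_flip[OF assms, of "\<lambda>d e. moebius d * mangoldt e :: real"]
    by (simp add: sum_negf mult.commute)
qed

section \<open>Sums of the Moebius function from the prime number theorem\<close>

text \<open>\<open>b - g\<close> increases and is bounded while \<open>g\<close> decreases, so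
  \<open>b\<close> converges. Summing the step bound from \<open>n\<close> onwards gives
  \<open>g n\<close> as the rate. Constants such as Euler's are obtained from this together with an
  explicit error.\<close>

lemma telescoping_limit:
  fixes b g :: "nat \<Rightarrow> real"
  assumes step: "\<And>n. n \<ge> M \<Longrightarrow> \<bar>b (Suc n) - b n\<bar> \<le> g n - g (Suc n)"
    and nonneg: "\<And>n. n \<ge> M \<Longrightarrow> 0 \<le> g n"
  obtains l where "\<And>n. n \<ge> M \<Longrightarrow> \<bar>b n - l\<bar> \<le> g n"
proof -
  have diff: "\<bar>b (n + k) - b n\<bar> \<le> g n - g (n + k)" if "n \<ge> M" for n k
  proof (induction k)
    case (Suc k)
    have "\<bar>b (Suc (n + k)) - b (n + k)\<bar> \<le> g (n + k) - g (Suc (n + k))"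
      using step[of "n + k"] that by simp
    with Suc show ?case by simp
  qed simp
  define f where "f = (\<lambda>k. b (M + k) - g (M + k))"
  define h where "h = (\<lambda>k. g (M + k))"
  have step': "\<bar>b (Suc (M + k)) - b (M + k)\<bar> \<le> g (M + k) - g (Suc (M + k))" for k
    using step[of "M + k"] by simp
  have "incseq f"
  proof (rule incseq_SucI)
    show "f k \<le> f (Suc k)" for k using step'[of k] unfolding f_def add_Suc_right by linarith
  qed
  moreover have "f k \<le> b M + g M" for k
    using diff[of M k] nonneg[of "M + k"] by (simp add: f_def)
  ultimately obtain lf where lf: "f \<longlonglongrightarrow> lf" using incseq_convergent by blast
  have "decseq h"
  proof (rule decseq_SucI)
    show "h (Suc k) \<le> h k" for k using step'[of k] unfolding h_def add_Suc_right by linarith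
  qed
  moreover have "h k \<ge> 0" for k using nonneg by (simp add: h_def)
  ultimately obtain lh where lh: "h \<longlonglongrightarrow> lh" using decseq_convergent by blast
  have lim: "(\<lambda>k. b (M + k)) \<longlonglongrightarrow> lf + lh"
    using tendsto_add[OF lf lh] by (simp add: f_def h_def)
  show ?thesis
  proof (rule that)
    fix n assume n: "n \<ge> M"
    have "\<forall>\<^sub>F k in sequentially. \<bar>b n - b (M + k)\<bar> \<le> g n"
    proof (rule eventually_sequentiallyI)
      fix k assume "k \<ge> n - M"
      then have "M + k = n + (M + k - n)" using n by simp
      then obtain i where "M + k = n + i" by blast
      then show "\<bar>b n - b (M + k)\<bar> \<le> g n"
        using diff[OF n, of i] nonneg[of "n + i"] n by simp
    qed
    moreover have "(\<lambda>k. \<bar>b n - b (M + k)\<bar>) \<longlonglongrightarrow> \<bar>b n - (lf + lh)\<bar>"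
      by (intro tendsto_intros lim)
    ultimately show "\<bar>b n - (lf + lh)\<bar> \<le> g n"
      by (intro tendsto_upperbound) auto
  qed
qed

text \<open>Summation by parts: for a decreasing weight the total variation collapses to the first
  value, so cancellation in the partial sums of \<open>c\<close> survives the weight.\<close>

lemma Abel_sum_bound:
  fixes c w :: "nat \<Rightarrow> real"
  assumes "M < N"
    and mono: "\<And>n. M < n \<Longrightarrow> n < N \<Longrightarrow> w (Suc n) \<le> w n" and "0 \<le> w N"
    and S: "\<And>n. n \<le> N \<Longrightarrow> \<bar>\<Sum>a\<in>{M<..n}. c a\<bar> \<le> S"
  shows "\<bar>\<Sum>a\<in>{M<..N}. c a * w a\<bar> \<le> S * w (Suc M)"
proof -
  \<comment> \<open>Invariant: apart from the boundary term, the error spent so far is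
    \<open>S\<close> times the decrease of \<open>w\<close>. The boundary term at \<open>N\<close>
    then costs the remaining \<open>S * w N\<close>.\<close>
  have "n \<le> N \<longrightarrow> \<bar>(\<Sum>a\<in>{M<..n}. c a * w a) - (\<Sum>a\<in>{M<..n}. c a) * w n\<bar> \<le> S * (w (Suc M) - w n)"
    if "Suc M \<le> n" for n
    using that
  proof (induction n rule: dec_induct)
    case base
    have "{M<..Suc M} = {Suc M}" by auto
    then show ?case by simp
  next
    case (step n)
    show ?case
    proof
      assume le: "Suc n \<le> N"
      have "{M<..Suc n} = insert (Suc n) {M<..n}" using step by auto
      then have "(\<Sum>a\<in>{M<..Suc n}. c a * w a) - (\<Sum>a\<in>{M<..Suc n}. c a) * w (Suc n) =
        ((\<Sum>a\<in>{M<..n}. c a * w a) - (\<Sum>a\<in>{M<..n}. c a) * w n) + (\<Sum>a\<in>{M<..n}. c a) * (w n - w (Suc n))"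
        by (simp add: algebra_simps)
      moreover have "\<bar>(\<Sum>a\<in>{M<..n}. c a) * (w n - w (Suc n))\<bar> \<le> S * (w n - w (Suc n))"
        unfolding abs_mult using S[of n] mono[of n] step le by (intro mult_mono) auto
      ultimately show "\<bar>(\<Sum>a\<in>{M<..Suc n}. c a * w a) - (\<Sum>a\<in>{M<..Suc n}. c a) * w (Suc n)\<bar>
          \<le> S * (w (Suc M) - w (Suc n))"
        using step le by (simp add: algebra_simps)
    qed
  qed
  from this[of N] have "\<bar>(\<Sum>a\<in>{M<..N}. c a * w a) - (\<Sum>a\<in>{M<..N}. c a) * w N\<bar> \<le> S * (w (Suc M) - w N)"
    using assms(1) by simp
  moreover have "\<bar>(\<Sum>a\<in>{M<..N}. c a) * w N\<bar> \<le> S * w N"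
    unfolding abs_mult using S[of N] \<open>0 \<le> w N\<close> by (intro mult_mono) auto
  ultimately show ?thesis by (simp add: algebra_simps)
qed

text \<open>At integers the error 1/n telescopes, because ln(1 + 1/n) lies between 1/(n + 1) and
  1/n. Passing from the integer part N to \<open>y\<close> costs another 1/N, and \<open>y\<close>
  is at most 2 N; hence the 4.\<close>

lemma sum_inverse_nats_upto:
  "\<exists>\<gamma>. \<forall>y\<ge>1. \<bar>(\<Sum>b\<in>nats_upto y. 1 / real b) - ln y - \<gamma>\<bar> \<le> 4 / y"
proof -
  define b where "b = (\<lambda>N. (\<Sum>n=1..N. 1 / real n) - ln (real N))"
  obtain \<gamma> where \<gamma>: "\<And>n. n \<ge> 1 \<Longrightarrow> \<bar>b n - \<gamma>\<bar> \<le> 1 / real n"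
  proof (rule telescoping_limit[of 1 b "\<lambda>n. 1 / real n"])
    fix n :: nat assume n: "n \<ge> 1"
    have "b (Suc n) - b n = 1 / real (Suc n) - (ln (real (Suc n)) - ln (real n))"
      by (simp add: b_def)
    moreover have "ln (real (Suc n)) - ln (real n) = ln (1 + 1 / real n)"
    proof -
      have "1 + 1 / real n = real (Suc n) / real n" using n by (simp add: field_simps)
      then show ?thesis using n by (simp add: ln_div)
    qed
    moreover have "ln (1 + 1 / real n) \<le> 1 / real n"
      by (rule ln_add_one_self_le_self) simp
    moreover have "ln (1 + 1 / real n) \<ge> 1 / real (Suc n)"
    proof -
      have "- ln (1 + 1 / real n) = ln (1 - 1 / real (Suc n))"
        using n by (subst ln_inverse[symmetric]) (auto simp: field_simps)
      also have "\<dots> \<le> - (1 / real (Suc n))" using ln_le_minus_one[of "1 - 1 / real (Suc n)"] n by simp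
      finally show ?thesis by simp
    qed
    ultimately show "\<bar>b (Suc n) - b n\<bar> \<le> 1 / real n - 1 / real (Suc n)" by linarith
  qed auto
  show ?thesis
  proof (intro exI[of _ \<gamma>] allI impI)
    fix y :: real assume y: "y \<ge> 1"
    define N where "N = nat \<lfloor>y\<rfloor>"
    have N: "N \<ge> 1" "real N \<le> y" "y < real N + 1" using y unfolding N_def by linarith+
    have "ln y - ln (real N) = ln (y / real N)" using N y by (subst ln_div) auto
    also have "\<dots> \<le> ln (1 + 1 / real N)" using N y by (subst ln_le_cancel_iff) (auto simp: field_simps)
    also have "\<dots> \<le> 1 / real N" by (rule ln_add_one_self_le_self) simp
    finally have "ln y - ln (real N) \<le> 1 / real N" .
    moreover have "ln (real N) \<le> ln y" using N y by simp
    moreover have "(\<Sum>b\<in>nats_upto y. 1 / real b) = b N + ln (real N)"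
      by (simp add: b_def nats_upto_eq N_def)
    moreover have "2 / real N \<le> 4 / y"
    proof -
      have "real N \<ge> 1" using N by simp
      then have "y \<le> 2 * real N" using N by linarith
      then show ?thesis using N(1) y by (simp add: field_simps)
    qed
    ultimately show "\<bar>(\<Sum>b\<in>nats_upto y. 1 / real b) - ln y - \<gamma>\<bar> \<le> 4 / y"
      using \<gamma>[OF N(1)] by simp
  qed
qed

section \<open>Mean values of the Moebius function\<close>

definition msum :: "real \<Rightarrow> real" where
  "msum x = (\<Sum>d\<in>nats_upto x. moebius d / real d)"

definition Tsum1 :: "real \<Rightarrow> real" where
  "Tsum1 x = (\<Sum>d\<in>nats_upto x. moebius d / real d * ln (x / real d))"

text \<open>The prime number theorem enters as an assumption and is later drawn from the level of
  distribution by \<open>prime_number_estimate_of_level\<close>. Two powers of the logarithm are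
  asked for because partial summation loses one and a rate has to remain.\<close>

locale prime_number_estimate =
  fixes C\<^sub>0 :: real
  assumes psi_bound: "x \<ge> 2 \<Longrightarrow> \<bar>(\<Sum>n\<in>nats_upto x. mangoldt n) - x\<bar> \<le> C\<^sub>0 * x / (ln x)\<^sup>2"
begin

lemma C0_nonneg: "C\<^sub>0 \<ge> 0"
proof -
  have "0 \<le> C\<^sub>0 * 2 / (ln 2)\<^sup>2" using psi_bound[of 2] by linarith
  then show ?thesis by (simp add: zero_le_divide_iff)
qed

text \<open>Partial summation of psi(n) - n against 1/n. The denominator is \<open>1 + ln y\<close>
  so that the bound keeps its meaning at \<open>y = 1\<close>.\<close>

lemma sum_mangoldt_over:
  "\<exists>c. \<exists>K\<ge>0. \<forall>y\<ge>1. \<bar>(\<Sum>b\<in>nats_upto y. mangoldt b / real b) - ln y - c\<bar> \<le> K / (1 + ln y)"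
proof -
  define D where "D = (\<lambda>N. (\<Sum>n=1..N. mangoldt n) - real N)"
  define a where "a = (\<lambda>N. \<Sum>n=1..N. (mangoldt n - 1) / real n)"
  \<comment> \<open>Removing the boundary term of partial summation leaves the increments D(m)/(m (m
    + 1)) with \<open>m = Suc n\<close>, which are absolutely summable.\<close>
  define b where "b = (\<lambda>N. a N - D N / real (Suc N))"
  have D: "\<bar>D N\<bar> \<le> C\<^sub>0 * real N / (ln (real N))\<^sup>2" if "N \<ge> 2" for N
    using psi_bound[of "real N"] that by (simp add: nats_upto_eq D_def)
  obtain c' where c': "\<And>n. n \<ge> 2 \<Longrightarrow> \<bar>b n - c'\<bar> \<le> C\<^sub>0 / ln (real n)"
  proof (rule telescoping_limit[of 2 b "\<lambda>n. C\<^sub>0 / ln (real n)"])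
    fix n :: nat assume n: "n \<ge> 2"
    define m where "m = Suc n"
    have DS: "D (Suc n) = D n + mangoldt m - 1" by (simp add: D_def m_def)
    have aS: "a (Suc n) = a n + (mangoldt m - 1) / real m" by (simp add: a_def m_def)
    have "b (Suc n) - b n = D m / (real m * real (Suc m))"
    proof -
      have "b (Suc n) - b n = (mangoldt m - 1) / real m - D m / (real m + 1) + (D m - mangoldt m + 1) / real m"
        unfolding b_def aS using DS by (simp add: m_def)
      also have "\<dots> = D m / real m - D m / (real m + 1)"
        by (simp add: diff_divide_distrib add_divide_distrib)
      also have "\<dots> = D m / (real m * real (Suc m))" using n by (simp add: m_def field_simps)
      finally show ?thesis .
    qed
    then have "\<bar>b (Suc n) - b n\<bar> = \<bar>D m\<bar> / (real m * real (Suc m))" by (simp add: abs_mult)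
    also have "\<dots> \<le> (C\<^sub>0 * real m / (ln (real m))\<^sup>2) / (real m * real (Suc m))"
      using D[of m] n by (intro divide_right_mono) (auto simp: m_def)
    also have "\<dots> = C\<^sub>0 / (real (Suc m) * (ln (real m))\<^sup>2)"
    proof -
      have "real m \<noteq> 0" by (simp add: m_def)
      then show ?thesis by (simp del: of_nat_Suc)
    qed
    also have "\<dots> \<le> C\<^sub>0 * (1 / real m / (ln (real m) * ln (real n)))"
    proof -
      have "ln (real n) > 0" "ln (real n) \<le> ln (real m)" using n by (auto simp: m_def)
      then have "real m * (ln (real m) * ln (real n)) \<le> real (Suc m) * (ln (real m) * ln (real m))"
        by (intro mult_mono) auto
      moreover have "real m * (ln (real m) * ln (real n)) > 0" using n \<open>ln (real n) > 0\<close> by (simp add: m_def)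
      ultimately have "1 / (real (Suc m) * (ln (real m))\<^sup>2) \<le> 1 / (real m * (ln (real m) * ln (real n)))"
        unfolding power2_eq_square by (intro divide_left_mono) (auto intro!: mult_pos_pos simp: m_def)
      from mult_left_mono[OF this C0_nonneg] show ?thesis by simp
    qed
    \<comment> \<open>As 1/m is at most ln m - ln n, the bound becomes a difference of consecutive
      values of \<open>C\<^sub>0\<close> / ln, which is the form that telescoping needs.\<close>
    also have "\<dots> \<le> C\<^sub>0 * ((ln (real m) - ln (real n)) / (ln (real m) * ln (real n)))"
    proof (intro mult_left_mono divide_right_mono C0_nonneg)
      have "ln (real n / real m) \<le> real n / real m - 1" using n by (intro ln_le_minus_one) (auto simp: m_def)
      moreover have "ln (real n / real m) = ln (real n) - ln (real m)" using n by (subst ln_div) (auto simp: m_def)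
      moreover have "real n / real m - 1 = - (1 / real m)" using n by (simp add: m_def field_simps)
      ultimately show "1 / real m \<le> ln (real m) - ln (real n)" by linarith
      show "0 \<le> ln (real m) * ln (real n)" using n by (simp add: m_def)
    qed
    also have "\<dots> = C\<^sub>0 / ln (real n) - C\<^sub>0 / ln (real (Suc n))"
    proof -
      have "ln (real n) > 0" "ln (real m) > 0" using n by (auto simp: m_def)
      then show ?thesis by (simp add: m_def[symmetric] field_simps)
    qed
    finally show "\<bar>b (Suc n) - b n\<bar> \<le> C\<^sub>0 / ln (real n) - C\<^sub>0 / ln (real (Suc n))" .
  qed (use C0_nonneg in auto)
  obtain \<gamma> where \<gamma>: "\<And>y. y \<ge> 1 \<Longrightarrow> \<bar>(\<Sum>b\<in>nats_upto y. 1 / real b) - ln y - \<gamma>\<bar> \<le> 4 / y"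
    using sum_inverse_nats_upto by blast
  define K where "K = 12 * C\<^sub>0 + 2 * (1 + \<bar>c'\<bar>) + 4"
  show ?thesis
  proof (rule exI[of _ "c' + \<gamma>"], rule exI[of _ K], intro conjI allI impI)
    show "K \<ge> 0" using C0_nonneg by (simp add: K_def)
    fix y :: real assume y: "y \<ge> 1"
    define N where "N = nat \<lfloor>y\<rfloor>"
    have N: "N \<ge> 1" "real N \<le> y" "y < real N + 1" using y unfolding N_def by linarith+
    have lny: "0 \<le> ln y" "1 + ln y \<le> y" using y ln_le_minus_one[of y] by auto
    have split: "(\<Sum>b\<in>nats_upto y. mangoldt b / real b) = a N + (\<Sum>b\<in>nats_upto y. 1 / real b)"
      by (simp add: a_def nats_upto_eq N_def diff_divide_distrib sum_subtractf)
    have aN: "\<bar>a N - c'\<bar> \<le> (12 * C\<^sub>0 + 2 * (1 + \<bar>c'\<bar>)) / (1 + ln y)"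
    \<comment> \<open>At \<open>N = 1\<close> a comparison with 1 / ln N is impossible; there
      \<open>ln y\<close> is at most 1 and a constant is enough.\<close>
    proof (cases "N = 1")
      case True
      then have "y < 2" using N by simp
      then have "ln y \<le> 1" using lny by linarith
      have "\<bar>a N - c'\<bar> \<le> 1 + \<bar>c'\<bar>" using True by (simp add: a_def)
      also have "\<dots> \<le> 2 * (1 + \<bar>c'\<bar>) / (1 + ln y)"
      proof -
        have "(1 + \<bar>c'\<bar>) * (1 + ln y) \<le> (1 + \<bar>c'\<bar>) * 2" using \<open>ln y \<le> 1\<close> by (intro mult_left_mono) auto
        then show ?thesis using lny by (simp add: pos_le_divide_eq mult.commute)
      qed
      also have "\<dots> \<le> (12 * C\<^sub>0 + 2 * (1 + \<bar>c'\<bar>)) / (1 + ln y)"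
        using C0_nonneg lny by (intro divide_right_mono) auto
      finally show ?thesis .
    next
      case False
      then have N2: "N \<ge> 2" using N by simp
      have lnN: "ln (real N) \<ge> 1/2"
      proof -
        have "(1/2::real) \<le> ln 2" using ln2_ge_two_thirds by simp
        also have "\<dots> \<le> ln (real N)" using N2 by (subst ln_le_cancel_iff) auto
        finally show ?thesis .
      qed
      have "2 * real N \<le> real N * real N" using N2 by (intro mult_right_mono) auto
      moreover have "2 \<le> real N" using N2 by simp
      ultimately have "y \<le> real N * real N" using N by linarith
      then have "ln y \<le> ln (real N * real N)" using y by simp
      also have "\<dots> = 2 * ln (real N)" using N2 by (simp add: ln_mult)
      finally have lny4: "1 + ln y \<le> 4 * ln (real N)" using lnN by simp
      have "\<bar>D N / real (Suc N)\<bar> \<le> 2 * C\<^sub>0 / ln (real N)"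
      proof -
        have "\<bar>D N / real (Suc N)\<bar> \<le> (C\<^sub>0 * real N / (ln (real N))\<^sup>2) / real (Suc N)"
          using divide_right_mono[OF D[OF N2], of "real (Suc N)"] by (simp only: abs_divide) simp
        also have "\<dots> = (C\<^sub>0 / (ln (real N))\<^sup>2) * (real N / real (Suc N))" by simp
        also have "\<dots> \<le> (C\<^sub>0 / (ln (real N))\<^sup>2) * 1"
          using C0_nonneg by (intro mult_left_mono) auto
        also have "\<dots> = (C\<^sub>0 / ln (real N)) * (1 / ln (real N))" by (simp add: power2_eq_square)
        also have "\<dots> \<le> (C\<^sub>0 / ln (real N)) * 2"
          using C0_nonneg lnN by (intro mult_left_mono) (auto simp: field_simps)
        finally show ?thesis by (simp add: mult.commute)
      qed
      moreover have "\<bar>b N - c'\<bar> \<le> C\<^sub>0 / ln (real N)" by (rule c'[OF N2])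
      moreover have "a N - c' = (b N - c') + D N / real (Suc N)" by (simp add: b_def)
      moreover have "3 * C\<^sub>0 / ln (real N) = 2 * C\<^sub>0 / ln (real N) + C\<^sub>0 / ln (real N)"
        by (simp add: add_divide_distrib[symmetric])
      ultimately have "\<bar>a N - c'\<bar> \<le> 3 * C\<^sub>0 / ln (real N)" by linarith
      also have "\<dots> \<le> 12 * C\<^sub>0 / (1 + ln y)"
      proof -
        have "3 * C\<^sub>0 * (1 + ln y) \<le> 3 * C\<^sub>0 * (4 * ln (real N))" using lny4 C0_nonneg by (intro mult_left_mono) auto
        then show ?thesis using lnN lny by (simp add: divide_le_eq le_divide_eq mult.commute)
      qed
      also have "\<dots> \<le> (12 * C\<^sub>0 + 2 * (1 + \<bar>c'\<bar>)) / (1 + ln y)"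
        using lny by (intro divide_right_mono) auto
      finally show ?thesis .
    qed
    have "4 / y \<le> 4 / (1 + ln y)" using lny y by (intro divide_left_mono mult_pos_pos) linarith+
    then show "\<bar>(\<Sum>b\<in>nats_upto y. mangoldt b / real b) - ln y - (c' + \<gamma>)\<bar> \<le> K / (1 + ln y)"
      using aN \<gamma>[OF y] unfolding split K_def add_divide_distrib by linarith
  qed
qed

text \<open>Dividing the identity \<open>id\<close> by \<open>ln x + c\<close> converts the error
  term of \<open>sum_mangoldt_over\<close> into decay of \<open>msum\<close>. The averaged error is
  estimated by cutting the range at a single point, which saves a square root of 1 + ln x; this
  crude rate suffices.\<close>

lemma msum_bound: "\<exists>K\<ge>0. \<forall>x\<ge>1. \<bar>msum x\<bar> \<le> K / sqrt (1 + ln x)"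
proof -
  obtain c K where K: "K \<ge> 0" and
    E: "\<And>y. y \<ge> 1 \<Longrightarrow> \<bar>(\<Sum>b\<in>nats_upto y. mangoldt b / real b) - ln y - c\<bar> \<le> K / (1 + ln y)"
    using sum_mangoldt_over by blast
  obtain \<gamma> where \<gamma>: "\<And>y. y \<ge> 1 \<Longrightarrow> \<bar>(\<Sum>b\<in>nats_upto y. 1 / real b) - ln y - \<gamma>\<bar> \<le> 4 / y"
    using sum_inverse_nats_upto by blast
  define \<Psi> where "\<Psi> = (\<lambda>y. \<Sum>b\<in>nats_upto y. mangoldt b / real b :: real)"
  define e where "e = (\<lambda>y. \<Psi> y - ln y - c)"
  \<comment> \<open>\<open>moebius_mangoldt\<close> divided by \<open>n\<close> is summed and the
    convolution opened; the terms with ln d cancel against those coming from ln(x/d).\<close>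
  have id: "(ln x + c) * msum x = - (\<Sum>a\<in>nats_upto x. moebius a / real a * e (x / real a))" if "x \<ge> 1" for x
  proof -
    have "(\<Sum>n\<in>nats_upto x. \<Sum>d | d dvd n. moebius d / real d * (mangoldt (n div d) / real (n div d)))
        = (\<Sum>n\<in>nats_upto x. - (moebius n / real n * ln (real n)))"
    proof (intro sum.cong refl)
      fix n assume n: "n \<in> nats_upto x"
      have "(\<Sum>d | d dvd n. moebius d / real d * (mangoldt (n div d) / real (n div d)))
         = (\<Sum>d | d dvd n. moebius d * mangoldt (n div d)) / real n"
        unfolding sum_divide_distrib by (intro sum.cong refl) (auto simp flip: of_nat_mult)
      then show "(\<Sum>d | d dvd n. moebius d / real d * (mangoldt (n div d) / real (n div d))) =
          - (moebius n / real n * ln (real n))"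
        using moebius_mangoldt[of n] n by simp
    qed
    moreover have "(\<Sum>n\<in>nats_upto x. \<Sum>d | d dvd n. moebius d / real d * (mangoldt (n div d) / real (n div d)))
        = (\<Sum>d\<in>nats_upto x. moebius d / real d * \<Psi> (x / real d))"
      unfolding \<Psi>_def sum_divisors_hyperbola[of "\<lambda>d e. moebius d / real d * (mangoldt e / real e)"]
      by (simp add: sum_distrib_left)
    moreover have "(\<Sum>d\<in>nats_upto x. moebius d / real d * \<Psi> (x / real d)) =
      (\<Sum>d\<in>nats_upto x. moebius d / real d * e (x / real d) + (ln x + c) * (moebius d / real d)
          - moebius d / real d * ln (real d))"
      using that by (intro sum.cong refl) (auto simp: e_def ln_div algebra_simps)
    ultimately show ?thesis
      by (simp add: sum.distrib sum_subtractf sum_negf msum_def sum_distrib_left)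
  qed
  define K1 where "K1 = (1 + \<bar>\<gamma>\<bar> + 16) * (2 * K + 1)"
  have K1: "K1 \<ge> 0" using K by (simp add: K1_def)
  have harm: "(\<Sum>a\<in>nats_upto x. 1 / real a) \<le> ln x + \<bar>\<gamma>\<bar> + 4" if "x \<ge> 1" for x
  proof -
    have "4 / x \<le> 4" using that by (simp add: field_simps)
    with \<gamma>[OF that] show ?thesis by linarith
  qed
  have main: "\<bar>\<Sum>a\<in>nats_upto x. moebius a / real a * e (x / real a)\<bar> \<le> K1 * sqrt (1 + ln x)" if x: "x \<ge> 1" for x
  proof -
    define s where "s = sqrt (1 + ln x)"
    have lnx: "ln x \<ge> 0" using x by simp
    have s: "s \<ge> 1" "s * s = 1 + ln x" using lnx by (auto simp: s_def)
    have e: "\<bar>e y\<bar> \<le> K / (1 + ln y)" if "y \<ge> 1" for y using E[OF that] by (simp add: e_def \<Psi>_def)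
    \<comment> \<open>With this cut, the range up to x/Y has error at most K/s against a harmonic
      sum of order s^2, and the remaining range has a harmonic sum of order ln Y = s. Both
      contribute O(s).\<close>
    define Y where "Y = exp s"
    have Y: "Y \<ge> 1" "ln Y = s" using s by (auto simp: Y_def)
    define A where "A = {a \<in> nats_upto x. real a * Y \<le> x}"
    define B where "B = nats_upto x - A"
    have "\<bar>\<Sum>a\<in>nats_upto x. moebius a / real a * e (x / real a)\<bar>
       \<le> (\<Sum>a\<in>nats_upto x. 1 / real a * \<bar>e (x / real a)\<bar>)"
      by (rule order_trans[OF sum_abs]) (auto intro!: sum_mono mult_left_le_one_le divide_right_mono simp: abs_mult abs_moebius_le)
    also have "\<dots> = (\<Sum>a\<in>A. 1 / real a * \<bar>e (x / real a)\<bar>) + (\<Sum>a\<in>B. 1 / real a * \<bar>e (x / real a)\<bar>)"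
      unfolding B_def by (subst sum.subset_diff[of A]) (auto simp: A_def)
    also have "(\<Sum>a\<in>A. 1 / real a * \<bar>e (x / real a)\<bar>) \<le> (\<Sum>a\<in>A. 1 / real a * (K / s))"
    proof (intro sum_mono mult_left_mono)
      fix a assume "a \<in> A"
      then have a: "a > 0" "real a \<le> x" "Y \<le> x / real a" by (auto simp: A_def field_simps)
      have "s \<le> ln (x / real a)" using a(3) Y ln_le_cancel_iff[of Y "x / real a"] a(1) x by simp
      moreover have "\<bar>e (x / real a)\<bar> \<le> K / (1 + ln (x / real a))" by (rule e) (use a in auto)
      moreover have "K / (1 + ln (x / real a)) \<le> K / s"
        using calculation(1) s K by (intro divide_left_mono mult_pos_pos) auto
      ultimately show "\<bar>e (x / real a)\<bar> \<le> K / s" by linarith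
    qed auto
    also have "(\<Sum>a\<in>A. 1 / real a * (K / s)) = (K / s) * (\<Sum>a\<in>A. 1 / real a)"
      by (simp add: sum_distrib_left mult.commute)
    also have "\<dots> \<le> (K / s) * (\<Sum>a\<in>nats_upto x. 1 / real a)"
      using K s by (intro mult_left_mono sum_mono2) (auto simp: A_def)
    also have "\<dots> \<le> (K / s) * (ln x + \<bar>\<gamma>\<bar> + 4)"
      using K s harm[OF x] by (intro mult_left_mono) auto
    also have "\<dots> \<le> (K / s) * ((1 + \<bar>\<gamma>\<bar> + 4) * (s * s))"
    proof (intro mult_left_mono)
      have "(\<bar>\<gamma>\<bar> + 4) * 1 \<le> (\<bar>\<gamma>\<bar> + 4) * (s * s)" using s lnx by (intro mult_left_mono) auto
      then show "ln x + \<bar>\<gamma>\<bar> + 4 \<le> (1 + \<bar>\<gamma>\<bar> + 4) * (s * s)" using s lnx by (simp add: algebra_simps)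
    qed (use K s in auto)
    also have "\<dots> = K * (1 + \<bar>\<gamma>\<bar> + 4) * s" using s(1) by simp
    also have "(\<Sum>a\<in>B. 1 / real a * \<bar>e (x / real a)\<bar>) \<le> (\<Sum>a\<in>B. 1 / real a * K)"
    proof (intro sum_mono mult_left_mono)
      fix a assume "a \<in> B"
      then have a: "a > 0" "real a \<le> x" by (auto simp: B_def)
      then have "\<bar>e (x / real a)\<bar> \<le> K / (1 + ln (x / real a))" by (intro e) auto
      also have "\<dots> \<le> K / 1" using a K by (intro divide_left_mono mult_pos_pos) (auto simp: ln_ge_zero intro!: add_pos_nonneg)
      finally show "\<bar>e (x / real a)\<bar> \<le> K" by simp
    qed auto
    also have "(\<Sum>a\<in>B. 1 / real a * K) = K * (\<Sum>a\<in>B. 1 / real a)"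
      by (simp add: sum_distrib_left mult.commute)
    also have "\<dots> \<le> K * ((1 + \<bar>\<gamma>\<bar> + 12) * s)"
    proof (intro mult_left_mono K)
      show "(\<Sum>a\<in>B. 1 / real a) \<le> (1 + \<bar>\<gamma>\<bar> + 12) * s"
      proof (cases "x \<ge> Y")
        case True
        have A_aux: "real a \<le> x" if "real a * Y \<le> x" for a :: nat
        proof -
          have "real a * 1 \<le> real a * Y" using Y by (intro mult_left_mono) auto
          with that show ?thesis by simp
        qed
        have A: "A = nats_upto (x / Y)" using Y True unfolding A_def
          by (auto simp: field_simps intro: A_aux)
        have xY: "x / Y \<ge> 1" using True Y by simp
        have "(\<Sum>a\<in>B. 1 / real a) = (\<Sum>a\<in>nats_upto x. 1 / real a) - (\<Sum>a\<in>A. 1 / real a)"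
          unfolding B_def by (subst sum_diff) (auto simp: A_def)
        also have "\<dots> \<le> (ln x + \<gamma> + 4) - (ln (x / Y) + \<gamma> - 4)"
        proof -
          have "4 / z \<le> 4" if "z \<ge> 1" for z :: real using that by (simp add: field_simps)
          from this[OF x] this[OF xY] have "4 / x \<le> 4" "4 / (x / Y) \<le> 4" .
          then show ?thesis using \<gamma>[OF x] \<gamma>[OF xY] unfolding A by linarith
        qed
        also have "\<dots> = s + 8" using x Y by (subst ln_div) auto
        also have "\<dots> \<le> (1 + \<bar>\<gamma>\<bar> + 12) * s"
        proof -
          have "(\<bar>\<gamma>\<bar> + 12) * 1 \<le> (\<bar>\<gamma>\<bar> + 12) * s" using s by (intro mult_left_mono) auto
          then show ?thesis by (simp add: algebra_simps)
        qed
        finally show ?thesis .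
      next
        case False
        have "(\<Sum>a\<in>B. 1 / real a) \<le> (\<Sum>a\<in>nats_upto x. 1 / real a)" by (intro sum_mono2) (auto simp: B_def)
        also have "\<dots> \<le> ln x + \<bar>\<gamma>\<bar> + 4" by (rule harm[OF x])
        also have "ln x \<le> s" using False x Y ln_le_cancel_iff[of x Y] by simp
        also have "s + \<bar>\<gamma>\<bar> + 4 \<le> (1 + \<bar>\<gamma>\<bar> + 12) * s"
        proof -
          have "(\<bar>\<gamma>\<bar> + 12) * 1 \<le> (\<bar>\<gamma>\<bar> + 12) * s" using s by (intro mult_left_mono) auto
          then show ?thesis by (simp add: algebra_simps)
        qed
        finally show ?thesis by simp
      qed
    qed
    finally have "\<bar>\<Sum>a\<in>nats_upto x. moebius a / real a * e (x / real a)\<bar> \<le>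
      K * (1 + \<bar>\<gamma>\<bar> + 4) * s + K * ((1 + \<bar>\<gamma>\<bar> + 12) * s)" by simp
    also have "\<dots> = (K * (1 + \<bar>\<gamma>\<bar> + 4) + K * (1 + \<bar>\<gamma>\<bar> + 12)) * s" by (simp add: algebra_simps)
    also have "\<dots> \<le> K1 * s"
    proof (intro mult_right_mono)
      have "K * \<bar>\<gamma>\<bar> \<ge> 0" using K by simp
      then show "K * (1 + \<bar>\<gamma>\<bar> + 4) + K * (1 + \<bar>\<gamma>\<bar> + 12) \<le> K1" using K by (simp add: K1_def algebra_simps)
    qed (use s in auto)
    finally show ?thesis by (simp add: s_def)
  qed
  \<comment> \<open>Beyond this value of ln x, \<open>ln x + c\<close> is at least half of
    \<open>1 + ln x\<close> and division is harmless; below it the trivial harmonic bound goes into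
    the constant.\<close>
  define L where "L = 1 + 2 * \<bar>c\<bar>"
  define K2 where "K2 = 2 * K1 + (L + \<bar>\<gamma>\<bar> + 4) * sqrt (1 + L)"
  show ?thesis
  proof (intro exI[of _ K2] conjI allI impI)
    show "K2 \<ge> 0" using K1 by (auto simp: K2_def L_def intro!: add_nonneg_nonneg mult_nonneg_nonneg)
    fix x :: real assume x: "x \<ge> 1"
    then have lnx: "ln x \<ge> 0" by simp
    show "\<bar>msum x\<bar> \<le> K2 / sqrt (1 + ln x)"
    proof (cases "ln x \<le> L")
      case True
      have "\<bar>msum x\<bar> \<le> (\<Sum>a\<in>nats_upto x. 1 / real a)"
        unfolding msum_def by (rule order_trans[OF sum_abs]) (auto intro!: sum_mono divide_right_mono abs_moebius_le)
      also have "\<dots> \<le> ln x + \<bar>\<gamma>\<bar> + 4" by (rule harm[OF x])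
      also have "\<dots> \<le> L + \<bar>\<gamma>\<bar> + 4" using True by simp
      finally have "\<bar>msum x\<bar> * sqrt (1 + ln x) \<le> (L + \<bar>\<gamma>\<bar> + 4) * sqrt (1 + L)"
        using True lnx by (intro mult_mono) (auto simp: L_def)
      then have "\<bar>msum x\<bar> * sqrt (1 + ln x) \<le> K2" using K1 by (simp add: K2_def)
      then show ?thesis using lnx by (simp add: pos_le_divide_eq)
    next
      case False
      then have "1 + ln x \<le> 2 * (ln x + c)" by (simp add: L_def)
      then have "\<bar>msum x\<bar> * (1 + ln x) \<le> \<bar>msum x\<bar> * (2 * (ln x + c))" by (intro mult_left_mono) auto
      also have "\<dots> = 2 * \<bar>(ln x + c) * msum x\<bar>" using False by (simp add: abs_mult L_def)
      also have "\<dots> \<le> 2 * (K1 * sqrt (1 + ln x))" using main[OF x] unfolding id[OF x] by simp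
      finally have "(\<bar>msum x\<bar> * sqrt (1 + ln x)) * sqrt (1 + ln x) \<le> (2 * K1) * sqrt (1 + ln x)"
        using lnx by (simp add: mult.assoc)
      then have "\<bar>msum x\<bar> * sqrt (1 + ln x) \<le> 2 * K1"
        by (rule mult_right_le_imp_le) (use lnx in auto)
      also have "2 * K1 \<le> K2" by (auto simp: K2_def L_def intro!: mult_nonneg_nonneg)
      finally show ?thesis using lnx by (simp add: pos_le_divide_eq)
    qed
  qed
qed

text \<open>The Moebius sum of the harmonic sums H(x/a) is exactly 1. Writing H as logarithm plus
  constant plus error e leaves a multiple of \<open>msum\<close> and a sum over e(x/a). Where x/a is
  large that error is small; where x/a is small, cancellation in \<open>msum\<close> takes
  over.\<close>

lemma Tsum1_bound: "\<exists>K\<ge>0. \<forall>x\<ge>1. \<bar>Tsum1 x - 1\<bar> \<le> K / sqrt (sqrt (1 + ln x))"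
proof -
  obtain \<gamma> where \<gamma>: "\<forall>y\<ge>1. \<bar>(\<Sum>b\<in>nats_upto y. 1 / real b) - ln y - \<gamma>\<bar> \<le> 4 / y"
    using sum_inverse_nats_upto by blast
  obtain K where K: "K \<ge> 0" and mb: "\<And>x. x \<ge> 1 \<Longrightarrow> \<bar>msum x\<bar> \<le> K / sqrt (1 + ln x)"
    using msum_bound by blast
  define H where "H = (\<lambda>y. \<Sum>b\<in>nats_upto y. 1 / real b)"
  define e where "e = (\<lambda>y. H y - ln y - \<gamma>)"
  define K2 where "K2 = K * \<bar>\<gamma>\<bar> + 8 + 4 * K * (2 + (2 * \<bar>\<gamma>\<bar> + 4))"
  show ?thesis
  proof (rule exI[of _ K2], intro conjI allI impI)
    show "K2 \<ge> 0" using K by (auto simp: K2_def intro!: add_nonneg_nonneg mult_nonneg_nonneg)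
    fix x :: real assume x: "x \<ge> 1"
    have one: "(\<Sum>a\<in>nats_upto x. moebius a / real a * H (x / real a)) = 1"
    proof -
      have "(\<Sum>a\<in>nats_upto x. moebius a / real a * H (x / real a)) =
        (\<Sum>n\<in>nats_upto x. \<Sum>d | d dvd n. moebius d / real d * (1 / real (n div d)))"
        unfolding H_def sum_divisors_hyperbola[of "\<lambda>d e. moebius d / real d * (1 / real e)"]
        by (simp add: sum_distrib_left)
      also have "\<dots> = (\<Sum>n\<in>nats_upto x. if n = 1 then 1 else 0)"
      proof (intro sum.cong refl)
        fix n assume n: "n \<in> nats_upto x"
        have "(\<Sum>d | d dvd n. moebius d / real d * (1 / real (n div d)))
           = (\<Sum>d | d dvd n. moebius d) / real n"
          unfolding sum_divide_distrib by (intro sum.cong refl) (auto simp flip: of_nat_mult)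
        then show "(\<Sum>d | d dvd n. moebius d / real d * (1 / real (n div d))) = (if n = 1 then 1 else 0)"
          using sum_moebius[of n] n by simp
      qed
      also have "\<dots> = 1" using x by (simp add: sum.delta)
      finally show ?thesis .
    qed
    have T: "Tsum1 x - 1 = - (\<gamma> * msum x) - (\<Sum>a\<in>nats_upto x. moebius a / real a * e (x / real a))"
      unfolding one[symmetric] Tsum1_def msum_def e_def sum_distrib_left
      by (simp add: sum_subtractf sum.distrib algebra_simps)
    define s where "s = sqrt (1 + ln x)"
    define t where "t = sqrt s"
    have lnx: "ln x \<ge> 0" using x by simp
    have s: "s \<ge> 1" "s * s = 1 + ln x" using lnx by (auto simp: s_def)
    have t: "t \<ge> 1" "t * t = s" using s by (auto simp: t_def)
    have "t * 1 \<le> t * t" using t by (intro mult_left_mono) auto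
    with t have t: "t \<ge> 1" "t * t = s" "t \<le> s" by auto
    \<comment> \<open>Here \<open>s = t * t\<close>. Terms up to x/Y give O(1/Y) and hence O(1/t);
      beyond, Abel summation gives O(1/s) times a weight of size O(ln Y), which is O(t/s) =
      O(1/t).\<close>
    define Y where "Y = exp (t / 2)"
    have Y: "Y \<ge> 1" "ln Y = t / 2" "1 / Y \<le> 2 / t"
    proof -
      show "Y \<ge> 1" "ln Y = t / 2" using t by (auto simp: Y_def)
      have "t / 2 \<le> Y" using exp_ge_add_one_self[of "t / 2"] unfolding Y_def by linarith
      then show "1 / Y \<le> 2 / t" using t \<open>Y \<ge> 1\<close> by (simp add: field_simps)
    qed
    define N where "N = nat \<lfloor>x\<rfloor>"
    define M where "M = nat \<lfloor>x / Y\<rfloor>"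
    have xY: "x / Y \<le> x" "x / Y > 0" using Y x by (auto simp: field_simps mult_le_cancel_left1)
    have MN: "M \<le> N" unfolding M_def N_def using xY by (intro nat_mono floor_mono)
    have M: "real a \<le> x / Y \<longleftrightarrow> a \<le> M" for a
      unfolding M_def using xY by (simp add: le_nat_iff le_floor_iff)
    have N: "real a \<le> x \<longleftrightarrow> a \<le> N" for a
      unfolding N_def using x by (simp add: le_nat_iff le_floor_iff)
    have "(\<Sum>a\<in>nats_upto x. moebius a / real a * e (x / real a)) =
        (\<Sum>a\<in>{1..M}. moebius a / real a * e (x / real a)) + (\<Sum>a\<in>{M<..N}. moebius a / real a * e (x / real a))"
    proof -
      have "nats_upto x = {1..M} \<union> {M<..N}" using MN by (auto simp: N)
      then show ?thesis by (simp only:) (subst sum.union_disjoint, auto)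
    qed
    moreover have "\<bar>\<Sum>a\<in>{1..M}. moebius a / real a * e (x / real a)\<bar> \<le> 8 / t"
    proof -
      have "\<bar>\<Sum>a\<in>{1..M}. moebius a / real a * e (x / real a)\<bar> \<le> (\<Sum>a\<in>{1..M}. 4 / x)"
      proof (rule order_trans[OF sum_abs], rule sum_mono)
        fix a assume a: "a \<in> {1..M}"
        then have a': "real a \<le> x" "real a > 0" using MN by (auto simp: N)
        then have "\<bar>e (x / real a)\<bar> \<le> 4 / (x / real a)" using \<gamma>[rule_format, of "x / real a"] by (simp add: e_def H_def)
        moreover have "\<bar>moebius a / real a\<bar> \<le> 1 / real a" using abs_moebius_le[of a] a' by (simp add: divide_right_mono)
        ultimately have "\<bar>moebius a / real a * e (x / real a)\<bar> \<le> 1 / real a * (4 / (x / real a))"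
          unfolding abs_mult using a' by (intro mult_mono) auto
        then show "\<bar>moebius a / real a * e (x / real a)\<bar> \<le> 4 / x" using a' x by simp
      qed
      also have "\<dots> = real M * (4 / x)" by simp
      also have "\<dots> \<le> (x / Y) * (4 / x)" using x M[of M] by (intro mult_right_mono) auto
      also have "\<dots> = 4 * (1 / Y)" using x by simp
      also have "\<dots> \<le> 4 * (2 / t)" using Y by (intro mult_left_mono) auto
      finally show ?thesis by simp
    qed
    moreover have "\<bar>\<Sum>a\<in>{M<..N}. moebius a / real a * e (x / real a)\<bar> \<le> 4 * K * (2 + (2 * \<bar>\<gamma>\<bar> + 4)) / t"
    proof (cases "M < N")
      case True
      have mbd: "\<bar>\<Sum>a\<in>{1..n}. moebius a / real a\<bar> \<le> 2 * K / s" if n: "M \<le> n" "n \<le> N" for n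
      proof (cases "n = 0")
        case False
        \<comment> \<open>For \<open>n = M\<close> the argument is taken to be x/Y and not the
          possibly smaller integer \<open>M\<close>: the sum is the same, and the lower bound
          \<open>y >= x / Y\<close> becomes available.\<close>
        have ms: "(\<Sum>a\<in>{1..n}. moebius a / real a) = msum (if n = M then x / Y else real n)"
          by (auto simp: msum_def nats_upto_eq M_def)
        define y where "y = (if n = M then x / Y else real n)"
        have y: "y \<ge> x / Y" "y \<ge> 1"
          using M[of n] n False M[of 1] unfolding y_def by (auto simp: field_simps)
        have "s * s / 4 \<le> 1 + ln y"
        proof -
          have "ln x - t / 2 \<le> ln y"
            using y xY x Y ln_le_cancel_iff[of "x / Y" y] by (simp add: ln_div)
          moreover have "s * 1 \<le> s * s" using s by (intro mult_left_mono) auto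
          moreover note t(3)
          ultimately show ?thesis using s by linarith
        qed
        then have "s / 2 \<le> sqrt (1 + ln y)" using s by (intro real_le_rsqrt) (simp add: power2_eq_square)
        moreover have "0 < 1 + ln y" using ln_ge_zero[OF y(2)] by linarith
        ultimately have "K / sqrt (1 + ln y) \<le> K / (s / 2)"
          using K s by (intro divide_left_mono mult_pos_pos) auto
        then show ?thesis using mb[OF y(2)] unfolding ms y_def[symmetric] by (simp add: mult.commute)
      qed (use K s in auto)
      have mbd2: "\<bar>\<Sum>a\<in>{M<..n}. moebius a / real a\<bar> \<le> 4 * K / s" if n: "n \<le> N" for n
      proof (cases "M \<le> n")
        case True
        have "{1..n} = {1..M} \<union> {M<..n}" using True by auto
        then have "(\<Sum>a\<in>{1..n}. moebius a / real a) = (\<Sum>a\<in>{1..M}. moebius a / real a) + (\<Sum>a\<in>{M<..n}. moebius a / real a)"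
          by (simp only:) (subst sum.union_disjoint, auto)
        then show ?thesis using mbd[OF True n] mbd[of M] MN by simp
      qed (use K s in auto)
      have pos: "x / real (Suc M) < Y"
      proof -
        have "\<not> real (Suc M) \<le> x / Y" using M[of "Suc M"] by simp
        then show ?thesis using Y x by (simp add: field_simps)
      qed
      have HY: "H (x / real (Suc M)) \<le> t / 2 + \<bar>\<gamma>\<bar> + 4"
      proof -
        have "H (x / real (Suc M)) \<le> H Y" unfolding H_def using pos by (intro sum_mono2) auto
        also have "\<dots> \<le> t / 2 + \<bar>\<gamma>\<bar> + 4"
        proof -
          have "4 / Y \<le> 4" using Y by (simp add: field_simps)
          moreover have "\<bar>H Y - t / 2 - \<gamma>\<bar> \<le> 4 / Y" using \<gamma>[rule_format, OF Y(1)] unfolding Y(2) by (simp add: H_def)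
          ultimately show ?thesis by linarith
        qed
        finally show ?thesis .
      qed
      \<comment> \<open>The error e is not monotone. Abel summation is applied to H and to the
        logarithm separately, the constant being immediate.\<close>
      have S1: "\<bar>\<Sum>a\<in>{M<..N}. moebius a / real a * H (x / real a)\<bar> \<le> 4 * K / s * H (x / real (Suc M))"
      proof (rule Abel_sum_bound[OF True _ _ mbd2])
        fix n assume "M < n"
        then have "x / real (Suc n) \<le> x / real n" using x by (intro divide_left_mono) auto
        then show "H (x / real (Suc n)) \<le> H (x / real n)"
          unfolding H_def by (intro sum_mono2) auto
      qed (auto simp: H_def intro!: sum_nonneg)
      have S2: "\<bar>\<Sum>a\<in>{M<..N}. moebius a / real a * ln (x / real a)\<bar> \<le> 4 * K / s * ln (x / real (Suc M))"
        by (rule Abel_sum_bound[OF True _ _ mbd2]) (use x N[of N] True in \<open>auto simp: ln_div\<close>)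
      have S3: "\<bar>\<Sum>a\<in>{M<..N}. moebius a / real a * \<gamma>\<bar> \<le> 4 * K / s * \<bar>\<gamma>\<bar>"
        unfolding sum_distrib_right[symmetric] abs_mult using mbd2[of N] by (intro mult_right_mono) auto
      have lnY: "ln (x / real (Suc M)) \<le> t / 2"
      proof -
        have "ln (x / real (Suc M)) \<le> ln Y" using pos Y x by (subst ln_le_cancel_iff) auto
        then show ?thesis unfolding Y(2) .
      qed
      have "(\<Sum>a\<in>{M<..N}. moebius a / real a * e (x / real a)) =
        (\<Sum>a\<in>{M<..N}. moebius a / real a * H (x / real a)) - (\<Sum>a\<in>{M<..N}. moebius a / real a * ln (x / real a))
          - (\<Sum>a\<in>{M<..N}. moebius a / real a * \<gamma>)"
        unfolding e_def sum_subtractf[symmetric] by (intro sum.cong refl) (simp add: algebra_simps)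
      then have "\<bar>\<Sum>a\<in>{M<..N}. moebius a / real a * e (x / real a)\<bar> \<le>
          4 * K / s * H (x / real (Suc M)) + 4 * K / s * ln (x / real (Suc M)) + 4 * K / s * \<bar>\<gamma>\<bar>"
        using S1 S2 S3 by linarith
      also have "\<dots> = 4 * K / s * (H (x / real (Suc M)) + ln (x / real (Suc M)) + \<bar>\<gamma>\<bar>)"
        by (simp add: algebra_simps)
      also have "\<dots> \<le> 4 * K / s * ((2 + (2 * \<bar>\<gamma>\<bar> + 4)) * t)"
      proof (intro mult_left_mono)
        have "(2 * \<bar>\<gamma>\<bar> + 4) * 1 \<le> (2 * \<bar>\<gamma>\<bar> + 4) * t" using t by (intro mult_left_mono) auto
        then show "H (x / real (Suc M)) + ln (x / real (Suc M)) + \<bar>\<gamma>\<bar> \<le> (2 + (2 * \<bar>\<gamma>\<bar> + 4)) * t"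
          using HY lnY t(1) by (simp add: algebra_simps)
      qed (use K s in auto)
      also have "\<dots> = 4 * K * (2 + (2 * \<bar>\<gamma>\<bar> + 4)) / t" using t(1) unfolding t(2)[symmetric] by simp
      finally show ?thesis .
    qed (use K t in auto)
    moreover have "\<bar>\<gamma> * msum x\<bar> \<le> K * \<bar>\<gamma>\<bar> / t"
    proof -
      have "\<bar>\<gamma> * msum x\<bar> \<le> \<bar>\<gamma>\<bar> * (K / s)" unfolding abs_mult using mb[OF x] by (intro mult_left_mono) (auto simp: s_def)
      also have "\<dots> \<le> \<bar>\<gamma>\<bar> * (K / t)" using K t s by (intro mult_left_mono divide_left_mono) auto
      finally show ?thesis by (simp add: mult.commute)
    qed
    ultimately show "\<bar>Tsum1 x - 1\<bar> \<le> K2 / sqrt (sqrt (1 + ln x))"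
      unfolding T s_def[symmetric] t_def[symmetric] K2_def add_divide_distrib by linarith
  qed
qed

end

section \<open>Euler products and Rankin bounds\<close>

definition primes_upto :: "real \<Rightarrow> nat set" where
  "primes_upto x = {p. prime p \<and> real p \<le> x}"

lemma mem_primes_upto [simp]: "p \<in> primes_upto x \<longleftrightarrow> prime p \<and> real p \<le> x"
  by (simp add: primes_upto_def)

lemma primes_upto_subset: "primes_upto x \<subseteq> nats_upto x"
  by (auto simp: prime_gt_0_nat)

lemma finite_primes_upto [simp, intro]: "finite (primes_upto x)"
  by (rule finite_subset[OF primes_upto_subset]) simp

section \<open>Euler products over finitely many primes\<close>

definition smooth_nats :: "nat set \<Rightarrow> nat set" where
  "smooth_nats P = {m. 0 < m \<and> prime_factors m \<subseteq> P}"

lemma smooth_nats_empty: "smooth_nats {} = {1}"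
  by (simp only: smooth_nats_def subset_empty prime_factors_eq_empty_nat) auto

text \<open>Unique factorisation splits off the full power of \<open>p\<close>. It is an equivalence
  so that summability can be carried across as well as the value.\<close>

lemma has_sum_smooth_insert_iff:
  fixes f :: "nat \<Rightarrow> real"
  assumes p: "prime p" "p \<notin> P"
  shows "(f has_sum T) (smooth_nats (insert p P)) \<longleftrightarrow>
         ((\<lambda>(a,n). f (p ^ a * n)) has_sum T) (Sigma UNIV (\<lambda>_. smooth_nats P))"
proof (rule has_sum_reindex_bij_witness[of _ "\<lambda>(a,n). p ^ a * n" "\<lambda>m. (multiplicity p m, m div p ^ multiplicity p m)"])
  fix m assume m: "m \<in> smooth_nats (insert p P)"
  then have m0: "m > 0" by (simp add: smooth_nats_def)
  obtain n where n: "m = p ^ multiplicity p m * n" "\<not> p dvd n"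
    by (rule multiplicity_decompose'[of m p]) (use m0 p(1) in \<open>auto dest: prime_gt_1_nat\<close>)
  have p0: "p > 0" using p(1) by (simp add: prime_gt_0_nat)
  have "m div p ^ multiplicity p m = p ^ multiplicity p m * n div p ^ multiplicity p m"
    using n(1) by (rule arg_cong)
  also have "\<dots> = n" using p0 by simp
  finally have "m div p ^ multiplicity p m = n" .
  moreover have "n > 0" using n(1) m0 by (cases n) auto
  moreover have "prime_factors n \<subseteq> P"
  proof
    fix q assume q: "q \<in> prime_factors n"
    have "n dvd m" by (subst n(1)) simp
    then have "q \<in> prime_factors m" using q m0 by (auto simp: in_prime_factors_iff intro: dvd_trans)
    moreover have "q \<noteq> p" using q n(2) by auto
    ultimately show "q \<in> P" using m by (auto simp: smooth_nats_def)
  qed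
  ultimately show "(multiplicity p m, m div p ^ multiplicity p m) \<in> Sigma UNIV (\<lambda>_. smooth_nats P)"
    by (simp add: smooth_nats_def)
  show "(case (multiplicity p m, m div p ^ multiplicity p m) of (a, n) \<Rightarrow> p ^ a * n) = m"
    by (simp add: multiplicity_dvd)
  show "(case (multiplicity p m, m div p ^ multiplicity p m) of (a, n) \<Rightarrow> f (p ^ a * n)) = f m"
    by (simp add: multiplicity_dvd)
next
  fix b assume b: "b \<in> Sigma (UNIV :: nat set) (\<lambda>_. smooth_nats P)"
  then obtain a n where an: "b = (a,n)" "n > 0" "prime_factors n \<subseteq> P" by (auto simp: smooth_nats_def)
  have "\<not> p dvd n" using an p by (auto simp: in_prime_factors_iff)
  then have "multiplicity p (p ^ a * n) = a"
    using p an by (simp add: prime_elem_multiplicity_mult_distrib not_dvd_imp_multiplicity_0)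
  moreover have "p > 0" using p by (simp add: prime_gt_0_nat)
  ultimately show "(multiplicity p (case b of (a, n) \<Rightarrow> p ^ a * n), (case b of (a, n) \<Rightarrow> p ^ a * n) div
     p ^ multiplicity p (case b of (a, n) \<Rightarrow> p ^ a * n)) = b"
    by (simp add: an)
  have "prime_factors (p ^ a * n) \<subseteq> insert p P"
  proof
    fix q assume "q \<in> prime_factors (p ^ a * n)"
    then have "prime q" "q dvd p ^ a * n" by (auto simp: in_prime_factors_iff)
    then have "q dvd p ^ a \<or> q dvd n" using prime_dvd_mult_iff by blast
    then have "q = p \<or> q dvd n" using \<open>prime q\<close> p(1) prime_dvd_power primes_dvd_imp_eq by blast
    then show "q \<in> insert p P" using an \<open>prime q\<close> by (auto simp: in_prime_factors_iff)
  qed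
  then show "(case b of (a, n) \<Rightarrow> p ^ a * n) \<in> smooth_nats (insert p P)"
    using an \<open>p > 0\<close> by (simp add: smooth_nats_def)
qed auto

text \<open>The bound 3/4 is chosen to admit 1/sqrt 2, and with it the function 1/sqrt m. It keeps
  1/(1 - h p) at most 4, which is the origin of the factor 4 in the exponential bounds
  below.\<close>

locale completely_multiplicative =
  fixes h :: "nat \<Rightarrow> real"
  assumes h_1: "h 1 = 1" and h_mult: "h (a * b) = h a * h b"
    and h_nonneg: "h a \<ge> 0" and h_prime: "prime p \<Longrightarrow> h p \<le> 3/4"
begin

lemma h_power: "h (p ^ a) = h p ^ a"
  by (induction a) (use h_1 h_mult in auto)

text \<open>The weight \<open>v\<close> belongs to the prime and not to its power, so each positive
  exponent carries it once. This is the local factor of a function of the radical of m times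
  \<open>h m\<close>.\<close>

lemma local_has_sum:
  assumes p: "prime p"
  shows "((\<lambda>a. if a = 0 then 1 else v * h p ^ a) has_sum (1 + v * (h p / (1 - h p)))) UNIV"
proof (rule norm_summable_imp_has_sum)
  have *: "0 \<le> h p" "h p < 1" using h_nonneg[of p] h_prime[OF p] by auto
  have geo: "(\<lambda>a. v * h p ^ a) sums (v * (1 / (1 - h p)))"
    using geometric_sums[of "h p"] * by (intro sums_mult) auto
  have "(\<lambda>a. (if a = 0 then 1 - v else 0) + v * h p ^ a) sums ((1 - v) + v * (1 / (1 - h p)))"
    using sums_single[of 0 "\<lambda>_. 1 - v"] by (intro sums_add geo) simp
  moreover have "(\<lambda>a. (if a = 0 then 1 - v else 0) + v * h p ^ a) = (\<lambda>a. if a = 0 then 1 else v * h p ^ a)"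
    by auto
  moreover have "(1 - v) + v * (1 / (1 - h p)) = 1 + v * (h p / (1 - h p))"
    using * by (simp add: field_simps)
  ultimately show "(\<lambda>a. if a = 0 then 1 else v * h p ^ a) sums (1 + v * (h p / (1 - h p)))" by (simp only:)
  have "summable (\<lambda>a. norm (v * h p ^ a))" using * by (simp add: abs_mult power_abs summable_mult)
  moreover have "\<forall>\<^sub>F a in sequentially. norm (v * h p ^ a) = norm (if a = 0 then 1 else v * h p ^ a)"
    using eventually_gt_at_top[of 0] by eventually_elim simp
  ultimately show "summable (\<lambda>a. norm (if a = 0 then 1 else v * h p ^ a))"
    by (rule summable_cong[THEN iffD1, rotated])
qed

lemma mult_prime_power:
  assumes p: "prime p" "p \<notin> P" and n: "n \<in> smooth_nats P"
  shows "(\<Prod>q\<in>prime_factors (p ^ a * n). v q) * h (p ^ a * n) =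
     (if a = 0 then 1 else v p * h p ^ a) * ((\<Prod>q\<in>prime_factors n. v q) * h n)"
proof (cases "a = 0")
  case False
  have pn: "p \<notin> prime_factors n" "n > 0" using n p by (auto simp: smooth_nats_def)
  have "p ^ a > 0" using p by (simp add: prime_gt_0_nat)
  then have "prime_factors (p ^ a * n) = insert p (prime_factors n)"
    using pn False p by (subst prime_factors_mult_nat) (auto simp: prime_factorization_prime_power)
  then show ?thesis using pn False by (simp add: h_mult h_power)
qed simp

text \<open>For nonnegative weights the iterated sums already give summability on the product set.
  The signed version \<open>has_sum_smooth\<close> takes its absolute convergence from here, applied
  to absolute values.\<close>

lemma has_sum_smooth_nonneg:
  assumes "finite P" "\<And>p. p \<in> P \<Longrightarrow> prime p" "\<And>p. 0 \<le> v p"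
  shows "((\<lambda>m. (\<Prod>q\<in>prime_factors m. v q) * h m) has_sum (\<Prod>p\<in>P. 1 + v p * (h p / (1 - h p)))) (smooth_nats P)"
  using assms(1,2)
proof (induction P)
  case empty
  then show ?case by (simp add: smooth_nats_empty has_sum_finiteI h_1[simplified])
next
  case (insert p P)
  let ?g = "\<lambda>m. (\<Prod>q\<in>prime_factors m. v q) * h m"
  let ?S = "\<Prod>p\<in>P. 1 + v p * (h p / (1 - h p))"
  let ?l = "\<lambda>a. if a = 0 then 1 else v p * h p ^ a"
  have p: "prime p" "p \<notin> P" using insert by auto
  have IH: "(?g has_sum ?S) (smooth_nats P)" using insert by auto
  have *: "((\<lambda>n. (\<lambda>(a,n). ?g (p ^ a * n)) (a, n)) has_sum ?l a * ?S) (smooth_nats P)" for a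
    using has_sum_cmult_right[OF IH, of "?l a"]
    by (rule has_sum_cong[THEN iffD1, rotated]) (simp add: mult_prime_power[OF p])
  have tot: "((\<lambda>a. ?l a * ?S) has_sum (1 + v p * (h p / (1 - h p))) * ?S) UNIV"
    by (intro has_sum_cmult_left local_has_sum p)
  have "((\<lambda>(a,n). ?g (p ^ a * n)) has_sum (1 + v p * (h p / (1 - h p))) * ?S) (Sigma UNIV (\<lambda>_. smooth_nats P))"
  proof (rule has_sum_SigmaI[OF * tot])
    show "(\<lambda>(a,n). ?g (p ^ a * n)) summable_on Sigma UNIV (\<lambda>_. smooth_nats P)"
      by (rule summable_on_SigmaI[OF * has_sum_imp_summable[OF tot]])
         (use assms(3) h_nonneg in \<open>auto intro!: mult_nonneg_nonneg prod_nonneg\<close>)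
  qed
  then show ?case using insert by (simp add: has_sum_smooth_insert_iff[OF p])
qed

lemma has_sum_smooth:
  assumes "finite P" "\<And>p. p \<in> P \<Longrightarrow> prime p"
  shows "((\<lambda>m. (\<Prod>q\<in>prime_factors m. v q) * h m) has_sum (\<Prod>p\<in>P. 1 + v p * (h p / (1 - h p)))) (smooth_nats P)"
  using assms(1,2)
proof (induction P)
  case empty
  then show ?case by (simp add: smooth_nats_empty has_sum_finiteI h_1[simplified])
next
  case (insert p P)
  let ?g = "\<lambda>m. (\<Prod>q\<in>prime_factors m. v q) * h m"
  let ?S = "\<Prod>p\<in>P. 1 + v p * (h p / (1 - h p))"
  let ?l = "\<lambda>a. if a = 0 then 1 else v p * h p ^ a"
  have p: "prime p" "p \<notin> P" using insert by auto
  have IH: "(?g has_sum ?S) (smooth_nats P)" using insert by auto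
  have *: "((\<lambda>n. (\<lambda>(a,n). ?g (p ^ a * n)) (a, n)) has_sum ?l a * ?S) (smooth_nats P)" for a
    using has_sum_cmult_right[OF IH, of "?l a"]
    by (rule has_sum_cong[THEN iffD1, rotated]) (simp add: mult_prime_power[OF p])
  have tot: "((\<lambda>a. ?l a * ?S) has_sum (1 + v p * (h p / (1 - h p))) * ?S) UNIV"
    by (intro has_sum_cmult_left local_has_sum p)
  have "(\<lambda>m. norm (?g m)) summable_on smooth_nats (insert p P)"
  proof -
    have "(\<lambda>m. (\<Prod>q\<in>prime_factors m. \<bar>v q\<bar>) * h m) summable_on smooth_nats (insert p P)"
      by (rule has_sum_imp_summable[OF has_sum_smooth_nonneg]) (use insert in auto)
    then show ?thesis using h_nonneg by (simp add: abs_mult abs_prod)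
  qed
  then have "?g summable_on smooth_nats (insert p P)" by (rule abs_summable_summable)
  then have "(\<lambda>(a,n). ?g (p ^ a * n)) summable_on Sigma UNIV (\<lambda>_. smooth_nats P)"
    unfolding summable_on_def has_sum_smooth_insert_iff[OF p] .
  from has_sum_SigmaI[OF * tot this]
  show ?case using insert by (simp add: has_sum_smooth_insert_iff[OF p])
qed

text \<open>Every number up to \<open>x\<close> is composed of primes up to \<open>x\<close>, so a
  finite Euler product majorises the sum; then 1 + t is at most exp t.\<close>

lemma sum_mult_le_exp:
  assumes A: "A \<subseteq> nats_upto x" and v: "\<And>p. 0 \<le> v p"
  shows "(\<Sum>m\<in>A. (\<Prod>q\<in>prime_factors m. v q) * h m) \<le> exp (4 * (\<Sum>p\<in>primes_upto x. v p * h p))"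
proof -
  define P where "P = primes_upto x"
  have P: "finite P" "\<And>p. p \<in> P \<Longrightarrow> prime p" by (auto simp: P_def)
  have "A \<subseteq> smooth_nats P"
  proof
    fix m assume "m \<in> A"
    then have m: "0 < m" "real m \<le> x" using A by auto
    have "q \<in> P" if "q \<in> prime_factors m" for q
    proof -
      have "prime q" "q dvd m" using that by (auto simp: in_prime_factors_iff)
      then have "q \<le> m" "q > 0" using m by (auto dest: dvd_imp_le prime_gt_0_nat)
      then show ?thesis using m \<open>prime q\<close> by (simp add: P_def)
    qed
    then show "m \<in> smooth_nats P" using m by (auto simp: smooth_nats_def)
  qed
  moreover have "finite A" using A finite_subset by blast
  ultimately have "(\<Sum>m\<in>A. (\<Prod>q\<in>prime_factors m. v q) * h m) \<le> (\<Prod>p\<in>P. 1 + v p * (h p / (1 - h p)))"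
    by (intro finite_sum_le_has_sum[OF has_sum_smooth_nonneg])
       (use P v h_nonneg in \<open>auto intro!: mult_nonneg_nonneg prod_nonneg\<close>)
  also have "\<dots> \<le> (\<Prod>p\<in>P. exp (4 * (v p * h p)))"
  proof (rule prod_mono)
    fix p assume "p \<in> P"
    then have hp: "0 \<le> h p" "h p \<le> 3/4" using h_nonneg h_prime P by auto
    have "h p / (1 - h p) \<le> h p / (1/4)" using hp by (intro divide_left_mono) auto
    then have "v p * (h p / (1 - h p)) \<le> v p * (4 * h p)" using v by (intro mult_left_mono) auto
    then have "1 + v p * (h p / (1 - h p)) \<le> 1 + 4 * (v p * h p)" by simp
    also have "\<dots> \<le> exp (4 * (v p * h p))" by (rule exp_ge_add_one_self)
    finally show "0 \<le> 1 + v p * (h p / (1 - h p)) \<and> 1 + v p * (h p / (1 - h p)) \<le> exp (4 * (v p * h p))"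
      using hp v by (auto intro!: add_nonneg_nonneg mult_nonneg_nonneg divide_nonneg_nonneg)
  qed
  also have "\<dots> = exp (4 * (\<Sum>p\<in>P. v p * h p))" using P by (simp add: exp_sum sum_distrib_left)
  finally show ?thesis by (simp add: P_def)
qed

end

interpretation inv_nat: completely_multiplicative "\<lambda>m. 1 / real m"
  by standard (auto dest: prime_ge_2_nat simp: field_simps intro: order_trans[of _ "2::real"])

interpretation inv_sqrt: completely_multiplicative "\<lambda>m. 1 / sqrt (real m)"
proof
  fix p :: nat assume "prime p"
  then have "real p \<ge> 2" using prime_ge_2_nat by force
  then have "sqrt (real p) \<ge> 4/3" by (intro real_le_rsqrt) (simp add: power2_eq_square)
  then have "1 / sqrt (real p) \<le> 1 / (4/3)" by (intro divide_left_mono mult_pos_pos) linarith+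
  then show "1 / sqrt (real p) \<le> 3/4" by simp
qed (auto simp: real_sqrt_mult)

text \<open>
  The primes dividing \<open>Q\<close> are those at which the weight \<open>u\<close> below may differ substantially from \<open>1/p\<close>.
\<close>

definition vloc :: "real \<Rightarrow> nat \<Rightarrow> nat \<Rightarrow> real" where
  "vloc B Q p = (if p dvd Q then B else B / real p)"

text \<open>It bounds the coefficients \<open>bcoef\<close> of every admissible weight
  (\<open>abs_bcoef_le\<close>) and depends only on \<open>B\<close> and \<open>Q\<close>; this is
  the source of uniformity in the weight.\<close>

definition majorant :: "real \<Rightarrow> nat \<Rightarrow> nat \<Rightarrow> real" where
  "majorant B Q m = (\<Prod>p\<in>prime_factors m. vloc B Q p) / real m"

lemma vloc_nonneg: "B \<ge> 0 \<Longrightarrow> vloc B Q p \<ge> 0"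
  by (simp add: vloc_def)

lemma majorant_nonneg: "B \<ge> 0 \<Longrightarrow> majorant B Q m \<ge> 0"
  by (simp add: majorant_def prod_nonneg vloc_nonneg)

section \<open>Sums over the prime factors of a modulus\<close>

definition p32 :: real where "p32 = (\<Sum>n. real n powr (- 3/2))"

lemma sum_p32: "finite A \<Longrightarrow> (\<Sum>n\<in>A. real n powr (- 3/2)) \<le> p32"
  unfolding p32_def by (intro sum_le_suminf) (auto simp: summable_real_powr_iff)

lemma p32_nonneg: "p32 \<ge> 0"
  using sum_p32[of "{}"] by simp

text \<open>Off \<open>Q\<close> the local weight gains 1/p, so even with h of size p^(-1/2) those
  primes contribute at most the sum of n^(-3/2). The prime factors of \<open>Q\<close> are left.
  Both h = 1/p and h = 1/sqrt p are covered.\<close>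

lemma sum_vloc_le:
  assumes B: "B \<ge> 0" and Q: "Q > 0" and h: "\<And>p. 0 \<le> h p" "\<And>p. prime p \<Longrightarrow> h p \<le> 1 / sqrt (real p)"
  shows "(\<Sum>p\<in>primes_upto x. vloc B Q p * h p) \<le> B * (\<Sum>p\<in>prime_factors Q. h p) + B * p32"
proof -
  let ?P = "primes_upto x"
  have "(\<Sum>p\<in>?P. vloc B Q p * h p) \<le> (\<Sum>p\<in>?P. (if p dvd Q then B * h p else 0) + B * real p powr (- 3/2))"
  proof (rule sum_mono)
    fix p assume "p \<in> ?P"
    then have p: "prime p" "real p > 0" by (auto simp: prime_gt_0_nat)
    have "B / real p * h p \<le> B / real p * (1 / sqrt (real p))"
      using h(2)[OF p(1)] B by (intro mult_left_mono) auto
    also have "\<dots> = B * real p powr (- 3/2)"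
    proof -
      have "real p powr (3/2) = real p powr (1 + 1/2)" by simp
      also have "\<dots> = real p * sqrt (real p)" using p by (simp only: powr_add powr_half_sqrt) simp
      finally show ?thesis using p by (simp add: powr_minus divide_simps)
    qed
    finally show "vloc B Q p * h p \<le> (if p dvd Q then B * h p else 0) + B * real p powr (- 3/2)"
      using B by (auto simp: vloc_def)
  qed
  also have "\<dots> = (\<Sum>p\<in>?P. if p dvd Q then B * h p else 0) + B * (\<Sum>p\<in>?P. real p powr (- 3/2))"
    by (simp add: sum.distrib sum_distrib_left)
  also have "(\<Sum>p\<in>?P. if p dvd Q then B * h p else 0) = (\<Sum>p\<in>?P \<inter> {p. p dvd Q}. B * h p)"
    by (simp add: sum.If_cases)
  also have "\<dots> \<le> (\<Sum>p\<in>prime_factors Q. B * h p)"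
    using B Q h(1) by (intro sum_mono2) (auto simp: in_prime_factors_iff)
  also have "\<dots> = B * (\<Sum>p\<in>prime_factors Q. h p)" by (simp add: sum_distrib_left)
  finally show ?thesis using sum_p32[of ?P] B mult_left_mono[OF sum_p32[of ?P] B] by simp
qed

lemma card_prime_factors_le:
  assumes "Q > 0"
  shows "real (card (prime_factors Q)) \<le> 2 * ln (real Q)"
proof -
  have "2 ^ card (prime_factors Q) = (\<Prod>p\<in>prime_factors Q. 2::nat)" by simp
  also have "\<dots> \<le> (\<Prod>p\<in>prime_factors Q. p ^ multiplicity p Q)"
  proof (rule prod_mono)
    fix p assume "p \<in> prime_factors Q"
    then have "p \<ge> 2" "multiplicity p Q \<ge> 1" by (auto simp: prime_factors_multiplicity prime_ge_2_nat Suc_le_eq)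
    then have "2 \<le> p ^ 1" "p ^ 1 \<le> p ^ multiplicity p Q" by (simp, intro power_increasing) auto
    then show "0 \<le> (2::nat) \<and> 2 \<le> p ^ multiplicity p Q" by linarith
  qed
  also have "\<dots> = Q" using assms prod_prime_factors[of Q] by simp
  finally have "real (2 ^ card (prime_factors Q)) \<le> real Q" by (rule of_nat_mono)
  then have "(2::real) ^ card (prime_factors Q) \<le> real Q" by simp
  then have "ln ((2::real) ^ card (prime_factors Q)) \<le> ln (real Q)" using assms by (subst ln_le_cancel_iff) auto
  then have "real (card (prime_factors Q)) * ln 2 \<le> ln (real Q)" by (simp add: ln_realpow)
  moreover have "real (card (prime_factors Q)) * (1/2) \<le> real (card (prime_factors Q)) * ln 2"
    using ln2_ge_two_thirds by (intro mult_left_mono) auto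
  ultimately show ?thesis by simp
qed

lemma sum_inv_sqrt: "(\<Sum>n=1..k. 1 / sqrt (real n)) \<le> 2 * sqrt (real k)"
proof (induction k)
  case (Suc k)
  define a b where "a = sqrt (real k)" and "b = sqrt (real (Suc k))"
  have ab: "a \<ge> 0" "b > 0" "a * a = real k" "b * b = real k + 1" by (auto simp: a_def b_def)
  have "2 * a * b \<le> a * a + b * b" using sum_squares_bound[of a b] by (simp add: power2_eq_square)
  then have "2 * a + 1 / b \<le> 2 * b" using ab by (simp add: field_simps)
  with Suc show ?case by (simp add: a_def b_def)
qed simp

text \<open>With w prime factors, those above w contribute at most w/sqrt w, and those up to w at
  most the sum over all integers up to w. The total is of order sqrt w, and w is O(ln Q).\<close>

lemma sum_prime_factors_inv_sqrt:
  assumes "Q > 0"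
  shows "(\<Sum>p\<in>prime_factors Q. 1 / sqrt (real p)) \<le> 6 * sqrt (ln (real Q))"
proof -
  define w where "w = card (prime_factors Q)"
  have "(\<Sum>p\<in>prime_factors Q. 1 / sqrt (real p)) \<le>
    (\<Sum>p\<in>prime_factors Q. (if p \<le> w then 1 / sqrt (real p) else 0) + 1 / sqrt (real w))"
  proof (rule sum_mono)
    fix p assume p: "p \<in> prime_factors Q"
    then have "w > 0" by (auto simp: w_def card_gt_0_iff)
    then show "1 / sqrt (real p) \<le> (if p \<le> w then 1 / sqrt (real p) else 0) + 1 / sqrt (real w)"
      by (auto simp: field_simps)
  qed
  also have "\<dots> = (\<Sum>p\<in>prime_factors Q \<inter> {p. p \<le> w}. 1 / sqrt (real p)) + real w / sqrt (real w)"
    by (simp add: sum.distrib sum.If_cases w_def)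
  also have "(\<Sum>p\<in>prime_factors Q \<inter> {p. p \<le> w}. 1 / sqrt (real p)) \<le> (\<Sum>n=1..w. 1 / sqrt (real n))"
    by (intro sum_mono2) (auto simp: in_prime_factors_iff Suc_le_eq prime_gt_0_nat)
  also have "\<dots> \<le> 2 * sqrt (real w)" by (rule sum_inv_sqrt)
  also have "real w / sqrt (real w) = sqrt (real w)" by (simp add: real_div_sqrt)
  also have "2 * sqrt (real w) + sqrt (real w) = 3 * sqrt (real w)" by simp
  also have "\<dots> \<le> 3 * sqrt (4 * ln (real Q))"
    using card_prime_factors_le[OF assms] assms by (auto simp: w_def)
  also have "\<dots> = 6 * sqrt (ln (real Q))" by (simp add: real_sqrt_mult)
  finally show ?thesis by simp
qed

lemma majorant_sqrt_bound:
  assumes "B \<ge> 0" "Q > 0"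
  shows "(\<Sum>m\<in>nats_upto x. majorant B Q m * sqrt (real m)) \<le> exp (4 * B * (6 * sqrt (ln (real Q)) + p32))"
proof -
  have "(\<Sum>m\<in>nats_upto x. majorant B Q m * sqrt (real m)) =
      (\<Sum>m\<in>nats_upto x. (\<Prod>p\<in>prime_factors m. vloc B Q p) * (1 / sqrt (real m)))"
    by (intro sum.cong refl) (auto simp: majorant_def field_simps)
  also have "\<dots> \<le> exp (4 * (\<Sum>p\<in>primes_upto x. vloc B Q p * (1 / sqrt (real p))))"
    by (rule inv_sqrt.sum_mult_le_exp) (use assms vloc_nonneg in auto)
  also have "\<dots> \<le> exp (4 * B * (6 * sqrt (ln (real Q)) + p32))"
  proof -
    have "(\<Sum>p\<in>primes_upto x. vloc B Q p * (1 / sqrt (real p))) \<le>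
       B * (\<Sum>p\<in>prime_factors Q. 1 / sqrt (real p)) + B * p32"
      by (rule sum_vloc_le) (use assms in auto)
    also have "\<dots> \<le> B * (6 * sqrt (ln (real Q))) + B * p32"
      using sum_prime_factors_inv_sqrt assms by (intro add_right_mono mult_left_mono) auto
    finally show ?thesis by (simp add: algebra_simps)
  qed
  finally show ?thesis .
qed

text \<open>Rankin's trick: the condition \<open>y < m\<close> is relaxed to the factor sqrt(m/y).
  The loss exp(O(sqrt(ln Q))) is affordable once ln y is of larger order than sqrt(ln Q).\<close>

lemma majorant_tail:
  assumes "B \<ge> 0" "Q > 0" "y > 0"
  shows "(\<Sum>m\<in>{m\<in>nats_upto x. y < real m}. majorant B Q m) \<le> exp (4 * B * (6 * sqrt (ln (real Q)) + p32)) / sqrt y"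
proof -
  have "(\<Sum>m\<in>{m\<in>nats_upto x. y < real m}. majorant B Q m) \<le>
      (\<Sum>m\<in>{m\<in>nats_upto x. y < real m}. majorant B Q m * sqrt (real m) / sqrt y)"
  proof (rule sum_mono)
    fix m assume "m \<in> {m\<in>nats_upto x. y < real m}"
    then have "sqrt y \<le> sqrt (real m)" by simp
    then have "majorant B Q m * sqrt y \<le> majorant B Q m * sqrt (real m)"
      using majorant_nonneg assms by (intro mult_left_mono) auto
    then show "majorant B Q m \<le> majorant B Q m * sqrt (real m) / sqrt y"
      using assms by (simp add: pos_le_divide_eq)
  qed
  also have "\<dots> \<le> (\<Sum>m\<in>nats_upto x. majorant B Q m * sqrt (real m) / sqrt y)"
    using majorant_nonneg assms by (intro sum_mono2) auto
  also have "\<dots> \<le> exp (4 * B * (6 * sqrt (ln (real Q)) + p32)) / sqrt y"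
    unfolding sum_divide_distrib[symmetric] using majorant_sqrt_bound[OF assms(1,2)] assms(3)
    by (intro divide_right_mono) auto
  finally show ?thesis .
qed

lemma majorant_sum_bound:
  assumes "B \<ge> 0" "Q > 0"
  shows "(\<Sum>m\<in>nats_upto x. majorant B Q m) \<le> exp (4 * B * ((\<Sum>p\<in>prime_factors Q. 1 / real p) + p32))"
proof -
  have "(\<Sum>m\<in>nats_upto x. majorant B Q m) =
      (\<Sum>m\<in>nats_upto x. (\<Prod>p\<in>prime_factors m. vloc B Q p) * (1 / real m))"
    by (simp add: majorant_def)
  also have "\<dots> \<le> exp (4 * (\<Sum>p\<in>primes_upto x. vloc B Q p * (1 / real p)))"
    by (rule inv_nat.sum_mult_le_exp) (use assms vloc_nonneg in auto)
  also have "\<dots> \<le> exp (4 * B * ((\<Sum>p\<in>prime_factors Q. 1 / real p) + p32))"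
  proof -
    have "1 / real p \<le> 1 / sqrt (real p)" if "prime p" for p
    proof -
      have "real p \<ge> 1" using that prime_ge_1_nat by force
      then have "sqrt (real p) \<le> real p" by (intro real_le_lsqrt) (auto simp: power2_eq_square)
      then show ?thesis using \<open>real p \<ge> 1\<close> by (intro divide_left_mono mult_pos_pos) auto
    qed
    then have "(\<Sum>p\<in>primes_upto x. vloc B Q p * (1 / real p)) \<le>
       B * (\<Sum>p\<in>prime_factors Q. 1 / real p) + B * p32"
      by (intro sum_vloc_le) (use assms in auto)
    then show ?thesis by (simp add: algebra_simps)
  qed
  finally show ?thesis .
qed

section \<open>Reciprocal sums over primes and over prime factors\<close>

context prime_number_estimate
begin

text \<open>A weak form of Mertens' theorem: beyond exp(1/\<delta>) the factor \<delta> ln p is at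
  least 1, so 1/p can be compared with \<open>mangoldt p / p\<close>. The arbitrarily small
  coefficient of ln z later yields arbitrarily small powers of \<open>L\<close>.\<close>

lemma sum_inverse_primes:
  assumes "\<delta> > 0"
  shows "\<exists>C. \<forall>z\<ge>1. (\<Sum>p\<in>primes_upto z. 1 / real p) \<le> \<delta> * ln z + C"
proof -
  obtain c K where K: "K \<ge> 0" and cK: "\<forall>y\<ge>1. \<bar>(\<Sum>b\<in>nats_upto y. mangoldt b / real b) - ln y - c\<bar> \<le> K / (1 + ln y)"
    using sum_mangoldt_over by blast
  define w where "w = exp (1 / \<delta>)"
  have w: "w > 0" "ln w = 1 / \<delta>" by (auto simp: w_def)
  define C where "C = (\<Sum>p\<in>nats_upto w. 1 / real p) + \<delta> * (\<bar>c\<bar> + K)"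
  show ?thesis
  proof (rule exI[of _ C], intro allI impI)
    fix z :: real assume z: "z \<ge> 1"
    have "K / (1 + ln z) \<le> K / 1" using z K by (intro divide_left_mono) (auto intro!: add_pos_nonneg)
    then have upper: "(\<Sum>b\<in>nats_upto z. mangoldt b / real b) \<le> ln z + \<bar>c\<bar> + K"
      using cK[rule_format, OF z] by linarith
    have "(\<Sum>p\<in>primes_upto z. 1 / real p) \<le>
       (\<Sum>p\<in>primes_upto z. (if real p \<le> w then 1 / real p else 0) + \<delta> * (mangoldt p / real p))"
    proof (rule sum_mono)
      fix p assume "p \<in> primes_upto z"
      then have p: "prime p" "p > 0" by (auto simp: prime_gt_0_nat)
      show "1 / real p \<le> (if real p \<le> w then 1 / real p else 0) + \<delta> * (mangoldt p / real p)"
      proof (cases "real p \<le> w")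
        case False
        then have "ln w \<le> ln (real p)" using w p by (subst ln_le_cancel_iff) auto
        then have "1 \<le> \<delta> * ln (real p)" using assms w by (simp add: field_simps)
        then have "1 / real p \<le> \<delta> * ln (real p) / real p" using p by (intro divide_right_mono) auto
        with False p show ?thesis by simp
      qed (use assms mangoldt_nonneg in auto)
    qed
    also have "\<dots> = (\<Sum>p\<in>primes_upto z \<inter> {p. real p \<le> w}. 1 / real p) +
       \<delta> * (\<Sum>p\<in>primes_upto z. mangoldt p / real p)"
      by (simp add: sum.distrib sum.If_cases sum_distrib_left)
    also have "\<dots> \<le> (\<Sum>p\<in>nats_upto w. 1 / real p) + \<delta> * (\<Sum>b\<in>nats_upto z. mangoldt b / real b)"
      using assms mangoldt_nonneg by (intro add_mono mult_left_mono sum_mono2) (auto simp: prime_gt_0_nat)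
    also have "\<dots> \<le> (\<Sum>p\<in>nats_upto w. 1 / real p) + \<delta> * (ln z + \<bar>c\<bar> + K)"
      using assms upper by (intro add_mono mult_left_mono) auto
    finally show "(\<Sum>p\<in>primes_upto z. 1 / real p) \<le> \<delta> * ln z + C"
      by (simp add: C_def algebra_simps)
  qed
qed

lemma sum_prime_factors_inverse:
  assumes "\<delta> > 0"
  shows "\<exists>C. \<forall>Q>0. (\<Sum>p\<in>prime_factors Q. 1 / real p) \<le> \<delta> * ln (1 + ln (real Q)) + C"
proof -
  obtain C where C: "\<forall>z\<ge>1. (\<Sum>p\<in>primes_upto z. 1 / real p) \<le> \<delta> * ln z + C"
    using sum_inverse_primes[OF assms] by blast
  show ?thesis
  proof (rule exI[of _ "C + \<delta> * ln 2 + 1"], intro allI impI)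
    fix Q :: nat assume Q: "Q > 0"
    \<comment> \<open>There are at most 2 ln Q prime factors, so those above \<open>z\<close>
      contribute at most 1 in total.\<close>
    define z where "z = 2 * (1 + ln (real Q))"
    have lnQ: "ln (real Q) \<ge> 0" using Q by simp
    have z: "z \<ge> 1" using lnQ by (simp add: z_def)
    have "(\<Sum>p\<in>prime_factors Q. 1 / real p) \<le> (\<Sum>p\<in>prime_factors Q. (if real p \<le> z then 1 / real p else 0) + 1 / z)"
    proof (rule sum_mono)
      fix p assume "p \<in> prime_factors Q"
      show "1 / real p \<le> (if real p \<le> z then 1 / real p else 0) + 1 / z"
        using z by (auto simp: field_simps)
    qed
    also have "\<dots> = (\<Sum>p\<in>prime_factors Q \<inter> {p. real p \<le> z}. 1 / real p) + real (card (prime_factors Q)) / z"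
      by (simp add: sum.distrib sum.If_cases)
    also have "(\<Sum>p\<in>prime_factors Q \<inter> {p. real p \<le> z}. 1 / real p) \<le> (\<Sum>p\<in>primes_upto z. 1 / real p)"
      by (intro sum_mono2) (auto simp: in_prime_factors_iff prime_gt_0_nat)
    also have "\<dots> \<le> \<delta> * ln z + C" using C z by blast
    also have "real (card (prime_factors Q)) / z \<le> 1"
      using card_prime_factors_le[OF Q] z by (simp add: z_def)
    also have "ln z = ln 2 + ln (1 + ln (real Q))" unfolding z_def using lnQ by (subst ln_mult) auto
    finally show "(\<Sum>p\<in>prime_factors Q. 1 / real p) \<le> \<delta> * ln (1 + ln (real Q)) + (C + \<delta> * ln 2 + 1)"
      by (simp add: algebra_simps)
  qed
qed

lemma majorant_sum_powr:
  assumes "B > 0" "\<delta> > 0"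
  shows "\<exists>C>0. \<forall>Q>0. \<forall>x. (\<Sum>m\<in>nats_upto x. majorant B Q m) \<le> C * (1 + ln (real Q)) powr \<delta>"
proof -
  obtain C where C: "\<forall>Q>0. (\<Sum>p\<in>prime_factors Q. 1 / real p) \<le> (\<delta> / (4 * B)) * ln (1 + ln (real Q)) + C"
    using sum_prime_factors_inverse[of "\<delta> / (4 * B)"] assms by auto
  show ?thesis
  proof (rule exI[of _ "exp (4 * B * (C + p32))"], intro conjI allI impI)
    fix Q :: nat and x :: real assume Q: "Q > 0"
    have "(\<Sum>m\<in>nats_upto x. majorant B Q m) \<le> exp (4 * B * ((\<Sum>p\<in>prime_factors Q. 1 / real p) + p32))"
      by (rule majorant_sum_bound) (use assms Q in auto)
    also have "\<dots> \<le> exp (4 * B * (((\<delta> / (4 * B)) * ln (1 + ln (real Q)) + C) + p32))"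
      using C Q assms by (intro exp_mono mult_left_mono add_right_mono) auto
    also have "4 * B * (((\<delta> / (4 * B)) * ln (1 + ln (real Q)) + C) + p32) =
        4 * B * (C + p32) + \<delta> * ln (1 + ln (real Q))"
      using assms by (simp add: field_simps)
    also have "exp \<dots> = exp (4 * B * (C + p32)) * (1 + ln (real Q)) powr \<delta>"
    proof -
      have "1 + ln (real Q) > 0" using Q by (intro add_pos_nonneg) auto
      then show ?thesis by (simp add: exp_add powr_def)
    qed
    finally show "(\<Sum>m\<in>nats_upto x. majorant B Q m) \<le> exp (4 * B * (C + p32)) * (1 + ln (real Q)) powr \<delta>" .
  qed auto
qed

end

section \<open>Moebius sums with multiplicative weights\<close>

lemma prod_prime_factors_squarefree:
  assumes "squarefree (n::nat)"
  shows "\<Prod>(prime_factors n) = n"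
proof -
  have n: "n \<noteq> 0" by (rule notI) (use assms in simp)
  then have "\<forall>p\<in>prime_factors n. multiplicity p n = 1"
    using assms squarefree_factorial_semiring' by blast
  then show ?thesis using prod_prime_factors[OF n] by simp
qed

text \<open>The Dirichlet factor that leads from \<open>moebius n / n\<close> to
  \<open>moebius n\<close> times the product of \<open>u\<close> (see
  \<open>moebius_prod_eq_convolution\<close>). Its numerator depends only on the primes dividing m,
  so it need not vanish at higher prime powers.\<close>

definition bcoef :: "(nat \<Rightarrow> real) \<Rightarrow> nat \<Rightarrow> real" where
  "bcoef u m = (\<Prod>p\<in>prime_factors m. 1 - real p * u p) / real m"

definition Tsum :: "(nat \<Rightarrow> real) \<Rightarrow> real \<Rightarrow> real" where
  "Tsum u x = (\<Sum>d\<in>nats_upto x. moebius d * (\<Prod>p\<in>prime_factors d. u p) * ln (x / real d))"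

definition Pconst :: "(nat \<Rightarrow> real) \<Rightarrow> real" where
  "Pconst u = (\<Sum>m. bcoef u m)"

text \<open>The weight \<open>u p\<close> is within B/p^2 of 1/p off \<open>Q\<close> and within B/p
  of it at the prime factors of \<open>Q\<close>, which makes \<open>bcoef\<close> absolutely
  summable.\<close>

definition admissible :: "real \<Rightarrow> nat \<Rightarrow> (nat \<Rightarrow> real) \<Rightarrow> bool" where
  "admissible B Q u \<longleftrightarrow> (\<forall>p. prime p \<longrightarrow> \<bar>1 - real p * u p\<bar> \<le> vloc B Q p)"

text \<open>By \<open>sum_moebius_prod\<close> the divisor sum of \<open>moebius d\<close> times the
  product of the p u(p) is the product of the 1 - p u(p), that is \<open>m * bcoef u m\<close>.
  Moebius inversion and division by \<open>n\<close> finish.\<close>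

lemma moebius_prod_eq_convolution:
  assumes "n > 0"
  shows "moebius n * (\<Prod>p\<in>prime_factors n. u p) =
         (\<Sum>m | m dvd n. bcoef u m * (moebius (n div m) / real (n div m)))"
proof -
  let ?f = "\<lambda>d. moebius d * (\<Prod>p\<in>prime_factors d. real p * u p)"
  have "?f n = (\<Sum>m | m dvd n. (real m * bcoef u m) * moebius (n div m))"
  proof (rule moebius_inversion[OF assms])
    fix m assume "m dvd n"
    then have m: "m > 0" using assms by (auto dest: dvd_pos_nat)
    show "real m * bcoef u m = (\<Sum>d | d dvd m. ?f d)"
      unfolding sum_moebius_prod[OF m] using m by (simp add: bcoef_def)
  qed
  moreover have "?f n = real n * (moebius n * (\<Prod>p\<in>prime_factors n. u p))"
  proof (cases "squarefree n")
    case True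
    then have "(\<Prod>p\<in>prime_factors n. real p) = real n"
      using prod_prime_factors_squarefree[of n] by (simp flip: of_nat_prod)
    then show ?thesis by (simp add: prod.distrib)
  qed (simp add: moebius_def)
  moreover have "(\<Sum>m | m dvd n. (real m * bcoef u m) * moebius (n div m)) =
      real n * (\<Sum>m | m dvd n. bcoef u m * (moebius (n div m) / real (n div m)))"
    unfolding sum_distrib_left
  proof (intro sum.cong refl)
    fix m assume "m \<in> {m. m dvd n}"
    then obtain k where k: "n = m * k" by (auto elim: dvdE)
    with assms have "m > 0" "k > 0" by (cases m; cases k; simp)+
    then show "real m * bcoef u m * moebius (n div m) = real n * (bcoef u m * (moebius (n div m) / real (n div m)))"
      using k by simp
  qed
  ultimately have "real n * (moebius n * (\<Prod>p\<in>prime_factors n. u p)) =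
     real n * (\<Sum>m | m dvd n. bcoef u m * (moebius (n div m) / real (n div m)))" by simp
  with assms show ?thesis by simp
qed

lemma Tsum_eq_sum_bcoef:
  "Tsum u x = (\<Sum>m\<in>nats_upto x. bcoef u m * Tsum1 (x / real m))"
proof -
  have "Tsum u x = (\<Sum>n\<in>nats_upto x. \<Sum>m | m dvd n.
      bcoef u m * (moebius (n div m) / real (n div m)) * ln (x / real m / real (n div m)))"
    unfolding Tsum_def
  proof (intro sum.cong refl)
    fix n assume n: "n \<in> nats_upto x"
    then show "moebius n * (\<Prod>p\<in>prime_factors n. u p) * ln (x / real n) = (\<Sum>m | m dvd n.
      bcoef u m * (moebius (n div m) / real (n div m)) * ln (x / real m / real (n div m)))"
      by (subst moebius_prod_eq_convolution) (auto simp: sum_distrib_right intro!: sum.cong simp flip: of_nat_mult)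
  qed
  also have "\<dots> = (\<Sum>m\<in>nats_upto x. \<Sum>e\<in>nats_upto (x / real m).
      bcoef u m * (moebius e / real e) * ln (x / real m / real e))"
    by (rule sum_divisors_hyperbola)
  also have "\<dots> = (\<Sum>m\<in>nats_upto x. bcoef u m * Tsum1 (x / real m))"
    unfolding Tsum1_def sum_distrib_left by (simp add: mult.assoc)
  finally show ?thesis .
qed

lemma abs_bcoef_le:
  assumes "admissible B Q u"
  shows "\<bar>bcoef u m\<bar> \<le> majorant B Q m"
proof -
  have "(\<Prod>p\<in>prime_factors m. \<bar>1 - real p * u p\<bar>) \<le> (\<Prod>p\<in>prime_factors m. vloc B Q p)"
    using assms by (intro prod_mono) (auto simp: admissible_def in_prime_factors_iff)
  then show ?thesis by (simp add: bcoef_def majorant_def abs_prod divide_right_mono)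
qed

lemma sum_bcoef_subset:
  assumes "admissible B Q u" "B \<ge> 0" "finite A" "0 \<notin> A" "\<And>m. m \<in> A \<Longrightarrow> y < real m"
    "\<And>x. (\<Sum>m\<in>{m\<in>nats_upto x. y < real m}. majorant B Q m) \<le> T"
  shows "(\<Sum>m\<in>A. \<bar>bcoef u m\<bar>) \<le> T"
proof -
  have "(\<Sum>m\<in>A. \<bar>bcoef u m\<bar>) \<le> (\<Sum>m\<in>A. majorant B Q m)"
    using abs_bcoef_le[OF assms(1)] by (intro sum_mono)
  also have "\<dots> \<le> (\<Sum>m\<in>{m\<in>nats_upto (real (Max A)). y < real m}. majorant B Q m)"
    using assms majorant_nonneg by (intro sum_mono2) (auto intro!: Nat.gr0I)
  also have "\<dots> \<le> T" by (rule assms(6))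
  finally show ?thesis .
qed

lemma bcoef_0 [simp]: "bcoef u 0 = 0"
  by (simp add: bcoef_def)

lemma summable_abs_bcoef:
  assumes u: "admissible B Q u" "B \<ge> 0" "Q > 0"
  shows "summable (\<lambda>m. \<bar>bcoef u m\<bar>)"
proof (rule bounded_imp_summable)
  fix n
  have "(\<Sum>m\<le>n. \<bar>bcoef u m\<bar>) = (\<Sum>m\<in>{1..n}. \<bar>bcoef u m\<bar>)"
    by (intro sum.mono_neutral_right) (auto simp: Suc_le_eq)
  also have "\<dots> \<le> exp (4 * B * ((\<Sum>p\<in>prime_factors Q. 1 / real p) + p32))"
  proof (rule sum_bcoef_subset[OF u(1,2), of _ 0])
    fix x
    have "{m\<in>nats_upto x. 0 < real m} = nats_upto x" by auto
    then show "(\<Sum>m\<in>{m\<in>nats_upto x. 0 < real m}. majorant B Q m) \<le> exp (4 * B * ((\<Sum>p\<in>prime_factors Q. 1 / real p) + p32))"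
      using majorant_sum_bound[OF u(2,3), of x] by simp
  qed auto
  finally show "(\<Sum>m\<le>n. \<bar>bcoef u m\<bar>) \<le> exp (4 * B * ((\<Sum>p\<in>prime_factors Q. 1 / real p) + p32))" .
qed simp

lemma bcoef_sums:
  assumes "admissible B Q u" "B \<ge> 0" "Q > 0"
  shows "(\<lambda>N. \<Sum>m\<in>nats_upto (real N). bcoef u m) \<longlonglongrightarrow> Pconst u"
proof -
  have "summable (bcoef u)" using summable_abs_bcoef[OF assms] by (rule summable_rabs_cancel)
  then have "(\<lambda>N. \<Sum>m\<le>N. bcoef u m) \<longlonglongrightarrow> Pconst u"
    unfolding Pconst_def by (rule summable_LIMSEQ')
  moreover have "(\<Sum>m\<le>N. bcoef u m) = (\<Sum>m\<in>nats_upto (real N). bcoef u m)" for N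
    by (intro sum.mono_neutral_right) (auto intro!: Nat.gr0I)
  ultimately show ?thesis by simp
qed

lemma Pconst_tail:
  assumes u: "admissible B Q u" "B \<ge> 0" "Q > 0"
    and T: "\<And>x. (\<Sum>m\<in>{m\<in>nats_upto x. y < real m}. majorant B Q m) \<le> T"
  shows "\<bar>Pconst u - (\<Sum>m\<in>nats_upto y. bcoef u m)\<bar> \<le> T"
proof -
  have "(\<lambda>N. \<bar>(\<Sum>m\<in>nats_upto (real N). bcoef u m) - (\<Sum>m\<in>nats_upto y. bcoef u m)\<bar>)
     \<longlonglongrightarrow> \<bar>Pconst u - (\<Sum>m\<in>nats_upto y. bcoef u m)\<bar>"
    by (intro tendsto_intros bcoef_sums[OF u])
  moreover have "\<forall>\<^sub>F N in sequentially. \<bar>(\<Sum>m\<in>nats_upto (real N). bcoef u m) - (\<Sum>m\<in>nats_upto y. bcoef u m)\<bar> \<le> T"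
  proof (rule eventually_sequentiallyI[of "nat \<lceil>y\<rceil>"])
    fix N assume "nat \<lceil>y\<rceil> \<le> N"
    then have N: "y \<le> real N" by linarith
    then have sub: "nats_upto y \<subseteq> nats_upto (real N)" by auto
    have "\<bar>(\<Sum>m\<in>nats_upto (real N). bcoef u m) - (\<Sum>m\<in>nats_upto y. bcoef u m)\<bar> =
      \<bar>\<Sum>m\<in>nats_upto (real N) - nats_upto y. bcoef u m\<bar>"
      using sub by (subst sum_diff) auto
    also have "\<dots> \<le> (\<Sum>m\<in>nats_upto (real N) - nats_upto y. \<bar>bcoef u m\<bar>)" by (rule sum_abs)
    also have "\<dots> \<le> T" by (rule sum_bcoef_subset[OF u(1,2) _ _ _ T]) auto
    finally show "\<bar>(\<Sum>m\<in>nats_upto (real N). bcoef u m) - (\<Sum>m\<in>nats_upto y. bcoef u m)\<bar> \<le> T" .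
  qed
  ultimately show ?thesis by (intro tendsto_upperbound) auto
qed

text \<open>The product over primes up to N is the sum of \<open>bcoef\<close> over N-smooth
  numbers, and these include 1 to N. The distance to the full series is thus at most the tail of the
  absolute series.\<close>

lemma Pconst_euler_product:
  assumes u: "admissible B Q u" "B \<ge> 0" "Q > 0"
  shows "(\<lambda>N. \<Prod>p\<in>primes_upto (real N). (1 - u p) / (1 - 1 / real p)) \<longlonglongrightarrow> Pconst u"
proof -
  define E where "E = (\<lambda>N. \<Prod>p\<in>primes_upto (real N). (1 - u p) / (1 - 1 / real p))"
  define A where "A = (\<Sum>m. \<bar>bcoef u m\<bar>)"
  have sm: "summable (\<lambda>m. \<bar>bcoef u m\<bar>)" by (rule summable_abs_bcoef[OF u])
  have hsP: "(bcoef u has_sum Pconst u) UNIV"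
    unfolding Pconst_def using sm summable_rabs_cancel[OF sm]
    by (intro norm_summable_imp_has_sum) (auto simp: summable_sums)
  have hsA: "((\<lambda>m. \<bar>bcoef u m\<bar>) has_sum A) UNIV"
    unfolding A_def using sm by (intro norm_summable_imp_has_sum) (auto simp: summable_sums)
  have b: "bcoef u = (\<lambda>m. (\<Prod>p\<in>prime_factors m. 1 - real p * u p) * (1 / real m))"
    by (simp add: bcoef_def fun_eq_iff)
  have b': "(\<lambda>m. \<bar>bcoef u m\<bar>) = (\<lambda>m. (\<Prod>p\<in>prime_factors m. \<bar>1 - real p * u p\<bar>) * (1 / real m))"
    by (simp add: bcoef_def fun_eq_iff abs_prod)
  have bound: "norm (E N - Pconst u) \<le> A - (\<Sum>m\<le>N. \<bar>bcoef u m\<bar>)" for N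
  proof -
    let ?P = "primes_upto (real N)"
    have P: "finite ?P" "\<And>p. p \<in> ?P \<Longrightarrow> prime p" by auto
    have "(bcoef u has_sum (\<Prod>p\<in>?P. 1 + (1 - real p * u p) * ((1 / real p) / (1 - 1 / real p)))) (smooth_nats ?P)"
      unfolding b by (rule inv_nat.has_sum_smooth[OF P])
    also have "(\<Prod>p\<in>?P. 1 + (1 - real p * u p) * ((1 / real p) / (1 - 1 / real p))) = E N"
      unfolding E_def
    proof (intro prod.cong refl)
      fix p assume "p \<in> ?P"
      then have "real p > 1" using prime_gt_1_nat by auto
      then show "1 + (1 - real p * u p) * ((1 / real p) / (1 - 1 / real p)) = (1 - u p) / (1 - 1 / real p)"
        by (simp add: field_simps)
    qed
    finally have 1: "(bcoef u has_sum E N) (smooth_nats ?P)" .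
    obtain A' where A': "((\<lambda>m. \<bar>bcoef u m\<bar>) has_sum A') (smooth_nats ?P)"
      unfolding b' using inv_nat.has_sum_smooth[OF P] by blast
    have "(\<Sum>m\<in>{1..N}. \<bar>bcoef u m\<bar>) \<le> A'"
    proof (rule finite_sum_le_has_sum[OF A'])
      have "prime_factors m \<subseteq> ?P" if "m > 0" "m \<le> N" for m
      proof
        fix p assume "p \<in> prime_factors m"
        then have "prime p" "p \<le> m" using that by (auto simp: in_prime_factors_iff dest: dvd_imp_le)
        then show "p \<in> ?P" using that by simp
      qed
      then show "{1..N} \<subseteq> smooth_nats ?P" unfolding smooth_nats_def by (intro subsetI) (simp add: Suc_le_eq)
    qed auto
    also have "(\<Sum>m\<in>{1..N}. \<bar>bcoef u m\<bar>) = (\<Sum>m\<le>N. \<bar>bcoef u m\<bar>)"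
      by (intro sum.mono_neutral_left) (auto simp: Suc_le_eq)
    finally have 2: "(\<Sum>m\<le>N. \<bar>bcoef u m\<bar>) \<le> A'" .
    have "norm (Pconst u - E N) \<le> A - A'"
      by (rule norm_infsum_le[OF has_sum_Diff[OF hsP 1] has_sum_Diff[OF hsA A']]) auto
    then have "norm (E N - Pconst u) \<le> A - A'" by (simp add: norm_minus_commute)
    with 2 show ?thesis by linarith
  qed
  have "(\<lambda>N. \<Sum>m\<le>N. \<bar>bcoef u m\<bar>) \<longlonglongrightarrow> A"
    unfolding A_def by (rule summable_LIMSEQ'[OF sm])
  then have "(\<lambda>N. A - (\<Sum>m\<le>N. \<bar>bcoef u m\<bar>)) \<longlonglongrightarrow> A - A" by (intro tendsto_intros)
  then have lim0: "(\<lambda>N. A - (\<Sum>m\<le>N. \<bar>bcoef u m\<bar>)) \<longlonglongrightarrow> 0" by simp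
  have "(\<lambda>N. E N - Pconst u) \<longlonglongrightarrow> 0"
    by (rule Lim_null_comparison[OF _ lim0]) (use bound in auto)
  then have "E \<longlonglongrightarrow> Pconst u" by (simp add: LIM_zero_iff)
  then show ?thesis by (simp add: E_def)
qed

section \<open>Estimates for large \<open>L\<close>, uniform in the modulus\<close>

lemma eventually_powr_le:
  assumes "a < (b::real)"
  shows "\<forall>\<^sub>F L in at_top. C * L powr a \<le> L powr b"
proof -
  have c: "b - a > 0" using assms by simp
  have "filterlim (\<lambda>L::real. L powr (b - a)) at_top at_top"
    using c by real_asymp
  then have "\<forall>\<^sub>F L in at_top. C \<le> L powr (b - a)" by (simp add: filterlim_at_top)
  then show ?thesis using eventually_gt_at_top[of 0]
  proof eventually_elim
    case (elim L)
    have "C * L powr a \<le> L powr (b - a) * L powr a" using elim by (intro mult_right_mono) auto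
    also have "\<dots> = L powr b" by (simp flip: powr_add)
    finally show ?case .
  qed
qed

lemma majorant_tail_small:
  assumes "B > 0" "K > 0"
  shows "\<forall>\<^sub>F L in at_top. \<forall>Q>0. ln (real Q) \<le> K * L \<longrightarrow> (\<forall>y>0. L powr (3/4) / 2 \<le> ln y \<longrightarrow>
           (\<forall>x. (\<Sum>m\<in>{m\<in>nats_upto x. y < real m}. majorant B Q m) \<le> 1 / L))"
proof -
  \<comment> \<open>The first two summands bound the Rankin exponent divided by sqrt L, and the 2
    pays for ln L <= 2 sqrt L. Together they fit below ln y / 2, which is at least
    L^(3/4)/4.\<close>
  define c where "c = 24 * B * sqrt K + 4 * B * p32 + 2"
  have ev: "\<forall>\<^sub>F L in at_top. (4 * c) * L powr (1/2) \<le> L powr (3/4)"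
    by (rule eventually_powr_le) simp
  show ?thesis using ev eventually_ge_at_top[of 1]
  proof eventually_elim
    case (elim L)
    show ?case
    proof (intro allI impI)
      fix Q :: nat and y x :: real
      assume Q: "Q > 0" "ln (real Q) \<le> K * L" and y: "y > 0" "L powr (3/4) / 2 \<le> ln y"
      have sL: "sqrt L \<ge> 1" using elim by simp
      have "sqrt (ln (real Q)) \<le> sqrt K * sqrt L" using Q(2) by (simp flip: real_sqrt_mult)
      then have "4 * B * (6 * sqrt (ln (real Q)) + p32) \<le> 4 * B * (6 * (sqrt K * sqrt L) + p32)"
        using assms by (intro mult_left_mono add_right_mono) auto
      also have "\<dots> \<le> (c - 2) * sqrt L"
        using assms sL p32_nonneg mult_left_mono[OF sL, of "4 * B * p32"] by (simp add: c_def algebra_simps)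
      finally have 1: "4 * B * (6 * sqrt (ln (real Q)) + p32) \<le> (c - 2) * sqrt L" .
      have "ln (sqrt L) \<le> sqrt L" using ln_le_minus_one[of "sqrt L"] sL by linarith
      then have 2: "ln L \<le> 2 * sqrt L" using elim by (simp add: ln_sqrt)
      have 3: "c * sqrt L \<le> ln y / 2" using elim y by (simp add: powr_half_sqrt)
      have "(\<Sum>m\<in>{m\<in>nats_upto x. y < real m}. majorant B Q m) \<le> exp (4 * B * (6 * sqrt (ln (real Q)) + p32)) / sqrt y"
        by (rule majorant_tail) (use assms Q y in auto)
      also have "sqrt y = exp (ln y / 2)" using y by (simp add: ln_sqrt[symmetric] exp_ln)
      also have "exp (4 * B * (6 * sqrt (ln (real Q)) + p32)) / exp (ln y / 2) =
          exp (4 * B * (6 * sqrt (ln (real Q)) + p32) - ln y / 2)" by (simp add: exp_diff)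
      also have "\<dots> \<le> exp (- ln L)" using 1 2 3 by (intro exp_mono) (simp add: algebra_simps)
      also have "\<dots> = 1 / L" using elim by (simp add: exp_minus field_simps)
      finally show "(\<Sum>m\<in>{m\<in>nats_upto x. y < real m}. majorant B Q m) \<le> 1 / L" .
    qed
  qed
qed

context prime_number_estimate
begin

lemma majorant_sum_small:
  assumes "B > 0" "K > 0" "\<delta> > 0"
  shows "\<forall>\<^sub>F L in at_top. \<forall>Q>0. ln (real Q) \<le> K * L \<longrightarrow>
           (\<forall>x. (\<Sum>m\<in>nats_upto x. majorant B Q m) \<le> L powr \<delta>)"
proof -
  obtain C where C: "C > 0" "\<forall>Q>0. \<forall>x. (\<Sum>m\<in>nats_upto x. majorant B Q m) \<le> C * (1 + ln (real Q)) powr (\<delta> / 2)"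
    using majorant_sum_powr[of B "\<delta> / 2"] assms by auto
  have ev: "\<forall>\<^sub>F L in at_top. (C * (1 + K) powr (\<delta> / 2)) * L powr (\<delta> / 2) \<le> L powr \<delta>"
    using assms by (intro eventually_powr_le) simp
  show ?thesis using ev eventually_ge_at_top[of 1]
  proof eventually_elim
    case (elim L)
    show ?case
    proof (intro allI impI)
      fix Q :: nat and x :: real
      assume Q: "Q > 0" "ln (real Q) \<le> K * L"
      have "(\<Sum>m\<in>nats_upto x. majorant B Q m) \<le> C * (1 + ln (real Q)) powr (\<delta> / 2)" using C Q by blast
      also have "\<dots> \<le> C * ((1 + K) * L) powr (\<delta> / 2)"
      proof (intro mult_left_mono powr_mono2)
        show "0 \<le> 1 + ln (real Q)" using Q by (intro add_nonneg_nonneg) auto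
        show "1 + ln (real Q) \<le> (1 + K) * L" using Q elim by (simp add: algebra_simps)
      qed (use C assms in auto)
      also have "\<dots> = (C * (1 + K) powr (\<delta> / 2)) * L powr (\<delta> / 2)"
        using assms elim by (simp add: powr_mult)
      also have "\<dots> \<le> L powr \<delta>" by (rule elim)
      finally show "(\<Sum>m\<in>nats_upto x. majorant B Q m) \<le> L powr \<delta>" .
    qed
  qed
qed

lemma Tsum1_abs_bound: "\<exists>C>0. \<forall>x\<ge>1. \<bar>Tsum1 x\<bar> \<le> C"
proof -
  obtain K where K: "K \<ge> 0" "\<forall>x\<ge>1. \<bar>Tsum1 x - 1\<bar> \<le> K / sqrt (sqrt (1 + ln x))"
    using Tsum1_bound by blast
  have "\<bar>Tsum1 x\<bar> \<le> K + 1" if x: "x \<ge> 1" for x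
  proof -
    have "1 \<le> sqrt (sqrt (1 + ln x))" using x by simp
    then have "K / sqrt (sqrt (1 + ln x)) \<le> K / 1" using K by (intro divide_left_mono) auto
    then show ?thesis using K(2)[rule_format, OF x] by linarith
  qed
  then show ?thesis using K(1) by (intro exI[of _ "K + 1"]) auto
qed

text \<open>The convolution is split at m = sqrt x. Below, \<open>Tsum1 (x / m)\<close> is within
  O((ln x)^(-1/4)) of 1; above, the Rankin tail is at most 1/L. \<open>Q\<close> and
  \<open>u\<close> are quantified after \<open>L\<close> because \<open>Q\<close> will be
  \<open>e\<close> times a difference of shifts with \<open>e\<close> running up to
  \<open>R\<close>. When ln x is below L^(3/4), a small power of \<open>L\<close> has to do as a
  bound.\<close>

theorem Tsum_uniform:
  assumes "B > 0" "K > 0" "\<delta> > 0"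
  shows "\<forall>\<^sub>F L in at_top. \<forall>Q u. Q > 0 \<longrightarrow> ln (real Q) \<le> K * L \<longrightarrow> admissible B Q u \<longrightarrow>
     \<bar>Pconst u\<bar> \<le> L powr \<delta> \<and> (\<forall>x\<ge>1. \<bar>Tsum u x\<bar> \<le> L powr \<delta>) \<and>
     (\<forall>x>0. L powr (3/4) \<le> ln x \<longrightarrow> \<bar>Tsum u x - Pconst u\<bar> \<le> L powr (- 1/8))"
proof -
  obtain C where C: "C > 0" "\<forall>x\<ge>1. \<bar>Tsum1 x\<bar> \<le> C" using Tsum1_abs_bound by blast
  obtain K1 where K1: "K1 \<ge> 0" "\<forall>x\<ge>1. \<bar>Tsum1 x - 1\<bar> \<le> K1 / sqrt (sqrt (1 + ln x))"
    using Tsum1_bound by blast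
  \<comment> \<open>With d at most 1/32 the exponent d - 3/16 is at most -5/32, strictly below the
    target -1/8; the slack absorbs the constants.\<close>
  define d where "d = min (\<delta> / 2) (1/32)"
  have d: "d > 0" "d < \<delta>" "d \<le> 1/32" using assms by (auto simp: d_def)
  have ev: "\<forall>\<^sub>F L in at_top. C * L powr d \<le> L powr \<delta>" "\<forall>\<^sub>F L in at_top. 1 * L powr d \<le> L powr \<delta>"
    "\<forall>\<^sub>F L in at_top. (2 * K1 + C + 1) * L powr (- 5/32) \<le> L powr (- 1/8)"
    using d by (intro eventually_powr_le; simp)+
  show ?thesis using ev eventually_ge_at_top[of 1] majorant_sum_small[OF assms(1,2) d(1)] majorant_tail_small[OF assms(1,2)]
  proof eventually_elim
    case (elim L)
    have L: "L \<ge> 1" using elim by simp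
    show ?case
    proof (intro allI impI conjI)
      fix Q u assume Q: "Q > 0" "ln (real Q) \<le> K * L" and u: "admissible B Q u"
      have S: "(\<Sum>m\<in>nats_upto x. majorant B Q m) \<le> L powr d" for x using elim Q by blast
      have Sb: "(\<Sum>m\<in>nats_upto x. \<bar>bcoef u m\<bar>) \<le> L powr d" for x
        using sum_mono[of "nats_upto x" "\<lambda>m. \<bar>bcoef u m\<bar>" "majorant B Q"] abs_bcoef_le[OF u] S[of x] by (meson order_trans)
      have "\<bar>Pconst u - (\<Sum>m\<in>nats_upto 0. bcoef u m)\<bar> \<le> L powr d"
      proof (rule Pconst_tail[OF u])
        fix x
        have "{m \<in> nats_upto x. 0 < real m} = nats_upto x" by auto
        then show "(\<Sum>m\<in>{m \<in> nats_upto x. 0 < real m}. majorant B Q m) \<le> L powr d" using S[of x] by simp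
      qed (use assms Q in auto)
      moreover have "nats_upto 0 = {}" by auto
      ultimately have "\<bar>Pconst u\<bar> \<le> L powr d" by simp
      then show "\<bar>Pconst u\<bar> \<le> L powr \<delta>" using elim by simp
      have Tb: "\<bar>Tsum1 (x / real m)\<bar> \<le> C" if "m \<in> nats_upto x" for m x
        using C that by (simp add: field_simps)
      show "\<bar>Tsum u x\<bar> \<le> L powr \<delta>" if "x \<ge> 1" for x
      proof -
        have "\<bar>Tsum u x\<bar> \<le> (\<Sum>m\<in>nats_upto x. \<bar>bcoef u m\<bar> * C)"
          unfolding Tsum_eq_sum_bcoef
          by (rule order_trans[OF sum_abs], rule sum_mono) (use Tb in \<open>auto simp: abs_mult intro!: mult_left_mono\<close>)
        also have "\<dots> \<le> L powr d * C" unfolding sum_distrib_right[symmetric] using Sb C by (intro mult_right_mono) auto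
        also have "\<dots> \<le> L powr \<delta>" using elim by (simp add: mult.commute)
        finally show ?thesis .
      qed
      show "\<bar>Tsum u x - Pconst u\<bar> \<le> L powr (- 1/8)" if x: "x > 0" "L powr (3/4) \<le> ln x" for x
      proof -
        define y where "y = sqrt x"
        have lny: "ln y = ln x / 2" using x by (simp add: y_def ln_sqrt)
        have "1 \<le> L powr (3/4)" using L by (simp add: ge_one_powr_ge_zero)
        then have "ln x \<ge> 1" using x by simp
        then have x1: "x \<ge> 1" using x ln_ge_zero_iff[of x] by linarith
        have y: "y \<ge> 1" "y * y = x" "y \<le> x" using x1 x
          by (auto simp: y_def intro: real_le_lsqrt) (intro real_le_lsqrt, auto simp: power2_eq_square mult_le_cancel_left1)
        have tail: "(\<Sum>m\<in>{m\<in>nats_upto z. y < real m}. majorant B Q m) \<le> 1 / L" for z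
          using elim(6) Q x y lny by simp
        \<comment> \<open>The fourth root of L^(3/4), matching the fourth root in
          \<open>Tsum1_bound\<close>.\<close>
        define t where "t = L powr (3/16)"
        have t: "t \<ge> 1" using L by (simp add: t_def ge_one_powr_ge_zero)
        have t4: "t ^ 4 = L powr (3/4)" using L by (simp add: t_def powr_power)
        define A where "A = nats_upto y"
        define A' where "A' = {m\<in>nats_upto x. y < real m}"
        have split: "nats_upto x = A \<union> A'" "A \<inter> A' = {}" "finite A" using y(3) by (auto simp: A_def A'_def)
        have "finite A'" using split(1) finite_nats_upto[of x] by simp
        have "Tsum u x - Pconst u = (\<Sum>m\<in>A. bcoef u m * (Tsum1 (x / real m) - 1)) +
          (\<Sum>m\<in>A'. bcoef u m * Tsum1 (x / real m)) - (Pconst u - (\<Sum>m\<in>nats_upto y. bcoef u m))"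
          unfolding Tsum_eq_sum_bcoef split(1)
          by (subst sum.union_disjoint) (use split(2,3) \<open>finite A'\<close> in \<open>auto simp: A_def algebra_simps sum_subtractf\<close>)
        moreover have "\<bar>\<Sum>m\<in>A. bcoef u m * (Tsum1 (x / real m) - 1)\<bar> \<le> L powr d * (2 * K1 / t)"
        proof -
          have "\<bar>\<Sum>m\<in>A. bcoef u m * (Tsum1 (x / real m) - 1)\<bar> \<le> (\<Sum>m\<in>A. \<bar>bcoef u m\<bar> * (2 * K1 / t))"
          proof (rule order_trans[OF sum_abs], rule sum_mono)
            fix m assume "m \<in> A"
            then have m: "m > 0" "real m \<le> y" by (auto simp: A_def)
            have xm: "y \<le> x / real m"
            proof -
              have "y * real m \<le> y * y" using m y by (intro mult_left_mono) auto
              then show ?thesis using m y by (simp add: field_simps)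
            qed
            then have "ln y \<le> ln (x / real m)" using y by (subst ln_le_cancel_iff) auto
            then have "(t / 2) ^ 4 \<le> 1 + ln (x / real m)"
              using t4 x(2) lny \<open>1 \<le> L powr (3/4)\<close> by (simp add: power_divide)
            then have "((t / 2)\<^sup>2)\<^sup>2 \<le> 1 + ln (x / real m)" by simp
            then have "t / 2 \<le> sqrt (sqrt (1 + ln (x / real m)))" by (intro real_le_rsqrt)
            then have "K1 / sqrt (sqrt (1 + ln (x / real m))) \<le> K1 / (t / 2)"
              using t K1 by (intro divide_left_mono mult_pos_pos) linarith+
            moreover have "\<bar>Tsum1 (x / real m) - 1\<bar> \<le> K1 / sqrt (sqrt (1 + ln (x / real m)))"
              using K1(2) xm y by (meson order_trans)
            ultimately have "\<bar>Tsum1 (x / real m) - 1\<bar> \<le> 2 * K1 / t" by (simp add: mult.commute)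
            then show "\<bar>bcoef u m * (Tsum1 (x / real m) - 1)\<bar> \<le> \<bar>bcoef u m\<bar> * (2 * K1 / t)"
              by (simp only: abs_mult) (intro mult_left_mono, auto)
          qed
          also have "\<dots> \<le> L powr d * (2 * K1 / t)"
            unfolding sum_distrib_right[symmetric] A_def using Sb K1 t by (intro mult_right_mono) auto
          finally show ?thesis .
        qed
        moreover have "\<bar>\<Sum>m\<in>A'. bcoef u m * Tsum1 (x / real m)\<bar> \<le> C / L"
        proof -
          have "\<bar>\<Sum>m\<in>A'. bcoef u m * Tsum1 (x / real m)\<bar> \<le> (\<Sum>m\<in>A'. majorant B Q m * C)"
          proof (rule order_trans[OF sum_abs], rule sum_mono)
            fix m assume "m \<in> A'"
            then have "\<bar>Tsum1 (x / real m)\<bar> \<le> C" by (intro Tb) (auto simp: A'_def)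
            then show "\<bar>bcoef u m * Tsum1 (x / real m)\<bar> \<le> majorant B Q m * C"
              using abs_bcoef_le[OF u] majorant_nonneg assms by (simp only: abs_mult) (intro mult_mono, auto)
          qed
          also have "\<dots> \<le> 1 / L * C"
            unfolding sum_distrib_right[symmetric] A'_def using tail C by (intro mult_right_mono) auto
          finally show ?thesis by simp
        qed
        moreover have "\<bar>Pconst u - (\<Sum>m\<in>nats_upto y. bcoef u m)\<bar> \<le> 1 / L"
          by (rule Pconst_tail[OF u _ _ tail]) (use assms Q in auto)
        moreover have "L powr d * (2 * K1 / t) + C / L + 1 / L \<le> (2 * K1 + C + 1) * L powr (- 5/32)"
        proof -
          have "L powr d * (2 * K1 / t) = 2 * K1 * L powr (d - 3/16)"
            by (simp add: t_def powr_diff)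
          also have "\<dots> \<le> 2 * K1 * L powr (- 5/32)"
            using K1 L d by (intro mult_left_mono powr_mono) auto
          finally have 1: "L powr d * (2 * K1 / t) \<le> 2 * K1 * L powr (- 5/32)" .
          have "1 / L = L powr (- 1)" using L by (simp add: powr_minus field_simps)
          also have "\<dots> \<le> L powr (- 5/32)" using L by (intro powr_mono) auto
          finally have 2: "1 / L \<le> L powr (- 5/32)" .
          have "C / L \<le> C * L powr (- 5/32)" using mult_left_mono[OF 2, of C] C by simp
          with 1 2 show ?thesis by (simp add: algebra_simps)
        qed
        ultimately show ?thesis using elim(3) by linarith
      qed
    qed
  qed
qed

end

section \<open>The singular sum over pairs of divisors\<close>

lemma coprime_iff_prime_factors:
  assumes "d > (0::nat)"
  shows "coprime d q \<longleftrightarrow> (\<forall>p\<in>prime_factors d. \<not> p dvd q)"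
proof
  assume c: "coprime d q"
  show "\<forall>p\<in>prime_factors d. \<not> p dvd q"
  proof
    fix p assume "p \<in> prime_factors d"
    then have "prime p" "p dvd d" by (auto simp: in_prime_factors_iff)
    show "\<not> p dvd q"
    proof
      assume "p dvd q"
      with \<open>p dvd d\<close> have "is_unit p" by (rule coprime_common_divisor[OF c])
      with \<open>prime p\<close> show False by simp
    qed
  qed
next
  assume a: "\<forall>p\<in>prime_factors d. \<not> p dvd q"
  show "coprime d q"
  proof (rule ccontr)
    assume "\<not> coprime d q"
    then have "gcd d q \<noteq> 1" unfolding coprime_iff_gcd_eq_1 .
    then obtain p where "prime p" "p dvd gcd d q" using prime_factor_nat by blast
    then show False using a assms by (auto simp: in_prime_factors_iff)
  qed
qed

lemma squarefree_dvd_iff: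
  assumes "squarefree (s::nat)"
  shows "s dvd g \<longleftrightarrow> (\<forall>p\<in>prime_factors s. p dvd g)"
proof
  assume "s dvd g"
  then show "\<forall>p\<in>prime_factors s. p dvd g" by (auto simp: in_prime_factors_iff intro: dvd_trans)
next
  assume a: "\<forall>p\<in>prime_factors s. p dvd g"
  show "s dvd g"
  proof (cases "g = 0")
    case False
    then have "prime_factors s \<subseteq> prime_factors g" using a by (auto simp: in_prime_factors_iff)
    then have "\<Prod>(prime_factors s) dvd (\<Prod>p\<in>prime_factors g. p)" by (intro prod_dvd_prod_subset) auto
    also have "(\<Prod>p\<in>prime_factors g. p) dvd (\<Prod>p\<in>prime_factors g. p ^ multiplicity p g)"
      by (intro prod_dvd_prod dvd_power) (auto simp: prime_factors_multiplicity)
    also have "\<dots> = g" using False prod_prime_factors[of g] by simp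
    finally show ?thesis using prod_prime_factors_squarefree[OF assms] by simp
  qed simp
qed

text \<open>A real-valued totient of the radical. It agrees with \<open>totient\<close> on
  squarefree arguments (\<open>totient_squarefree\<close>), which are the ones that
  \<open>moebius\<close> lets through.\<close>

definition phi :: "nat \<Rightarrow> real" where
  "phi d = (\<Prod>p\<in>prime_factors d. real p - 1)"

lemma phi_pos: "phi d > 0"
  unfolding phi_def by (intro prod_pos) (auto simp: in_prime_factors_iff dest!: prime_gt_1_nat)

lemma phi_mult: "coprime a b \<Longrightarrow> a > 0 \<Longrightarrow> b > 0 \<Longrightarrow> phi (a * b) = phi a * phi b"
  by (simp add: phi_def prod_prime_factors_mult)

lemma totient_squarefree:
  assumes "squarefree n"
  shows "real (totient n) = phi n"
proof -
  have "real n = (\<Prod>p\<in>prime_factors n. real p)"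
    using prod_prime_factors_squarefree[OF assms] by (simp flip: of_nat_prod)
  then have "real (totient n) = (\<Prod>p\<in>prime_factors n. real p * (1 - 1 / real p))"
    by (simp add: totient_formula2 prod.distrib)
  also have "\<dots> = phi n" unfolding phi_def
    by (intro prod.cong refl) (auto simp: in_prime_factors_iff prime_gt_0_nat field_simps)
  finally show ?thesis .
qed

text \<open>Coprimality to \<open>q\<close> is built into the weight, so that sums over d coprime to
  q are instances of \<open>Tsum\<close>, admissible with modulus \<open>q\<close>.\<close>

definition phi_weight :: "nat \<Rightarrow> nat \<Rightarrow> real" where
  "phi_weight q p = (if p dvd q then 0 else 1 / (real p - 1))"

lemma prod_phi_weight:
  assumes "d > 0"
  shows "(\<Prod>p\<in>prime_factors d. phi_weight q p) = (if coprime d q then 1 / phi d else 0)"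
proof (cases "coprime d q")
  case True
  then have "(\<Prod>p\<in>prime_factors d. phi_weight q p) = (\<Prod>p\<in>prime_factors d. 1 / (real p - 1))"
    using coprime_iff_prime_factors[OF assms, of q] by (intro prod.cong refl) (simp add: phi_weight_def)
  then show ?thesis using True by (simp add: phi_def prod_dividef)
next
  case False
  then obtain p where "p \<in> prime_factors d" "p dvd q" using coprime_iff_prime_factors[OF assms, of q] by blast
  then have "(\<Prod>p\<in>prime_factors d. phi_weight q p) = 0"
    by (intro prod_zero) (auto simp: phi_weight_def intro!: bexI[of _ p])
  then show ?thesis using False by simp
qed

lemma admissible_phi_weight: "admissible 2 q (phi_weight q)"
  unfolding admissible_def
proof (intro allI impI)
  fix p :: nat assume "prime p"
  then have p: "real p \<ge> 2" using prime_ge_2_nat by force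
  then have "1 - real p * (1 / (real p - 1)) = - (1 / (real p - 1))" by (simp add: field_simps)
  moreover have "1 / (real p - 1) \<le> 2 / real p" using p by (simp add: field_simps)
  ultimately show "\<bar>1 - real p * phi_weight q p\<bar> \<le> vloc 2 q p"
    using p by (auto simp: phi_weight_def vloc_def)
qed

text \<open>The local factor of the Moebius inverse of phi restricted to the divisors of g: the
  value p - 1 or 0 at the prime, minus the value 1 at 1.\<close>

definition floc :: "nat \<Rightarrow> nat \<Rightarrow> real" where
  "floc g p = (if p dvd g then real p - 2 else -1)"

definition fprod :: "nat \<Rightarrow> nat \<Rightarrow> real" where
  "fprod g e = (\<Prod>p\<in>prime_factors e. floc g p)"

lemma sum_fprod:
  assumes s: "squarefree s"
  shows "(\<Sum>e | e dvd s. fprod g e) = (if s dvd g then phi s else 0)"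
proof -
  have s0: "s > 0" by (rule Nat.gr0I) (use s in simp)
  have "(\<Sum>e | e dvd s. fprod g e) = (\<Sum>e | e dvd s \<and> squarefree e. fprod g e)"
    using s squarefree_mono by (intro sum.cong) auto
  also have "\<dots> = (\<Prod>p\<in>prime_factors s. 1 + floc g p)"
    unfolding fprod_def by (rule sum_squarefree_prod[OF s0])
  also have "\<dots> = (if s dvd g then phi s else 0)"
  proof (cases "s dvd g")
    case True
    then have "(\<Prod>p\<in>prime_factors s. 1 + floc g p) = phi s"
      unfolding phi_def using squarefree_dvd_iff[OF s] by (intro prod.cong refl) (simp add: floc_def)
    with True show ?thesis by simp
  next
    case False
    then obtain p where "p \<in> prime_factors s" "\<not> p dvd g" using squarefree_dvd_iff[OF s] by blast
    then have "(\<Prod>p\<in>prime_factors s. 1 + floc g p) = 0"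
      by (intro prod_zero) (auto simp: floc_def intro!: bexI[of _ p])
    with False show ?thesis by simp
  qed
  finally show ?thesis .
qed

section \<open>Selberg's diagonalisation\<close>

lemma squarefree_lcm_nat:
  assumes "squarefree (a::nat)" "squarefree b"
  shows "squarefree (lcm a b)" "prime_factors (lcm a b) = prime_factors a \<union> prime_factors b"
proof -
  have ab: "a \<noteq> 0" "b \<noteq> 0" by (rule notI; use assms in simp)+
  then have l: "lcm a b \<noteq> 0" by simp
  show "prime_factors (lcm a b) = prime_factors a \<union> prime_factors b"
  proof -
    have "lcm a b dvd a * b" by simp
    then have "prime p \<Longrightarrow> p dvd lcm a b \<Longrightarrow> p dvd a \<or> p dvd b" for p
      by (meson dvd_trans prime_dvd_mult_iff)
    then show ?thesis using ab l by (auto simp: in_prime_factors_iff intro: dvd_trans)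
  qed
  show "squarefree (lcm a b)"
  proof (subst squarefree_factorial_semiring''[OF l], intro allI impI)
    fix p :: nat assume p: "prime p"
    have "multiplicity p a \<le> 1" "multiplicity p b \<le> 1"
      using assms p squarefree_factorial_semiring''[OF ab(1)] squarefree_factorial_semiring''[OF ab(2)] by auto
    then show "multiplicity p (lcm a b) \<le> 1" using ab p by (simp add: multiplicity_lcm)
  qed
qed

lemma phi_lcm_gcd:
  assumes "squarefree (a::nat)" "squarefree b"
  shows "phi (lcm a b) * phi (gcd a b) = phi a * phi b"
proof -
  have ab: "a \<noteq> 0" "b \<noteq> 0" by (rule notI; use assms in simp)+
  have "prime_factors (gcd a b) = prime_factors a \<inter> prime_factors b"
    using ab by (auto simp: in_prime_factors_iff)
  then show ?thesis unfolding phi_def squarefree_lcm_nat(2)[OF assms] by (simp add: prod.union_inter)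
qed

text \<open>Since phi(lcm) phi(gcd) = phi(a) phi(b), the reciprocal totient is phi(gcd) over a
  product in separated variables. Expanding phi(gcd), together with its divisibility condition, over
  common divisors decouples \<open>a\<close> from \<open>b\<close>.\<close>

lemma inverse_totient_lcm:
  assumes "squarefree (a::nat)" "squarefree b"
  shows "(if gcd a b dvd g then 1 / real (totient (lcm a b)) else 0) =
         (\<Sum>e | e dvd a \<and> e dvd b. fprod g e) / (phi a * phi b)"
proof -
  have g: "squarefree (gcd a b)" using assms(1) by (rule squarefree_mono[rotated]) simp
  have "{e. e dvd a \<and> e dvd b} = {e. e dvd gcd a b}" by auto
  then have "(\<Sum>e | e dvd a \<and> e dvd b. fprod g e) = (if gcd a b dvd g then phi (gcd a b) else 0)"
    using sum_fprod[OF g] by simp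
  moreover have "phi (gcd a b) \<noteq> 0" "phi (lcm a b) \<noteq> 0" using phi_pos[of "gcd a b"] phi_pos[of "lcm a b"] by auto
  ultimately show ?thesis
    unfolding phi_lcm_gcd[OF assms, symmetric] totient_squarefree[OF squarefree_lcm_nat(1)[OF assms]] by simp
qed

text \<open>
  Two equal shifts correspond to \<open>g = 0\<close>, where the divisibility condition is void.
\<close>

definition Msum :: "real \<Rightarrow> nat \<Rightarrow> nat \<Rightarrow> nat \<Rightarrow> real" where
  "Msum R g h\<^sub>1 h\<^sub>2 = (\<Sum>d\<^sub>1\<in>nats_upto R. \<Sum>d\<^sub>2\<in>nats_upto R.
     if gcd d\<^sub>1 d\<^sub>2 dvd g \<and> coprime d\<^sub>1 h\<^sub>1 \<and> coprime d\<^sub>2 h\<^sub>2 then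
       (moebius d\<^sub>1 * ln (R / real d\<^sub>1)) * (moebius d\<^sub>2 * ln (R / real d\<^sub>2)) / real (totient (lcm d\<^sub>1 d\<^sub>2)) else 0)"

definition Acoef :: "real \<Rightarrow> nat \<Rightarrow> nat \<Rightarrow> real" where
  "Acoef R h d = (if coprime d h then moebius d * ln (R / real d) / phi d else 0)"

text \<open>Writing d = e t, the Moebius function forces t to be coprime to e, and this condition
  joins the one on \<open>h\<close>. That is why the inner weight is
  \<open>phi_weight (e * h)\<close> and varies with \<open>e\<close>.\<close>

lemma sum_Acoef_multiples:
  assumes e: "e > 0"
  shows "(\<Sum>d\<in>{d\<in>nats_upto R. e dvd d}. Acoef R h d) =
     (if coprime e h then moebius e / phi e else 0) * Tsum (phi_weight (e * h)) (R / real e)"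
proof -
  have "(\<Sum>d\<in>{d\<in>nats_upto R. e dvd d}. Acoef R h d) = (\<Sum>t\<in>nats_upto (R / real e). Acoef R h (e * t))"
    by (rule sum.reindex_bij_witness[of _ "\<lambda>t. e * t" "\<lambda>d. d div e"])
       (use e in \<open>auto elim!: dvdE simp: field_simps\<close>)
  also have "\<dots> = (\<Sum>t\<in>nats_upto (R / real e). (if coprime e h then moebius e / phi e else 0) *
     (moebius t * (\<Prod>p\<in>prime_factors t. phi_weight (e * h) p) * ln (R / real e / real t)))"
  proof (intro sum.cong refl)
    fix t assume "t \<in> nats_upto (R / real e)"
    then have t: "t > 0" by simp
    show "Acoef R h (e * t) = (if coprime e h then moebius e / phi e else 0) *
       (moebius t * (\<Prod>p\<in>prime_factors t. phi_weight (e * h) p) * ln (R / real e / real t))"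
    proof (cases "coprime e t")
      case True
      have "coprime (e * t) h \<longleftrightarrow> coprime e h \<and> coprime t h" by simp
      moreover have "coprime t (e * h) \<longleftrightarrow> coprime t h" using True by (simp add: coprime_commute)
      ultimately show ?thesis
        using True e t by (simp add: Acoef_def prod_phi_weight moebius_mult phi_mult)
    next
      case False
      then have "moebius (e * t) = 0" using squarefree_mult_imp_coprime by (auto simp: moebius_def)
      moreover have "\<not> coprime t (e * h)" using False by (simp add: coprime_commute)
      ultimately show ?thesis using t by (simp add: Acoef_def prod_phi_weight)
    qed
  qed
  also have "\<dots> = (if coprime e h then moebius e / phi e else 0) * Tsum (phi_weight (e * h)) (R / real e)"
    unfolding Tsum_def sum_distrib_left ..
  finally show ?thesis .
qed

text \<open>Selberg's diagonal weight. Both inner sums release a factor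
  \<open>moebius e / phi e\<close>; their product gives the squarefree condition and the square of
  \<open>phi e\<close>.\<close>

definition Wcoef :: "nat \<Rightarrow> nat \<Rightarrow> nat \<Rightarrow> nat \<Rightarrow> real" where
  "Wcoef g h\<^sub>1 h\<^sub>2 e = (if coprime e h\<^sub>1 \<and> coprime e h\<^sub>2 \<and> squarefree e then fprod g e / (phi e)\<^sup>2 else 0)"

lemma Msum_diagonal:
  "Msum R g h\<^sub>1 h\<^sub>2 = (\<Sum>e\<in>nats_upto R. Wcoef g h\<^sub>1 h\<^sub>2 e *
     (Tsum (phi_weight (e * h\<^sub>1)) (R / real e) * Tsum (phi_weight (e * h\<^sub>2)) (R / real e)))"
proof -
  have "Msum R g h\<^sub>1 h\<^sub>2 = (\<Sum>d\<^sub>1\<in>nats_upto R. \<Sum>d\<^sub>2\<in>nats_upto R. \<Sum>e\<in>nats_upto R.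
    (if e dvd d\<^sub>1 then Acoef R h\<^sub>1 d\<^sub>1 else 0) * (if e dvd d\<^sub>2 then Acoef R h\<^sub>2 d\<^sub>2 else 0) * fprod g e)"
    unfolding Msum_def
  proof (intro sum.cong refl)
    fix a b assume a: "a \<in> nats_upto R" and b: "b \<in> nats_upto R"
    show "(if gcd a b dvd g \<and> coprime a h\<^sub>1 \<and> coprime b h\<^sub>2 then
       (moebius a * ln (R / real a)) * (moebius b * ln (R / real b)) / real (totient (lcm a b)) else 0) =
       (\<Sum>e\<in>nats_upto R. (if e dvd a then Acoef R h\<^sub>1 a else 0) * (if e dvd b then Acoef R h\<^sub>2 b else 0) * fprod g e)"
    proof (cases "squarefree a \<and> squarefree b \<and> coprime a h\<^sub>1 \<and> coprime b h\<^sub>2")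
      case True
      have "(\<Sum>e\<in>nats_upto R. (if e dvd a then Acoef R h\<^sub>1 a else 0) * (if e dvd b then Acoef R h\<^sub>2 b else 0) * fprod g e)
         = (\<Sum>e | e dvd a \<and> e dvd b. Acoef R h\<^sub>1 a * Acoef R h\<^sub>2 b * fprod g e)"
      proof (rule sum.mono_neutral_cong_right)
        show "{e. e dvd a \<and> e dvd b} \<subseteq> nats_upto R"
        proof
          fix e assume "e \<in> {e. e dvd a \<and> e dvd b}"
          then have "e \<le> a" "e > 0" using a by (auto dest: dvd_imp_le intro: dvd_pos_nat)
          then show "e \<in> nats_upto R" using a by simp
        qed
      qed auto
      also have "\<dots> = Acoef R h\<^sub>1 a * Acoef R h\<^sub>2 b * (\<Sum>e | e dvd a \<and> e dvd b. fprod g e)"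
        by (simp add: sum_distrib_left)
      also have "\<dots> = (moebius a * ln (R / real a)) * (moebius b * ln (R / real b)) *
          ((\<Sum>e | e dvd a \<and> e dvd b. fprod g e) / (phi a * phi b))"
        using True by (simp add: Acoef_def)
      also have "\<dots> = (moebius a * ln (R / real a)) * (moebius b * ln (R / real b)) *
          (if gcd a b dvd g then 1 / real (totient (lcm a b)) else 0)"
        using True by (subst inverse_totient_lcm) auto
      finally show ?thesis using True by simp
    next
      case False
      then have "Acoef R h\<^sub>1 a = 0 \<or> Acoef R h\<^sub>2 b = 0" by (auto simp: Acoef_def moebius_def)
      moreover have "(if gcd a b dvd g \<and> coprime a h\<^sub>1 \<and> coprime b h\<^sub>2 then
       (moebius a * ln (R / real a)) * (moebius b * ln (R / real b)) / real (totient (lcm a b)) else 0) = 0"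
        using False by (auto simp: moebius_def)
      ultimately show ?thesis by (subst sum.neutral) auto
    qed
  qed
  also have "\<dots> = (\<Sum>e\<in>nats_upto R. \<Sum>d\<^sub>1\<in>nats_upto R. \<Sum>d\<^sub>2\<in>nats_upto R.
    (if e dvd d\<^sub>1 then Acoef R h\<^sub>1 d\<^sub>1 else 0) * (if e dvd d\<^sub>2 then Acoef R h\<^sub>2 d\<^sub>2 else 0) * fprod g e)"
    by (subst (2) sum.swap, subst sum.swap) (rule refl)
  also have "\<dots> = (\<Sum>e\<in>nats_upto R. fprod g e * ((\<Sum>d\<in>{d\<in>nats_upto R. e dvd d}. Acoef R h\<^sub>1 d) *
     (\<Sum>d\<in>{d\<in>nats_upto R. e dvd d}. Acoef R h\<^sub>2 d)))"
  proof (intro sum.cong refl)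
    fix e
    have *: "(\<Sum>d\<in>{d\<in>nats_upto R. e dvd d}. Acoef R h d) = (\<Sum>d\<in>nats_upto R. if e dvd d then Acoef R h d else 0)" for h
      by (rule sum.inter_filter) simp
    show "(\<Sum>d\<^sub>1\<in>nats_upto R. \<Sum>d\<^sub>2\<in>nats_upto R.
      (if e dvd d\<^sub>1 then Acoef R h\<^sub>1 d\<^sub>1 else 0) * (if e dvd d\<^sub>2 then Acoef R h\<^sub>2 d\<^sub>2 else 0) * fprod g e) =
      fprod g e * ((\<Sum>d\<in>{d\<in>nats_upto R. e dvd d}. Acoef R h\<^sub>1 d) * (\<Sum>d\<in>{d\<in>nats_upto R. e dvd d}. Acoef R h\<^sub>2 d))"
      unfolding * sum_product unfolding sum_distrib_left by (intro sum.cong refl) (simp only: mult_ac)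
  qed
  also have "\<dots> = (\<Sum>e\<in>nats_upto R. Wcoef g h\<^sub>1 h\<^sub>2 e *
     (Tsum (phi_weight (e * h\<^sub>1)) (R / real e) * Tsum (phi_weight (e * h\<^sub>2)) (R / real e)))"
  proof (intro sum.cong refl)
    fix e assume "e \<in> nats_upto R"
    then have e: "e > 0" by simp
    have m: "moebius e * moebius e = (if squarefree e then 1 else 0)" by (rule moebius_square)
    show "fprod g e * ((\<Sum>d\<in>{d\<in>nats_upto R. e dvd d}. Acoef R h\<^sub>1 d) * (\<Sum>d\<in>{d\<in>nats_upto R. e dvd d}. Acoef R h\<^sub>2 d)) =
      Wcoef g h\<^sub>1 h\<^sub>2 e * (Tsum (phi_weight (e * h\<^sub>1)) (R / real e) * Tsum (phi_weight (e * h\<^sub>2)) (R / real e))"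
    proof -
      have "fprod g e * ((if coprime e h\<^sub>1 then moebius e / phi e else 0) * (if coprime e h\<^sub>2 then moebius e / phi e else 0))
         = Wcoef g h\<^sub>1 h\<^sub>2 e"
        using m by (auto simp: Wcoef_def power2_eq_square)
      then show ?thesis unfolding sum_Acoef_multiples[OF e] by (simp only: mult_ac flip: \<open>_ = Wcoef g h\<^sub>1 h\<^sub>2 e\<close>)
    qed
  qed
  finally show ?thesis .
qed

text \<open>
  At \<open>p = 2\<close> the quotients by \<open>p - 2\<close> have the junk value \<open>0\<close>. This is harmless because an even \<open>e\<close>
  has \<open>Wcoef g h\<^sub>1 h\<^sub>2 e = 0\<close> in the relevant cases, and it makes \<open>sum_Wcoef_Tsum\<close> hold unconditionally.
\<close>

definition rho :: "nat \<Rightarrow> real" where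
  "rho e = (\<Prod>p\<in>prime_factors e. (real p - 1) / (real p - 2))"

text \<open>The weight left after resummation. For odd p it is 0 when p divides
  \<open>h\<^sub>2\<close>; 1/(p - 1) when p divides \<open>h\<^sub>1\<close> but not
  \<open>h\<^sub>2\<close>; 0 when p divides \<open>g\<close> and neither of them; and 1/(p - 2)
  when p divides none of the three.\<close>

definition ustar :: "nat \<Rightarrow> nat \<Rightarrow> nat \<Rightarrow> nat \<Rightarrow> real" where
  "ustar g h\<^sub>1 h\<^sub>2 p = (if p dvd h\<^sub>2 then 0
     else (1 - (if p dvd h\<^sub>1 then 0 else floc g p / (real p - 2))) / (real p - 1))"

text \<open>Exact resummation over n = e t. For squarefree n the factors are coprime and
  \<open>moebius t = moebius n * moebius e\<close>, so the sum over e expands a product of terms 1 -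
  \<open>\<kappa>\<close> p. If n is not squarefree, then e or t is not, or a common factor of the
  two makes the weight of t vanish.\<close>

lemma sum_Wcoef_Tsum:
  "(\<Sum>e\<in>nats_upto R. Wcoef g h\<^sub>1 h\<^sub>2 e * rho e * Tsum (phi_weight (e * h\<^sub>2)) (R / real e)) = Tsum (ustar g h\<^sub>1 h\<^sub>2) R"
proof -
  let ?U = "\<lambda>e t. \<Prod>p\<in>prime_factors t. phi_weight (e * h\<^sub>2) p"
  have "(\<Sum>e\<in>nats_upto R. Wcoef g h\<^sub>1 h\<^sub>2 e * rho e * Tsum (phi_weight (e * h\<^sub>2)) (R / real e)) =
    (\<Sum>e\<in>nats_upto R. \<Sum>t\<in>nats_upto (R / real e).
       Wcoef g h\<^sub>1 h\<^sub>2 e * rho e * (moebius t * ?U e t * ln (R / real e / real t)))"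
    unfolding Tsum_def sum_distrib_left ..
  also have "\<dots> = (\<Sum>n\<in>nats_upto R. \<Sum>e | e dvd n.
       Wcoef g h\<^sub>1 h\<^sub>2 e * rho e * (moebius (n div e) * ?U e (n div e) * ln (R / real e / real (n div e))))"
    by (rule sum_divisors_hyperbola[symmetric])
  also have "\<dots> = Tsum (ustar g h\<^sub>1 h\<^sub>2) R"
    unfolding Tsum_def
  proof (intro sum.cong refl)
    fix n assume "n \<in> nats_upto R"
    then have n: "n > 0" by simp
    have "(\<Sum>e | e dvd n. Wcoef g h\<^sub>1 h\<^sub>2 e * rho e * (moebius (n div e) * ?U e (n div e) * ln (R / real e / real (n div e)))) =
      (\<Sum>e | e dvd n. Wcoef g h\<^sub>1 h\<^sub>2 e * rho e * (moebius (n div e) * ?U e (n div e))) * ln (R / real n)"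
      unfolding sum_distrib_right by (intro sum.cong refl) (auto simp flip: of_nat_mult)
    also have "(\<Sum>e | e dvd n. Wcoef g h\<^sub>1 h\<^sub>2 e * rho e * (moebius (n div e) * ?U e (n div e))) =
       moebius n * (\<Prod>p\<in>prime_factors n. ustar g h\<^sub>1 h\<^sub>2 p)"
    proof (cases "squarefree n")
      case False
      have "Wcoef g h\<^sub>1 h\<^sub>2 e * rho e * (moebius (n div e) * ?U e (n div e)) = 0" if "e dvd n" for e
      proof -
        obtain t where t: "n = e * t" using \<open>e dvd n\<close> by (elim dvdE)
        then have et: "e > 0" "t > 0" using n by (cases e; cases t; simp)+
        show ?thesis
        proof (cases "coprime e t")
          case True
          then have "\<not> squarefree e \<or> \<not> squarefree t" using False t squarefree_mult_coprime by blast
          then show ?thesis using t et by (auto simp: Wcoef_def moebius_def)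
        next
          case False
          then have "\<not> coprime t (e * h\<^sub>2)" by (simp add: coprime_commute)
          then have "?U e t = 0" unfolding prod_phi_weight[OF et(2)] by (simp only: if_False)
          then show ?thesis using t et by simp
        qed
      qed
      then have "(\<Sum>e | e dvd n. Wcoef g h\<^sub>1 h\<^sub>2 e * rho e * (moebius (n div e) * ?U e (n div e))) = 0"
        by (intro sum.neutral) auto
      then show ?thesis using False by (simp add: moebius_def)
    next
      case True
      \<comment> \<open>This collects \<open>fprod\<close>, \<open>rho\<close> and one of the two
        factors 1/phi(e); the other joins 1/phi(t) to form 1/phi(n).\<close>
      define \<kappa> where "\<kappa> = (\<lambda>p. if p dvd h\<^sub>1 then 0 else floc g p / (real p - 2))"
      have "(\<Sum>e | e dvd n. Wcoef g h\<^sub>1 h\<^sub>2 e * rho e * (moebius (n div e) * ?U e (n div e))) =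
        (\<Sum>e | e dvd n. (if coprime n h\<^sub>2 then moebius n / phi n else 0) * (moebius e * (\<Prod>p\<in>prime_factors e. \<kappa> p)))"
      proof (intro sum.cong refl)
        fix e assume "e \<in> {e. e dvd n}"
        then obtain t where t: "n = e * t" by (auto elim: dvdE)
        then have et: "e > 0" "t > 0" using n by (cases e; cases t; simp)+
        have c: "coprime e t" using True t squarefree_mult_imp_coprime by blast
        have sf: "squarefree e" "squarefree t" using True t squarefree_multD by blast+
        have k: "(\<Prod>p\<in>prime_factors e. \<kappa> p) = (if coprime e h\<^sub>1 then fprod g e * rho e / phi e else 0)"
        proof (cases "coprime e h\<^sub>1")
          case True
          have "fprod g e * rho e / phi e = (\<Prod>p\<in>prime_factors e. floc g p * ((real p - 1) / (real p - 2)) / (real p - 1))"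
            by (simp only: fprod_def rho_def phi_def prod.distrib prod_dividef)
          also have "\<dots> = (\<Prod>p\<in>prime_factors e. \<kappa> p)"
          proof (intro prod.cong refl)
            fix p assume p: "p \<in> prime_factors e"
            then have "\<not> p dvd h\<^sub>1" using True coprime_iff_prime_factors[OF et(1)] by blast
            moreover have "real p - 1 \<noteq> 0" using p by (auto simp: in_prime_factors_iff)
            ultimately show "floc g p * ((real p - 1) / (real p - 2)) / (real p - 1) = \<kappa> p"
              by (simp add: \<kappa>_def)
          qed
          finally show ?thesis using True by simp
        next
          case False
          then obtain p where "p \<in> prime_factors e" "p dvd h\<^sub>1" using coprime_iff_prime_factors[OF et(1)] by blast
          then have "(\<Prod>p\<in>prime_factors e. \<kappa> p) = 0" by (intro prod_zero) (auto simp: \<kappa>_def intro!: bexI[of _ p])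
          then show ?thesis using False by simp
        qed
        have mm: "moebius n * moebius e = moebius t"
          using moebius_square[of e] sf t c by (simp add: moebius_mult)
        have cop: "coprime t (e * h\<^sub>2) \<longleftrightarrow> coprime t h\<^sub>2" using c by (simp add: coprime_commute)
        have cn: "coprime n h\<^sub>2 \<longleftrightarrow> coprime e h\<^sub>2 \<and> coprime t h\<^sub>2" using t by simp
        have pn: "phi n = phi e * phi t" using t c et by (simp add: phi_mult)
        have nt: "n div e = t" using t et by simp
        show "Wcoef g h\<^sub>1 h\<^sub>2 e * rho e * (moebius (n div e) * ?U e (n div e)) =
          (if coprime n h\<^sub>2 then moebius n / phi n else 0) * (moebius e * (\<Prod>p\<in>prime_factors e. \<kappa> p))"
          unfolding nt prod_phi_weight[OF et(2)] cop k cn pn mm[symmetric] Wcoef_def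
          using sf phi_pos[of e] phi_pos[of t] by (auto simp: power2_eq_square mult_ac)
      qed
      also have "\<dots> = (if coprime n h\<^sub>2 then moebius n / phi n else 0) * (\<Prod>p\<in>prime_factors n. 1 - \<kappa> p)"
        unfolding sum_distrib_left[symmetric] sum_moebius_prod[OF n] ..
      also have "\<dots> = moebius n * (\<Prod>p\<in>prime_factors n. phi_weight h\<^sub>2 p * (1 - \<kappa> p))"
        unfolding prod.distrib prod_phi_weight[OF n] by simp
      also have "(\<Prod>p\<in>prime_factors n. phi_weight h\<^sub>2 p * (1 - \<kappa> p)) = (\<Prod>p\<in>prime_factors n. ustar g h\<^sub>1 h\<^sub>2 p)"
        by (intro prod.cong refl) (simp add: phi_weight_def ustar_def \<kappa>_def)
      finally show ?thesis .
    qed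
    finally show "(\<Sum>e | e dvd n. Wcoef g h\<^sub>1 h\<^sub>2 e * rho e * (moebius (n div e) * ?U e (n div e) * ln (R / real e / real (n div e)))) =
       moebius n * (\<Prod>p\<in>prime_factors n. ustar g h\<^sub>1 h\<^sub>2 p) * ln (R / real n)" .
  qed
  finally show ?thesis .
qed

text \<open>Passing from h to e h changes only the Euler factors at p dividing e, where 1 - 1/(p -
  1) becomes 1; the quotient is (p - 1)/(p - 2). Oddness of \<open>e\<close> keeps the prime 2,
  where the old factor is zero, out of this comparison.\<close>

lemma Pconst_phi_weight_mult:
  assumes e: "e > 0" "coprime e h" "odd e" and h: "h > 0"
  shows "Pconst (phi_weight (e * h)) = Pconst (phi_weight h) * rho e"
proof -
  let ?E = "\<lambda>u N. \<Prod>p\<in>primes_upto (real N). (1 - u p) / (1 - 1 / real p) :: real"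
  have 1: "(\<lambda>N. ?E (phi_weight (e * h)) N) \<longlonglongrightarrow> Pconst (phi_weight (e * h))"
    by (rule Pconst_euler_product[OF admissible_phi_weight]) (use e h in auto)
  have 2: "(\<lambda>N. ?E (phi_weight h) N * rho e) \<longlonglongrightarrow> Pconst (phi_weight h) * rho e"
    by (intro tendsto_intros Pconst_euler_product[OF admissible_phi_weight]) (use h in auto)
  have "\<forall>\<^sub>F N in sequentially. ?E (phi_weight h) N * rho e = ?E (phi_weight (e * h)) N"
  proof (rule eventually_sequentiallyI[of e])
    fix N assume N: "N \<ge> e"
    have sub: "prime_factors e \<subseteq> primes_upto (real N)"
    proof
      fix p assume "p \<in> prime_factors e"
      then have "prime p" "p \<le> e" using e by (auto simp: in_prime_factors_iff dest: dvd_imp_le)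
      then show "p \<in> primes_upto (real N)" using N by simp
    qed
    have "rho e = (\<Prod>p\<in>primes_upto (real N). if p \<in> prime_factors e then (real p - 1) / (real p - 2) else 1)"
      unfolding rho_def using sub by (simp add: prod.If_cases Int_absorb1)
    then have "?E (phi_weight h) N * rho e = (\<Prod>p\<in>primes_upto (real N). (1 - phi_weight h p) / (1 - 1 / real p) *
       (if p \<in> prime_factors e then (real p - 1) / (real p - 2) else 1))"
      by (simp only: prod.distrib)
    also have "\<dots> = ?E (phi_weight (e * h)) N"
    proof (intro prod.cong refl)
      fix p assume "p \<in> primes_upto (real N)"
      then have p: "prime p" by simp
      show "(1 - phi_weight h p) / (1 - 1 / real p) * (if p \<in> prime_factors e then (real p - 1) / (real p - 2) else 1)
         = (1 - phi_weight (e * h) p) / (1 - 1 / real p)"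
      proof (cases "p dvd e")
        case True
        have "\<not> p dvd h"
        proof
          assume "p dvd h"
          with True have "is_unit p" by (rule coprime_common_divisor[OF e(2)])
          with p show False by simp
        qed
        moreover have "p \<noteq> 2" using True e by auto
        then have "real p > 2" using prime_ge_2_nat[OF p] by simp
        then have "1 - 1 / (real p - 1) = (real p - 2) / (real p - 1)" by (simp add: field_simps)
        then have "(1 - 1 / (real p - 1)) * ((real p - 1) / (real p - 2)) = 1" using \<open>real p > 2\<close> by simp
        ultimately show ?thesis using True e p by (simp add: phi_weight_def in_prime_factors_iff)
      next
        case False
        then show ?thesis using p by (auto simp: phi_weight_def in_prime_factors_iff prime_dvd_mult_iff)
      qed
    qed
    finally show "?E (phi_weight h) N * rho e = ?E (phi_weight (e * h)) N" .
  qed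
  then have "(\<lambda>N. ?E (phi_weight (e * h)) N) \<longlonglongrightarrow> Pconst (phi_weight h) * rho e"
    by (rule Lim_transform_eventually[OF 2])
  from LIMSEQ_unique[OF 1 this] show ?thesis .
qed

text \<open>The Euler factor at 2 is 1 - 1/(2 - 1) = 0. It reflects that one of two integers at odd
  distance is even.\<close>

lemma Pconst_odd:
  assumes "odd h"
  shows "Pconst (phi_weight h) = 0"
proof -
  have "(\<lambda>N. \<Prod>p\<in>primes_upto (real N). (1 - phi_weight h p) / (1 - 1 / real p)) \<longlonglongrightarrow> Pconst (phi_weight h)"
    by (rule Pconst_euler_product[OF admissible_phi_weight]) (use assms in \<open>auto intro!: Nat.gr0I\<close>)
  moreover have "\<forall>\<^sub>F N in sequentially. (\<Prod>p\<in>primes_upto (real N). (1 - phi_weight h p) / (1 - 1 / real p)) = 0"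
  proof (rule eventually_sequentiallyI[of 2])
    fix N :: nat assume "N \<ge> 2"
    then show "(\<Prod>p\<in>primes_upto (real N). (1 - phi_weight h p) / (1 - 1 / real p)) = 0"
      using assms by (intro prod_zero) (auto intro!: bexI[of _ 2] simp: phi_weight_def)
  qed
  ultimately show ?thesis using tendsto_eventually[THEN LIMSEQ_unique] by metis
qed

section \<open>Size of the diagonal weights\<close>

lemma abs_floc_bounds:
  assumes "prime p"
  shows "\<bar>floc g p\<bar> / (real p - 1)\<^sup>2 \<le> vloc 4 g p / real p" "\<bar>floc g p\<bar> \<le> real p - 1"
proof -
  have p: "real p \<ge> 2" using prime_ge_2_nat[OF assms] by simp
  show "\<bar>floc g p\<bar> \<le> real p - 1" using p by (auto simp: floc_def)
  have q: "1 / (real p - 1) \<le> 2 / real p" "1 / (real p - 1) \<ge> 0" using p by (auto simp: field_simps)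
  show "\<bar>floc g p\<bar> / (real p - 1)\<^sup>2 \<le> vloc 4 g p / real p"
  proof (cases "p dvd g")
    case True
    have "\<bar>floc g p\<bar> / (real p - 1)\<^sup>2 \<le> (real p - 1) / (real p - 1)\<^sup>2"
      using p True by (intro divide_right_mono) (auto simp: floc_def)
    also have "\<dots> = 1 / (real p - 1)" using p by (simp add: power2_eq_square)
    also have "\<dots> \<le> 4 / real p" using q p by (intro order_trans[OF q(1)]) (simp add: divide_right_mono)
    finally show ?thesis using True by (simp add: vloc_def)
  next
    case False
    have "\<bar>floc g p\<bar> / (real p - 1)\<^sup>2 = (1 / (real p - 1)) * (1 / (real p - 1))"
      using False by (simp add: floc_def power2_eq_square)
    also have "\<dots> \<le> (2 / real p) * (2 / real p)" using q by (intro mult_mono) auto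
    finally show ?thesis using False by (simp add: vloc_def)
  qed
qed

lemma abs_Wcoef_squarefree:
  assumes "squarefree e"
  shows "\<bar>Wcoef g h\<^sub>1 h\<^sub>2 e\<bar> \<le> (\<Prod>p\<in>prime_factors e. \<bar>floc g p\<bar> / (real p - 1)\<^sup>2)"
  using phi_pos[of e] by (auto simp: Wcoef_def fprod_def phi_def abs_prod prod_dividef prod_power_distrib intro!: prod_nonneg divide_nonneg_nonneg)

text \<open>This serves positive \<open>g\<close> of size at most a power of \<open>R\<close>, for
  which the Rankin tail with modulus \<open>g\<close> applies. For \<open>g = 0\<close> every prime
  divides \<open>g\<close>, and \<open>abs_Wcoef_le_inverse_phi\<close> takes its place.\<close>

lemma abs_Wcoef_le_majorant: "\<bar>Wcoef g h\<^sub>1 h\<^sub>2 e\<bar> \<le> majorant 4 g e"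
proof (cases "squarefree e")
  case True
  note abs_Wcoef_squarefree[OF True]
  also have "(\<Prod>p\<in>prime_factors e. \<bar>floc g p\<bar> / (real p - 1)\<^sup>2) \<le> (\<Prod>p\<in>prime_factors e. vloc 4 g p / real p)"
    using abs_floc_bounds by (intro prod_mono) (auto simp: in_prime_factors_iff)
  also have "\<dots> = (\<Prod>p\<in>prime_factors e. vloc 4 g p) / (\<Prod>p\<in>prime_factors e. real p)"
    by (rule prod_dividef)
  also have "(\<Prod>p\<in>prime_factors e. real p) = real e"
    using prod_prime_factors_squarefree[OF True] by (simp flip: of_nat_prod)
  finally show ?thesis by (simp add: majorant_def)
qed (simp add: Wcoef_def majorant_nonneg)

lemma abs_Wcoef_le_inverse_phi:
  assumes "squarefree e"
  shows "\<bar>Wcoef g h\<^sub>1 h\<^sub>2 e\<bar> \<le> 1 / phi e"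
proof -
  note abs_Wcoef_squarefree[OF assms]
  also have "(\<Prod>p\<in>prime_factors e. \<bar>floc g p\<bar> / (real p - 1)\<^sup>2) \<le> (\<Prod>p\<in>prime_factors e. 1 / (real p - 1))"
  proof (rule prod_mono, rule conjI)
    fix p assume "p \<in> prime_factors e"
    then have p: "prime p" by (simp add: in_prime_factors_iff)
    have p2: "real p \<ge> 2" using prime_ge_2_nat[OF p] by simp
    have "\<bar>floc g p\<bar> / (real p - 1)\<^sup>2 \<le> (real p - 1) / (real p - 1)\<^sup>2"
      by (intro divide_right_mono abs_floc_bounds p) simp
    then show "\<bar>floc g p\<bar> / (real p - 1)\<^sup>2 \<le> 1 / (real p - 1)" using p2 by (simp add: power2_eq_square)
  qed simp
  also have "\<dots> = 1 / phi e" by (simp add: phi_def prod_dividef)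
  finally show ?thesis .
qed

text \<open>The quotient e/phi(e) is at most the product of the 1 + 2/p, a divisor sum contained in
  a majorant sum with modulus \<open>e\<close>. So 1/phi(e) is 1/e up to a small power of
  \<open>L\<close>.\<close>

lemma inverse_phi_le:
  assumes e: "squarefree e"
  shows "1 / phi e \<le> (\<Sum>m\<in>nats_upto (real e). majorant 2 e m) / real e"
proof -
  have e0: "e > 0" by (rule Nat.gr0I) (use e in simp)
  have pe: "(\<Prod>p\<in>prime_factors d. real p) = real d" if "squarefree d" for d
    using prod_prime_factors_squarefree[OF that] by (simp flip: of_nat_prod)
  have "real e / phi e = (\<Prod>p\<in>prime_factors e. real p / (real p - 1))"
    unfolding phi_def prod_dividef pe[OF e] ..
  also have "\<dots> \<le> (\<Prod>p\<in>prime_factors e. 1 + 2 / real p)"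
  proof (rule prod_mono, rule conjI)
    fix p assume "p \<in> prime_factors e"
    then have p: "real p \<ge> 2" using prime_ge_2_nat by (auto simp: in_prime_factors_iff)
    show "0 \<le> real p / (real p - 1)" using p by simp
    have "real p / (real p - 1) = 1 + 1 / (real p - 1)" using p by (simp add: field_simps)
    also have "1 / (real p - 1) \<le> 2 / real p" using p by (simp add: field_simps)
    finally show "real p / (real p - 1) \<le> 1 + 2 / real p" by simp
  qed
  also have "\<dots> = (\<Sum>d | d dvd e \<and> squarefree d. \<Prod>p\<in>prime_factors d. 2 / real p)"
    by (rule sum_squarefree_prod[OF e0, symmetric])
  also have "\<dots> = (\<Sum>d | d dvd e \<and> squarefree d. majorant 2 e d)"
  proof (intro sum.cong refl)
    fix d assume "d \<in> {d. d dvd e \<and> squarefree d}"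
    then have d: "d dvd e" "squarefree d" by auto
    have "(\<Prod>p\<in>prime_factors d. vloc 2 e p) = (\<Prod>p\<in>prime_factors d. 2)"
      using d by (intro prod.cong refl) (auto simp: vloc_def in_prime_factors_iff intro: dvd_trans)
    then show "(\<Prod>p\<in>prime_factors d. 2 / real p) = majorant 2 e d"
      unfolding majorant_def prod_dividef pe[OF d(2)] by simp
  qed
  also have "\<dots> \<le> (\<Sum>m\<in>nats_upto (real e). majorant 2 e m)"
    using e0 by (intro sum_mono2 majorant_nonneg) (auto dest: dvd_imp_le intro: dvd_pos_nat)
  finally have "real e * (1 / phi e) \<le> (\<Sum>m\<in>nats_upto (real e). majorant 2 e m)" by simp
  then show ?thesis using e0 by (simp add: pos_le_divide_eq mult.commute)
qed

text \<open>If \<open>e\<close> were even, coprimality would make \<open>h\<^sub>1\<close> and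
  \<open>h\<^sub>2\<close> odd, so \<open>g\<close> would be even by the parity hypothesis and the
  factor p - 2 of \<open>fprod\<close> at p = 2 would be zero.\<close>

lemma Wcoef_nonzeroD:
  assumes "Wcoef g h\<^sub>1 h\<^sub>2 e \<noteq> 0" "even (g + h\<^sub>1 + h\<^sub>2)"
  shows "squarefree e" "coprime e h\<^sub>1" "odd e" "e > 0"
proof -
  show sf: "squarefree e" and c: "coprime e h\<^sub>1" using assms(1) by (auto simp: Wcoef_def split: if_splits)
  have c2: "coprime e h\<^sub>2" and f: "fprod g e \<noteq> 0" using assms(1) by (auto simp: Wcoef_def split: if_splits)
  show e: "e > 0" by (rule Nat.gr0I) (use sf in simp)
  show "odd e"
  proof
    assume ev: "even e"
    then have "odd h\<^sub>1" "odd h\<^sub>2" using c c2 coprime_common_divisor[of e h\<^sub>1 2] coprime_common_divisor[of e h\<^sub>2 2] by auto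
    then have "even g" using assms(2) by simp
    moreover have "2 \<in> prime_factors e" using ev e by (simp add: in_prime_factors_iff)
    ultimately have "fprod g e = 0" unfolding fprod_def by (intro prod_zero) (auto simp: floc_def intro!: bexI[of _ 2])
    with f show False by simp
  qed
qed

context prime_number_estimate
begin

text \<open>The first inner sum is replaced by its limit, at a small cost unless e is close to R,
  where only crude bounds hold; the main term is resummed by \<open>sum_Wcoef_Tsum\<close>. The sums
  of absolute weights stay in the statement because positive \<open>g\<close> and
  \<open>g = 0\<close> need different bounds for them.\<close>

lemma Msum_reduce:
  assumes K: "K > 0" and \<delta>: "\<delta> > 0"
  shows "\<forall>\<^sub>F L in at_top. \<forall>R g h\<^sub>1 h\<^sub>2. R > 0 \<longrightarrow> ln R = L \<longrightarrow> h\<^sub>1 > 0 \<longrightarrow> h\<^sub>2 > 0 \<longrightarrow> even (g + h\<^sub>1 + h\<^sub>2) \<longrightarrow>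
     ln (real h\<^sub>1) \<le> K * L \<longrightarrow> ln (real h\<^sub>2) \<le> K * L \<longrightarrow>
     \<bar>Msum R g h\<^sub>1 h\<^sub>2 - Pconst (phi_weight h\<^sub>1) * Tsum (ustar g h\<^sub>1 h\<^sub>2) R\<bar> \<le>
       L powr (- 1/8 + \<delta>) * (\<Sum>e\<in>nats_upto R. \<bar>Wcoef g h\<^sub>1 h\<^sub>2 e\<bar>) +
       2 * L powr (2 * \<delta>) * (\<Sum>e\<in>{e\<in>nats_upto R. R / exp (L powr (3/4)) < real e}. \<bar>Wcoef g h\<^sub>1 h\<^sub>2 e\<bar>)"
proof -
  have "\<forall>\<^sub>F L in at_top. \<forall>Q u. Q > 0 \<longrightarrow> ln (real Q) \<le> (K + 1) * L \<longrightarrow> admissible 2 Q u \<longrightarrow>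
     \<bar>Pconst u\<bar> \<le> L powr \<delta> \<and> (\<forall>x\<ge>1. \<bar>Tsum u x\<bar> \<le> L powr \<delta>) \<and>
     (\<forall>x>0. L powr (3/4) \<le> ln x \<longrightarrow> \<bar>Tsum u x - Pconst u\<bar> \<le> L powr (- 1/8))"
    by (rule Tsum_uniform) (use K \<delta> in auto)
  then show ?thesis using eventually_ge_at_top[of 1]
  proof eventually_elim
    case (elim L)
    show ?case
    proof (intro allI impI)
      fix R :: real and g h\<^sub>1 h\<^sub>2 :: nat
      assume R: "R > 0" "ln R = L" and h: "h\<^sub>1 > 0" "h\<^sub>2 > 0" and par: "even (g + h\<^sub>1 + h\<^sub>2)"
        and lh: "ln (real h\<^sub>1) \<le> K * L" "ln (real h\<^sub>2) \<le> K * L"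
      define X where "X = L powr \<delta>"
      define Y where "Y = L powr (- 1/8)"
      have XY: "X \<ge> 0" "Y \<ge> 0" by (auto simp: X_def Y_def)
      let ?T1 = "\<lambda>e. Tsum (phi_weight (e * h\<^sub>1)) (R / real e)"
      let ?T2 = "\<lambda>e. Tsum (phi_weight (e * h\<^sub>2)) (R / real e)"
      let ?P = "\<lambda>e. Pconst (phi_weight (e * h\<^sub>1))"
      let ?W = "Wcoef g h\<^sub>1 h\<^sub>2"
      define B where "B = {e\<in>nats_upto R. R / exp (L powr (3/4)) < real e}"
      have B: "B \<subseteq> nats_upto R" "finite B" by (auto simp: B_def intro: finite_subset[of _ "nats_upto R"])
      have uni: "\<bar>Pconst (phi_weight (e * h))\<bar> \<le> X" "\<bar>Tsum (phi_weight (e * h)) (R / real e)\<bar> \<le> X"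
        "e \<notin> B \<Longrightarrow> \<bar>Tsum (phi_weight (e * h)) (R / real e) - Pconst (phi_weight (e * h))\<bar> \<le> Y"
        if e: "e \<in> nats_upto R" and h: "h > 0" "ln (real h) \<le> K * L" for e h
      proof -
        have "ln (real e) \<le> ln R" using e R by (subst ln_le_cancel_iff) auto
        \<comment> \<open>As \<open>e\<close> runs up to \<open>R\<close>, it adds up to
          \<open>L\<close> to the logarithm of the modulus; hence \<open>K + 1\<close>.\<close>
        then have "ln (real (e * h)) \<le> (K + 1) * L" using e h R by (simp add: ln_mult algebra_simps)
        moreover have "e * h > 0" using e h by simp
        ultimately have *: "\<bar>Pconst (phi_weight (e * h))\<bar> \<le> X" "\<forall>x\<ge>1. \<bar>Tsum (phi_weight (e * h)) x\<bar> \<le> X"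
          "\<forall>x>0. L powr (3/4) \<le> ln x \<longrightarrow> \<bar>Tsum (phi_weight (e * h)) x - Pconst (phi_weight (e * h))\<bar> \<le> Y"
          using elim(1) admissible_phi_weight unfolding X_def Y_def by blast+
        show "\<bar>Pconst (phi_weight (e * h))\<bar> \<le> X" by fact
        show "\<bar>Tsum (phi_weight (e * h)) (R / real e)\<bar> \<le> X" using *(2) e by simp
        assume "e \<notin> B"
        then have "real e \<le> R / exp (L powr (3/4))" using e by (simp add: B_def)
        then have "exp (L powr (3/4)) \<le> R / real e" using e by (simp add: field_simps)
        then have "L powr (3/4) \<le> ln (R / real e)" using e R by (subst ln_ge_iff) auto
        then show "\<bar>Tsum (phi_weight (e * h)) (R / real e) - Pconst (phi_weight (e * h))\<bar> \<le> Y"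
          using *(3) e R by simp
      qed
      have PW: "?W e * ?P e = Pconst (phi_weight h\<^sub>1) * (?W e * rho e)" for e
      proof (cases "?W e = 0")
        case False
        then show ?thesis using Wcoef_nonzeroD[OF False par] h by (simp add: Pconst_phi_weight_mult)
      qed simp
      have eq0: "Msum R g h\<^sub>1 h\<^sub>2 - Pconst (phi_weight h\<^sub>1) * Tsum (ustar g h\<^sub>1 h\<^sub>2) R =
        (\<Sum>e\<in>nats_upto R. ?W e * (?T1 e * ?T2 e) - (?W e * ?P e) * ?T2 e)"
        unfolding Msum_diagonal PW sum_Wcoef_Tsum[symmetric] sum_subtractf sum_distrib_left by (simp add: mult.assoc)
      have "\<bar>Msum R g h\<^sub>1 h\<^sub>2 - Pconst (phi_weight h\<^sub>1) * Tsum (ustar g h\<^sub>1 h\<^sub>2) R\<bar> \<le>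
        (\<Sum>e\<in>nats_upto R. \<bar>?W e\<bar> * (Y * X) + (if e \<in> B then \<bar>?W e\<bar> * (2 * X * X) else 0))"
        unfolding eq0
      proof (rule order_trans[OF sum_abs], rule sum_mono)
        fix e assume e: "e \<in> nats_upto R"
        have "?W e * (?T1 e * ?T2 e) - (?W e * ?P e) * ?T2 e = ?W e * ((?T1 e - ?P e) * ?T2 e)"
          by (simp add: algebra_simps)
        then have eq: "\<bar>?W e * (?T1 e * ?T2 e) - (?W e * ?P e) * ?T2 e\<bar> = \<bar>?W e\<bar> * (\<bar>?T1 e - ?P e\<bar> * \<bar>?T2 e\<bar>)"
          by (simp only: abs_mult)
        have T2: "\<bar>?T2 e\<bar> \<le> X" by (rule uni(2)[OF e h(2) lh(2)])
        show "\<bar>?W e * (?T1 e * ?T2 e) - (?W e * ?P e) * ?T2 e\<bar> \<le>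
           \<bar>?W e\<bar> * (Y * X) + (if e \<in> B then \<bar>?W e\<bar> * (2 * X * X) else 0)"
        proof (cases "e \<in> B")
          case True
          have "\<bar>?T1 e - ?P e\<bar> \<le> 2 * X" using uni(1,2)[OF e h(1) lh(1)] by linarith
          then have "\<bar>?W e\<bar> * (\<bar>?T1 e - ?P e\<bar> * \<bar>?T2 e\<bar>) \<le> \<bar>?W e\<bar> * (2 * X * X)"
            using T2 XY by (intro mult_left_mono mult_mono) auto
          moreover have "\<bar>?W e\<bar> * (Y * X) \<ge> 0" using XY by simp
          ultimately show ?thesis unfolding eq using True by simp
        next
          case False
          have "\<bar>?W e\<bar> * (\<bar>?T1 e - ?P e\<bar> * \<bar>?T2 e\<bar>) \<le> \<bar>?W e\<bar> * (Y * X)"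
            using T2 XY uni(3)[OF e h(1) lh(1) False] by (intro mult_left_mono mult_mono) auto
          then show ?thesis unfolding eq using False by simp
        qed
      qed
      also have "\<dots> = (\<Sum>e\<in>nats_upto R. \<bar>?W e\<bar>) * (Y * X) + (\<Sum>e\<in>B. \<bar>?W e\<bar>) * (2 * X * X)"
      proof -
        have "(\<Sum>e\<in>nats_upto R. if e \<in> B then \<bar>?W e\<bar> * (2 * X * X) else 0) = (\<Sum>e\<in>B. \<bar>?W e\<bar> * (2 * X * X))"
          by (rule sum.mono_neutral_cong_right[OF finite_nats_upto B(1)]) simp_all
        then show ?thesis by (simp only: sum.distrib sum_distrib_right)
      qed
      also have "Y * X = L powr (- 1/8 + \<delta>)" by (simp only: X_def Y_def powr_add)
      also have "2 * X * X = 2 * L powr (2 * \<delta>)" by (simp add: X_def flip: powr_add)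
      finally show "\<bar>Msum R g h\<^sub>1 h\<^sub>2 - Pconst (phi_weight h\<^sub>1) * Tsum (ustar g h\<^sub>1 h\<^sub>2) R\<bar> \<le>
         L powr (- 1/8 + \<delta>) * (\<Sum>e\<in>nats_upto R. \<bar>?W e\<bar>) +
         2 * L powr (2 * \<delta>) * (\<Sum>e\<in>{e\<in>nats_upto R. R / exp (L powr (3/4)) < real e}. \<bar>?W e\<bar>)"
        by (simp add: B_def mult.commute)
    qed
  qed
qed

end

text \<open>The modulus contains the primes dividing \<open>g\<close> or \<open>h\<^sub>2\<close>,
  where the weight can be 0. At other odd primes it is 1/(p - 1) or 1/(p - 2); the latter gives the
  deviation 2/(p - 2), at most 6/p from p = 3 on, hence the 6. At p = 2 the value 0 or 1 is within
  the bound.\<close>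

lemma admissible_ustar:
  assumes "g > 0"
  shows "admissible 6 (g * h\<^sub>2) (ustar g h\<^sub>1 h\<^sub>2)"
  unfolding admissible_def
proof (intro allI impI)
  fix p :: nat assume p: "prime p"
  show "\<bar>1 - real p * ustar g h\<^sub>1 h\<^sub>2 p\<bar> \<le> vloc 6 (g * h\<^sub>2) p"
  proof (cases "p = 2")
    case True
    then have "ustar g h\<^sub>1 h\<^sub>2 p \<in> {0, 1}" by (auto simp: ustar_def)
    then show ?thesis using True by (auto simp: vloc_def)
  next
    case False
    then have p3: "real p \<ge> 3" using prime_ge_2_nat[OF p] by simp
    have a: "1 - real p * (1 / (real p - 1)) = - (1 / (real p - 1))" using p3 by (simp add: field_simps)
    have b: "1 / (real p - 1) \<le> 6 / real p" "1 / (real p - 1) \<le> 6" "0 < real p - 1" using p3 by (auto simp: field_simps)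
    show ?thesis
    proof (cases "p dvd h\<^sub>2 \<or> p dvd h\<^sub>1")
      case True
      then show ?thesis using a b by (auto simp: ustar_def vloc_def)
    next
      case nd: False
      show ?thesis
      proof (cases "p dvd g")
        case True
        then have "ustar g h\<^sub>1 h\<^sub>2 p = 0" using nd p3 by (simp add: ustar_def floc_def)
        then show ?thesis using True by (simp add: vloc_def)
      next
        case False
        have "1 - floc g p / (real p - 2) = (real p - 1) / (real p - 2)" using False p3 by (simp add: floc_def field_simps)
        then have u: "ustar g h\<^sub>1 h\<^sub>2 p = 1 / (real p - 2)" using nd p3 by (simp add: ustar_def)
        have "1 - real p * (1 / (real p - 2)) = - (2 / (real p - 2))" using p3 by (simp add: field_simps)
        moreover have "2 / (real p - 2) \<le> 6 / real p" using p3 by (simp add: field_simps)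
        moreover have "2 / (real p - 2) \<ge> 0" using p3 by simp
        moreover have "\<not> p dvd g * h\<^sub>2" using False nd p prime_dvd_mult_iff by blast
        ultimately show ?thesis unfolding u by (simp add: vloc_def)
      qed
    qed
  qed
qed

section \<open>Asymptotics of the two-divisor sum\<close>

context prime_number_estimate
begin

text \<open>The majorant with modulus \<open>g\<close> bounds the sum of the weights by a small
  power of \<open>L\<close> and its part near \<open>R\<close> by 1/L. With exponents 1/64 all
  errors are O(L^(-3/32)), below L^(-1/16). Finally the single remaining sum
  \<open>Tsum (ustar g h\<^sub>1 h\<^sub>2) R\<close> is replaced by its limit.\<close>

theorem Msum_asymptotics_distinct:
  assumes K: "K > 0"
  shows "\<forall>\<^sub>F L in at_top. \<forall>R g h\<^sub>1 h\<^sub>2. R > 0 \<longrightarrow> ln R = L \<longrightarrow> g > 0 \<longrightarrow> h\<^sub>1 > 0 \<longrightarrow> h\<^sub>2 > 0 \<longrightarrow>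
     even (g + h\<^sub>1 + h\<^sub>2) \<longrightarrow> ln (real g) \<le> K * L \<longrightarrow> ln (real h\<^sub>1) \<le> K * L \<longrightarrow> ln (real h\<^sub>2) \<le> K * L \<longrightarrow>
     \<bar>Msum R g h\<^sub>1 h\<^sub>2 - Pconst (phi_weight h\<^sub>1) * Pconst (ustar g h\<^sub>1 h\<^sub>2)\<bar> \<le> L powr (- 1/16)"
proof -
  have ev1: "\<forall>\<^sub>F L in at_top. 4 * L powr (- 1/8 + 2 * (1/64)) \<le> L powr (- 1/16 :: real)"
    by (rule eventually_powr_le) simp
  have ev2: "\<forall>\<^sub>F L in at_top. 3 * L powr (3/4) \<le> L powr (1 :: real)"
    by (rule eventually_powr_le) simp
  have maj: "\<forall>\<^sub>F L in at_top. \<forall>Q>0. ln (real Q) \<le> K * L \<longrightarrow>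
           (\<forall>x. (\<Sum>m\<in>nats_upto x. majorant 4 Q m) \<le> L powr (1/64))"
    by (rule majorant_sum_small) (use K in auto)
  have tail: "\<forall>\<^sub>F L in at_top. \<forall>Q>0. ln (real Q) \<le> K * L \<longrightarrow> (\<forall>y>0. L powr (3/4) / 2 \<le> ln y \<longrightarrow>
           (\<forall>x. (\<Sum>m\<in>{m\<in>nats_upto x. y < real m}. majorant 4 Q m) \<le> 1 / L))"
    by (rule majorant_tail_small) (use K in auto)
  have un1: "\<forall>\<^sub>F L in at_top. \<forall>Q u. Q > 0 \<longrightarrow> ln (real Q) \<le> (2 * K) * L \<longrightarrow> admissible 2 Q u \<longrightarrow>
     \<bar>Pconst u\<bar> \<le> L powr (1/64) \<and> (\<forall>x\<ge>1. \<bar>Tsum u x\<bar> \<le> L powr (1/64)) \<and>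
     (\<forall>x>0. L powr (3/4) \<le> ln x \<longrightarrow> \<bar>Tsum u x - Pconst u\<bar> \<le> L powr (- 1/8))"
    by (rule Tsum_uniform) (use K in auto)
  have un2: "\<forall>\<^sub>F L in at_top. \<forall>Q u. Q > 0 \<longrightarrow> ln (real Q) \<le> (2 * K) * L \<longrightarrow> admissible 6 Q u \<longrightarrow>
     \<bar>Pconst u\<bar> \<le> L powr (1/64) \<and> (\<forall>x\<ge>1. \<bar>Tsum u x\<bar> \<le> L powr (1/64)) \<and>
     (\<forall>x>0. L powr (3/4) \<le> ln x \<longrightarrow> \<bar>Tsum u x - Pconst u\<bar> \<le> L powr (- 1/8))"
    by (rule Tsum_uniform) (use K in auto)
  have red: "\<forall>\<^sub>F L in at_top. \<forall>R g h\<^sub>1 h\<^sub>2. R > 0 \<longrightarrow> ln R = L \<longrightarrow> h\<^sub>1 > 0 \<longrightarrow> h\<^sub>2 > 0 \<longrightarrow> even (g + h\<^sub>1 + h\<^sub>2) \<longrightarrow>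
     ln (real h\<^sub>1) \<le> K * L \<longrightarrow> ln (real h\<^sub>2) \<le> K * L \<longrightarrow>
     \<bar>Msum R g h\<^sub>1 h\<^sub>2 - Pconst (phi_weight h\<^sub>1) * Tsum (ustar g h\<^sub>1 h\<^sub>2) R\<bar> \<le>
       L powr (- 1/8 + 1/64) * (\<Sum>e\<in>nats_upto R. \<bar>Wcoef g h\<^sub>1 h\<^sub>2 e\<bar>) +
       2 * L powr (2 * (1/64)) * (\<Sum>e\<in>{e\<in>nats_upto R. R / exp (L powr (3/4)) < real e}. \<bar>Wcoef g h\<^sub>1 h\<^sub>2 e\<bar>)"
    by (rule Msum_reduce) (use K in auto)
  show ?thesis using ev1 ev2 maj tail un1 un2 red eventually_ge_at_top[of 1]
  proof eventually_elim
    case (elim L)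
    show ?case
    proof (intro allI impI)
      fix R :: real and g h\<^sub>1 h\<^sub>2 :: nat
      assume R: "R > 0" "ln R = L" and h: "g > 0" "h\<^sub>1 > 0" "h\<^sub>2 > 0" and par: "even (g + h\<^sub>1 + h\<^sub>2)"
        and lh: "ln (real g) \<le> K * L" "ln (real h\<^sub>1) \<le> K * L" "ln (real h\<^sub>2) \<le> K * L"
      have L: "L \<ge> 1" by (rule elim)
      let ?W = "Wcoef g h\<^sub>1 h\<^sub>2"
      define y where "y = R / exp (L powr (3/4))"
      have "ln y = L - L powr (3/4)" using R by (simp add: y_def ln_div)
      then have y: "y > 0" "L powr (3/4) / 2 \<le> ln y" using elim(2) L R by (auto simp: y_def)
      have S1: "(\<Sum>e\<in>nats_upto R. \<bar>?W e\<bar>) \<le> L powr (1/64)"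
      proof -
        have "(\<Sum>e\<in>nats_upto R. \<bar>?W e\<bar>) \<le> (\<Sum>e\<in>nats_upto R. majorant 4 g e)"
          by (intro sum_mono abs_Wcoef_le_majorant)
        also have "\<dots> \<le> L powr (1/64)" using elim(3) h lh by blast
        finally show ?thesis .
      qed
      have S2: "(\<Sum>e\<in>{e\<in>nats_upto R. y < real e}. \<bar>?W e\<bar>) \<le> 1 / L"
      proof -
        have "(\<Sum>e\<in>{e\<in>nats_upto R. y < real e}. \<bar>?W e\<bar>) \<le> (\<Sum>e\<in>{e\<in>nats_upto R. y < real e}. majorant 4 g e)"
          by (intro sum_mono abs_Wcoef_le_majorant)
        also have "\<dots> \<le> 1 / L" using elim(4) h lh y by blast
        finally show ?thesis .
      qed
      have P1: "\<bar>Pconst (phi_weight h\<^sub>1)\<bar> \<le> L powr (1/64)"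
      proof -
        have "K * L \<ge> 0" "(2 * K) * L = 2 * (K * L)" using K L by auto
        then have "ln (real h\<^sub>1) \<le> (2 * K) * L" using lh(2) by linarith
        then show ?thesis using elim(5) h admissible_phi_weight[of h\<^sub>1] by blast
      qed
      have P2: "\<bar>Tsum (ustar g h\<^sub>1 h\<^sub>2) R - Pconst (ustar g h\<^sub>1 h\<^sub>2)\<bar> \<le> L powr (- 1/8)"
      proof -
        have "ln (real (g * h\<^sub>2)) \<le> (2 * K) * L" using lh h by (simp add: ln_mult algebra_simps)
        moreover have "g * h\<^sub>2 > 0" using h by simp
        moreover have "L powr (3/4) \<le> ln R" using R L powr_mono[of "3/4" 1 L] by simp
        ultimately show ?thesis using elim(6) admissible_ustar[OF h(1)] R by blast
      qed
      have "\<bar>Msum R g h\<^sub>1 h\<^sub>2 - Pconst (phi_weight h\<^sub>1) * Tsum (ustar g h\<^sub>1 h\<^sub>2) R\<bar> \<le>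
         L powr (- 1/8 + 1/64) * (\<Sum>e\<in>nats_upto R. \<bar>?W e\<bar>) +
         2 * L powr (2 * (1/64)) * (\<Sum>e\<in>{e\<in>nats_upto R. y < real e}. \<bar>?W e\<bar>)"
        unfolding y_def using elim(7) R h par lh by blast
      also have "\<dots> \<le> L powr (- 1/8 + 1/64) * L powr (1/64) + 2 * L powr (2 * (1/64)) * (1 / L)"
        using S1 S2 by (intro add_mono mult_left_mono) auto
      also have "L powr (- 1/8 + 1/64) * L powr (1/64) = L powr (- 1/8 + 2 * (1/64))"
        by (simp flip: powr_add)
      also have "2 * L powr (2 * (1/64)) * (1 / L) \<le> 2 * L powr (- 1/8 + 2 * (1/64))"
      proof -
        have "1 / L = L powr (- 1)" using L by (simp add: powr_minus field_simps)
        then have "L powr (2 * (1/64)) * (1 / L) = L powr (2 * (1/64) - 1)"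
          by (simp only: powr_add[symmetric]) simp
        also have "\<dots> \<le> L powr (- 1/8 + 2 * (1/64))" using L by (intro powr_mono) auto
        finally show ?thesis by simp
      qed
      finally have 1: "\<bar>Msum R g h\<^sub>1 h\<^sub>2 - Pconst (phi_weight h\<^sub>1) * Tsum (ustar g h\<^sub>1 h\<^sub>2) R\<bar> \<le>
         3 * L powr (- 1/8 + 2 * (1/64))" by simp
      have "\<bar>Pconst (phi_weight h\<^sub>1) * Tsum (ustar g h\<^sub>1 h\<^sub>2) R - Pconst (phi_weight h\<^sub>1) * Pconst (ustar g h\<^sub>1 h\<^sub>2)\<bar> =
        \<bar>Pconst (phi_weight h\<^sub>1)\<bar> * \<bar>Tsum (ustar g h\<^sub>1 h\<^sub>2) R - Pconst (ustar g h\<^sub>1 h\<^sub>2)\<bar>"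
        by (simp only: abs_mult right_diff_distrib[symmetric])
      also have "\<dots> \<le> L powr (1/64) * L powr (- 1/8)" using P1 P2 by (intro mult_mono) auto
      also have "\<dots> \<le> L powr (- 1/8 + 2 * (1/64))"
        unfolding powr_add[symmetric] using L by (intro powr_mono) auto
      finally have 2: "\<bar>Pconst (phi_weight h\<^sub>1) * Tsum (ustar g h\<^sub>1 h\<^sub>2) R - Pconst (phi_weight h\<^sub>1) * Pconst (ustar g h\<^sub>1 h\<^sub>2)\<bar>
          \<le> L powr (- 1/8 + 2 * (1/64))" .
      show "\<bar>Msum R g h\<^sub>1 h\<^sub>2 - Pconst (phi_weight h\<^sub>1) * Pconst (ustar g h\<^sub>1 h\<^sub>2)\<bar> \<le> L powr (- 1/16)"
        using 1 2 elim(1) by linarith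
    qed
  qed
qed

text \<open>For even \<open>h\<close> the weight \<open>ustar 0 h h\<close> vanishes at every prime,
  so only d = 1 survives. For odd \<open>h\<close> the weight at 2 is 1, but then the constant in
  front is 0 by \<open>Pconst_odd\<close>.\<close>

lemma Pconst_Tsum_ustar_0:
  assumes "h > 0" "R \<ge> 1"
  shows "Pconst (phi_weight h) * Tsum (ustar 0 h h) R = Pconst (phi_weight h) * ln R"
proof (cases "even h")
  case True
  have u: "ustar 0 h h p = 0" if "prime p" for p
  proof (cases "p dvd h")
    case False
    then have "p \<noteq> 2" using True by auto
    then have "real p > 2" using prime_ge_2_nat[OF that] by simp
    then show ?thesis by (simp add: ustar_def floc_def)
  qed (simp add: ustar_def)
  have "Tsum (ustar 0 h h) R = (\<Sum>d\<in>{1}. moebius d * (\<Prod>p\<in>prime_factors d. ustar 0 h h p) * ln (R / real d))"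
    unfolding Tsum_def
  proof (intro sum.mono_neutral_right ballI)
    fix d assume d: "d \<in> nats_upto R - {1}"
    then have "prime_factors d \<noteq> {}" unfolding prime_factors_eq_empty_nat by auto
    then obtain p where "p \<in> prime_factors d" by blast
    then have "(\<Prod>p\<in>prime_factors d. ustar 0 h h p) = 0"
      using u by (intro prod_zero) (auto simp: in_prime_factors_iff intro!: bexI[of _ p])
    then show "moebius d * (\<Prod>p\<in>prime_factors d. ustar 0 h h p) * ln (R / real d) = 0" by simp
  qed (use assms in auto)
  then show ?thesis by simp
next
  case False
  then show ?thesis by (simp add: Pconst_odd)
qed

text \<open>The weights are at most L^(1/64)/e, so their total is of order L and their part near R
  of order L^(3/4), up to that power. Against a main term linear in L, the errors L^(58/64) and
  L^(51/64) are admissible.\<close>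

theorem Msum_asymptotics_equal:
  assumes K: "K > 0"
  shows "\<forall>\<^sub>F L in at_top. \<forall>R h. R > 0 \<longrightarrow> ln R = L \<longrightarrow> h > 0 \<longrightarrow> ln (real h) \<le> K * L \<longrightarrow>
     \<bar>Msum R 0 h h - Pconst (phi_weight h) * L\<bar> \<le> L powr (15/16)"
proof -
  obtain \<gamma> where \<gamma>: "\<forall>y\<ge>1. \<bar>(\<Sum>b\<in>nats_upto y. 1 / real b) - ln y - \<gamma>\<bar> \<le> 4 / y"
    using sum_inverse_nats_upto by blast
  define G where "G = 9 + \<bar>\<gamma>\<bar>"
  have ev1: "\<forall>\<^sub>F L in at_top. (3 * G) * L powr (59/64) \<le> L powr (15/16 :: real)"
    by (rule eventually_powr_le) simp
  have ev2: "\<forall>\<^sub>F L in at_top. 3 * L powr (3/4) \<le> L powr (1 :: real)"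
    by (rule eventually_powr_le) simp
  have maj: "\<forall>\<^sub>F L in at_top. \<forall>Q>0. ln (real Q) \<le> 1 * L \<longrightarrow>
           (\<forall>x. (\<Sum>m\<in>nats_upto x. majorant 2 Q m) \<le> L powr (1/64))"
    by (rule majorant_sum_small) auto
  have red: "\<forall>\<^sub>F L in at_top. \<forall>R g h\<^sub>1 h\<^sub>2. R > 0 \<longrightarrow> ln R = L \<longrightarrow> h\<^sub>1 > 0 \<longrightarrow> h\<^sub>2 > 0 \<longrightarrow> even (g + h\<^sub>1 + h\<^sub>2) \<longrightarrow>
     ln (real h\<^sub>1) \<le> K * L \<longrightarrow> ln (real h\<^sub>2) \<le> K * L \<longrightarrow>
     \<bar>Msum R g h\<^sub>1 h\<^sub>2 - Pconst (phi_weight h\<^sub>1) * Tsum (ustar g h\<^sub>1 h\<^sub>2) R\<bar> \<le>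
       L powr (- 1/8 + 1/64) * (\<Sum>e\<in>nats_upto R. \<bar>Wcoef g h\<^sub>1 h\<^sub>2 e\<bar>) +
       2 * L powr (2 * (1/64)) * (\<Sum>e\<in>{e\<in>nats_upto R. R / exp (L powr (3/4)) < real e}. \<bar>Wcoef g h\<^sub>1 h\<^sub>2 e\<bar>)"
    by (rule Msum_reduce) (use K in auto)
  show ?thesis using ev1 ev2 maj red eventually_ge_at_top[of 1]
  proof eventually_elim
    case (elim L)
    show ?case
    proof (intro allI impI)
      fix R :: real and h :: nat
      assume R: "R > 0" "ln R = L" and h: "h > 0" and lh: "ln (real h) \<le> K * L"
      have L: "L \<ge> 1" by (rule elim)
      then have R1: "R \<ge> 1" using R ln_ge_zero_iff[of R] by simp
      let ?W = "Wcoef 0 h h"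
      define X where "X = L powr (1/64)"
      have X: "X \<ge> 0" by (simp add: X_def)
      define y where "y = R / exp (L powr (3/4))"
      have lny: "ln y = L - L powr (3/4)" using R by (simp add: y_def ln_div)
      have "ln y \<ge> 0" using lny elim(2) L by simp
      moreover have "y > 0" using R by (simp add: y_def)
      ultimately have y: "y \<ge> 1" using ln_ge_zero_iff[of y] by simp
      have W: "\<bar>?W e\<bar> \<le> X * (1 / real e)" if e: "e \<in> nats_upto R" for e
      proof (cases "squarefree e")
        case True
        have "\<bar>?W e\<bar> \<le> 1 / phi e" by (rule abs_Wcoef_le_inverse_phi[OF True])
        also have "\<dots> \<le> (\<Sum>m\<in>nats_upto (real e). majorant 2 e m) / real e" by (rule inverse_phi_le[OF True])
        also have "\<dots> \<le> X / real e"
        proof (rule divide_right_mono)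
          have "ln (real e) \<le> ln R" using e R by (subst ln_le_cancel_iff) auto
          then show "(\<Sum>m\<in>nats_upto (real e). majorant 2 e m) \<le> X" using elim(3) e R unfolding X_def by auto
        qed simp
        finally show ?thesis by simp
      qed (use X in \<open>simp add: Wcoef_def\<close>)
      have four: "4 / z \<le> 4" if "z \<ge> 1" for z :: real using that by (simp add: field_simps)
      have HR: "\<bar>(\<Sum>e\<in>nats_upto R. 1 / real e) - L - \<gamma>\<bar> \<le> 4"
        using \<gamma>[rule_format, OF R1] four[OF R1] R by simp
      have Hy: "\<bar>(\<Sum>e\<in>nats_upto y. 1 / real e) - ln y - \<gamma>\<bar> \<le> 4"
        using \<gamma>[rule_format, OF y] four[OF y] by simp
      have S1: "(\<Sum>e\<in>nats_upto R. \<bar>?W e\<bar>) \<le> X * (G * L)"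
      proof -
        have "(\<Sum>e\<in>nats_upto R. \<bar>?W e\<bar>) \<le> X * (\<Sum>e\<in>nats_upto R. 1 / real e)"
          unfolding sum_distrib_left by (intro sum_mono W)
        also have "\<dots> \<le> X * (G * L)"
        proof (intro mult_left_mono X)
          have "(8 + \<bar>\<gamma>\<bar>) * 1 \<le> (8 + \<bar>\<gamma>\<bar>) * L" using L by (intro mult_left_mono) auto
          then show "(\<Sum>e\<in>nats_upto R. 1 / real e) \<le> G * L" using HR by (simp add: G_def algebra_simps)
        qed
        finally show ?thesis .
      qed
      have S2: "(\<Sum>e\<in>{e\<in>nats_upto R. y < real e}. \<bar>?W e\<bar>) \<le> X * (G * L powr (3/4))"
      proof -
        have Beq: "{e\<in>nats_upto R. y < real e} = nats_upto R - nats_upto y" by auto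
        have "(\<Sum>e\<in>{e\<in>nats_upto R. y < real e}. \<bar>?W e\<bar>) \<le> X * (\<Sum>e\<in>nats_upto R - nats_upto y. 1 / real e)"
          unfolding Beq sum_distrib_left by (intro sum_mono W) auto
        also have "(\<Sum>e\<in>nats_upto R - nats_upto y. 1 / real e) = (\<Sum>e\<in>nats_upto R. 1 / real e) - (\<Sum>e\<in>nats_upto y. 1 / real e)"
        proof (rule sum_diff)
          have "y \<le> R" using R by (simp add: y_def field_simps mult_le_cancel_left1)
          then show "nats_upto y \<subseteq> nats_upto R" by auto
        qed simp
        finally have "(\<Sum>e\<in>{e\<in>nats_upto R. y < real e}. \<bar>?W e\<bar>) \<le>
          X * ((\<Sum>e\<in>nats_upto R. 1 / real e) - (\<Sum>e\<in>nats_upto y. 1 / real e))" .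
        also have "X * ((\<Sum>e\<in>nats_upto R. 1 / real e) - (\<Sum>e\<in>nats_upto y. 1 / real e)) \<le> X * (G * L powr (3/4))"
        proof (intro mult_left_mono X)
          have l1: "1 \<le> L powr (3/4)" using L by (simp add: ge_one_powr_ge_zero)
          have "(8 + \<bar>\<gamma>\<bar>) * 1 \<le> (8 + \<bar>\<gamma>\<bar>) * L powr (3/4)" using l1 by (intro mult_left_mono) auto
          then show "(\<Sum>e\<in>nats_upto R. 1 / real e) - (\<Sum>e\<in>nats_upto y. 1 / real e) \<le> G * L powr (3/4)"
            using HR Hy lny by (simp add: G_def algebra_simps)
        qed
        finally show ?thesis .
      qed
      have "\<bar>Msum R 0 h h - Pconst (phi_weight h) * L\<bar> = \<bar>Msum R 0 h h - Pconst (phi_weight h) * Tsum (ustar 0 h h) R\<bar>"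
        by (simp only: Pconst_Tsum_ustar_0[OF h R1] R(2))
      also have "\<dots> \<le> L powr (- 1/8 + 1/64) * (\<Sum>e\<in>nats_upto R. \<bar>?W e\<bar>) +
         2 * L powr (2 * (1/64)) * (\<Sum>e\<in>{e\<in>nats_upto R. y < real e}. \<bar>?W e\<bar>)"
      proof -
        have "even (0 + h + h)" by simp
        then show ?thesis unfolding y_def using elim(4) R h lh by blast
      qed
      also have "\<dots> \<le> L powr (- 1/8 + 1/64) * (X * (G * L)) + 2 * L powr (2 * (1/64)) * (X * (G * L powr (3/4)))"
        using S1 S2 by (intro add_mono mult_left_mono) auto
      also have "L powr (- 1/8 + 1/64) * (X * (G * L)) \<le> G * L powr (59/64)"
      proof -
        have "L powr (- 1/8 + 1/64) * (X * (G * L)) = G * (L powr (- 1/8 + 1/64) * L powr (1/64) * L powr 1)"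
          using L by (simp add: X_def)
        also have "L powr (- 1/8 + 1/64) * L powr (1/64) * L powr 1 = L powr (58/64)"
          unfolding powr_add[symmetric] by simp
        also have "G * L powr (58/64) \<le> G * L powr (59/64)"
          using L by (intro mult_left_mono powr_mono) (auto simp: G_def)
        finally show ?thesis .
      qed
      also have "2 * L powr (2 * (1/64)) * (X * (G * L powr (3/4))) \<le> 2 * (G * L powr (59/64))"
      proof -
        have "2 * L powr (2 * (1/64)) * (X * (G * L powr (3/4))) = 2 * G * (L powr (2 * (1/64)) * L powr (1/64) * L powr (3/4))"
          by (simp add: X_def)
        also have "L powr (2 * (1/64)) * L powr (1/64) * L powr (3/4) = L powr (51/64)"
          unfolding powr_add[symmetric] by simp
        also have "2 * G * L powr (51/64) \<le> 2 * G * L powr (59/64)"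
          using L by (intro mult_left_mono powr_mono) (auto simp: G_def)
        finally show ?thesis by simp
      qed
      also have "G * L powr (59/64) + 2 * (G * L powr (59/64)) \<le> L powr (15/16)" using elim(1) by simp
      finally show "\<bar>Msum R 0 h h - Pconst (phi_weight h) * L\<bar> \<le> L powr (15/16)" by simp
    qed
  qed
qed

end

section \<open>The singular series\<close>

text \<open>Beyond \<open>Q\<close> the factors are 1 + O(1/p^2), so the product converges
  absolutely even if finitely many factors are zero. Its value is the limit of the partial products,
  which \<open>Pconst_euler_product\<close> identifies.\<close>

lemma prodinf_Pconst:
  assumes u: "admissible B Q u" "B \<ge> 0" "Q > 0"
  defines "f \<equiv> (\<lambda>p. if prime p then (1 - u p) / (1 - 1 / real p) else 1)"
  shows "convergent_prod f" "prodinf f = Pconst u"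
proof -
  have "summable (\<lambda>p. norm (f p - 1))"
  proof (rule summable_comparison_test_ev)
    show "\<forall>\<^sub>F p in sequentially. norm (norm (f p - 1)) \<le> 2 * B * (real p powr (-2))"
    proof (rule eventually_sequentiallyI[of "Suc Q"])
      fix p assume p: "Suc Q \<le> p"
      show "norm (norm (f p - 1)) \<le> 2 * B * (real p powr (-2))"
      proof (cases "prime p")
        case True
        then have p2: "real p \<ge> 2" using prime_ge_2_nat by force
        have "\<not> p dvd Q" using p u(3) by (auto dest: dvd_imp_le)
        then have b: "\<bar>1 - real p * u p\<bar> \<le> B / real p" using u(1) True by (auto simp: admissible_def vloc_def)
        have "f p - 1 = (1 - real p * u p) / (real p - 1)" using True p2 by (simp add: f_def field_simps)
        then have "\<bar>f p - 1\<bar> = \<bar>1 - real p * u p\<bar> * (1 / (real p - 1))" using p2 by (simp add: abs_divide)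
        also have "\<dots> \<le> (B / real p) * (2 / real p)"
          using b p2 u(2) by (intro mult_mono) (auto simp: field_simps)
        also have "\<dots> = 2 * B * (real p powr (-2))"
          using p2 by (simp add: powr_minus powr_realpow[symmetric] divide_simps power2_eq_square)
        finally show ?thesis by simp
      qed (use u in \<open>simp add: f_def\<close>)
    qed
    show "summable (\<lambda>p. 2 * B * (real p powr (-2)))"
      by (intro summable_mult) (simp add: summable_real_powr_iff)
  qed
  then have "abs_convergent_prod f" by (rule summable_imp_abs_convergent_prod)
  then show cp: "convergent_prod f" by (rule abs_convergent_prod_imp_convergent_prod)
  have "(\<Prod>i\<le>N. f i) = (\<Prod>p\<in>primes_upto (real N). (1 - u p) / (1 - 1 / real p))" for N
    unfolding f_def by (intro prod.mono_neutral_cong_right) auto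
  then have "(\<lambda>N. \<Prod>i\<le>N. f i) \<longlonglongrightarrow> Pconst u" using Pconst_euler_product[OF u] by simp
  with convergent_prod_LIMSEQ[OF cp] show "prodinf f = Pconst u" by (rule LIMSEQ_unique)
qed

lemma nat_abs_dvd_iff: "p dvd nat \<bar>a - b\<bar> \<longleftrightarrow> a mod int p = b mod int p"
proof -
  have "p dvd nat \<bar>a - b\<bar> \<longleftrightarrow> int p dvd \<bar>a - b\<bar>" by (subst int_dvd_int_iff[symmetric]) simp
  also have "\<dots> \<longleftrightarrow> a mod int p = b mod int p" by (simp add: mod_eq_dvd_iff)
  finally show ?thesis .
qed

lemma sing_series_2:
  assumes "j 1 \<noteq> j 2"
  shows "sing_series 2 j = Pconst (phi_weight (nat \<bar>j 1 - j 2\<bar>))"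
proof -
  define h where "h = nat \<bar>j 1 - j 2\<bar>"
  have h: "h > 0" using assms by (simp add: h_def)
  have "sing_series 2 j = prodinf (\<lambda>p. if prime p then (1 - phi_weight h p) / (1 - 1 / real p) else 1)"
    unfolding sing_series_def
  proof (rule arg_cong[of _ _ prodinf], rule ext)
    fix p
    show "(if prime p then (1 - 1 / real p) powi - int 2 * (1 - real (nu 2 j p) / real p) else 1) =
      (if prime p then (1 - phi_weight h p) / (1 - 1 / real p) else 1)"
    proof (cases "prime p")
      case True
      then have p: "real p \<ge> 2" using prime_ge_2_nat by force
      have img: "(\<lambda>i. j i mod int p) ` {1..2} = {j 1 mod int p, j 2 mod int p}"
        by (auto simp: numeral_2_eq_2 atLeastAtMostSuc_conv)
      have nu: "nu 2 j p = (if p dvd h then 1 else 2)"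
        unfolding nu_def img h_def nat_abs_dvd_iff by auto
      have pw: "(1 - 1 / real p) powi - int 2 = 1 / (1 - 1 / real p)\<^sup>2"
        by (simp add: power_int_minus field_simps)
      show ?thesis
      proof (cases "p dvd h")
        case True
        then show ?thesis using \<open>prime p\<close> p unfolding nu pw by (simp add: phi_weight_def power2_eq_square)
      next
        case False
        have "1 - 1 / (real p - 1) = (1 - 2 / real p) / (1 - 1 / real p)" using p by (simp add: field_simps)
        then show ?thesis using False \<open>prime p\<close> unfolding nu pw by (simp add: phi_weight_def power2_eq_square)
      qed
    qed simp
  qed
  also have "\<dots> = Pconst (phi_weight h)" by (rule prodinf_Pconst[OF admissible_phi_weight]) (use h in auto)
  finally show ?thesis by (simp add: h_def)
qed

text \<open>The five cases are the ways in which three residues can coincide. If all three differ, p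
  is at least 3. If only \<open>a\<close> and \<open>b\<close> agree and p = 2, both sides are 0,
  the left one through the factor of \<open>h\<^sub>1\<close>.\<close>

lemma local_factor_3:
  fixes a b c :: int
  assumes p: "prime p"
  defines "g \<equiv> nat \<bar>a - b\<bar>" and "h\<^sub>1 \<equiv> nat \<bar>a - c\<bar>" and "h\<^sub>2 \<equiv> nat \<bar>b - c\<bar>"
  shows "(1 - phi_weight h\<^sub>1 p) * (1 - ustar g h\<^sub>1 h\<^sub>2 p) =
    (1 - real (card {a mod int p, b mod int p, c mod int p}) / real p) / (1 - 1 / real p)"
proof -
  have p2: "real p \<ge> 2" "p \<ge> 2" using prime_ge_2_nat[OF p] by auto
  have d: "p dvd g \<longleftrightarrow> a mod int p = b mod int p" "p dvd h\<^sub>1 \<longleftrightarrow> a mod int p = c mod int p"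
    "p dvd h\<^sub>2 \<longleftrightarrow> b mod int p = c mod int p" unfolding g_def h\<^sub>1_def h\<^sub>2_def by (rule nat_abs_dvd_iff)+
  have two: "1 - 1 / (real p - 1) = (1 - 2 / real p) / (1 - 1 / real p)" using p2 by (simp add: field_simps)
  consider "p dvd g" "p dvd h\<^sub>1" "p dvd h\<^sub>2" | "p dvd g" "\<not> p dvd h\<^sub>1" "\<not> p dvd h\<^sub>2" | "\<not> p dvd g" "p dvd h\<^sub>1" "\<not> p dvd h\<^sub>2"
    | "\<not> p dvd g" "\<not> p dvd h\<^sub>1" "p dvd h\<^sub>2" | "\<not> p dvd g" "\<not> p dvd h\<^sub>1" "\<not> p dvd h\<^sub>2"
    using d by argo
  then show ?thesis
  proof cases
    case 1
    then have "card {a mod int p, b mod int p, c mod int p} = 1" using d by simp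
    then show ?thesis using 1 p2 by (simp add: phi_weight_def ustar_def)
  next
    case 2
    then have c: "card {a mod int p, b mod int p, c mod int p} = 2" using d by simp
    show ?thesis
    proof (cases "p = 2")
      case True
      then show ?thesis unfolding c using 2 by (simp add: phi_weight_def)
    next
      case False
      then have "real p - 2 > 0" using p2 by simp
      then have "ustar g h\<^sub>1 h\<^sub>2 p = 0" using 2 by (simp add: ustar_def floc_def)
      then show ?thesis unfolding c using 2 two by (simp add: phi_weight_def)
    qed
  next
    case 3
    then have c: "card {a mod int p, b mod int p, c mod int p} = 2" using d by (simp add: insert_commute)
    show ?thesis unfolding c using 3 two by (simp add: phi_weight_def ustar_def)
  next
    case 4
    then have c: "card {a mod int p, b mod int p, c mod int p} = 2" using d by simp
    show ?thesis unfolding c using 4 two by (simp add: phi_weight_def ustar_def)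
  next
    case 5
    then have c: "card {a mod int p, b mod int p, c mod int p} = 3" using d by simp
    have "p \<noteq> 2"
    proof
      assume "p = 2"
      then have "card {a mod int p, b mod int p, c mod int p} \<le> card {0, 1 :: int}" by (intro card_mono) auto
      then show False using c by simp
    qed
    then have p3: "real p \<ge> 3" using p2 by linarith
    have "1 - floc g p / (real p - 2) = (real p - 1) / (real p - 2)" using 5 p3 by (simp add: floc_def field_simps)
    then have u: "ustar g h\<^sub>1 h\<^sub>2 p = 1 / (real p - 2)" using 5 p3 by (simp add: ustar_def)
    have e1: "1 - 1 / (real p - 1) = (real p - 2) / (real p - 1)" using p3 by (simp add: field_simps)
    have e2: "1 - 1 / (real p - 2) = (real p - 3) / (real p - 2)" using p3 by (simp add: field_simps)
    have e3: "(1 - 3 / real p) / (1 - 1 / real p) = (real p - 3) / (real p - 1)" using p3 by (simp add: field_simps)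
    show ?thesis unfolding c u using 5 e1 e2 e3 p3 by (simp add: phi_weight_def)
  qed
qed

lemma sing_series_3:
  assumes "j 1 \<noteq> j 2" "j 1 \<noteq> j 3" "j 2 \<noteq> j 3"
  shows "sing_series 3 j = Pconst (phi_weight (nat \<bar>j 1 - j 3\<bar>)) *
     Pconst (ustar (nat \<bar>j 1 - j 2\<bar>) (nat \<bar>j 1 - j 3\<bar>) (nat \<bar>j 2 - j 3\<bar>))"
proof -
  define g h\<^sub>1 h\<^sub>2 where gh: "g = nat \<bar>j 1 - j 2\<bar>" "h\<^sub>1 = nat \<bar>j 1 - j 3\<bar>" "h\<^sub>2 = nat \<bar>j 2 - j 3\<bar>"
  have pos: "g > 0" "h\<^sub>1 > 0" "h\<^sub>2 > 0" using assms by (auto simp: gh)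
  let ?f = "\<lambda>u p. if prime p then (1 - u p) / (1 - 1 / real p) else 1 :: real"
  have "sing_series 3 j = prodinf (\<lambda>p. ?f (phi_weight h\<^sub>1) p * ?f (ustar g h\<^sub>1 h\<^sub>2) p)"
    unfolding sing_series_def
  proof (rule arg_cong[of _ _ prodinf], rule ext)
    fix p
    show "(if prime p then (1 - 1 / real p) powi - int 3 * (1 - real (nu 3 j p) / real p) else 1) =
      ?f (phi_weight h\<^sub>1) p * ?f (ustar g h\<^sub>1 h\<^sub>2) p"
    proof (cases "prime p")
      case True
      then have p: "real p \<ge> 2" using prime_ge_2_nat by force
      have img: "(\<lambda>i. j i mod int p) ` {1..3} = {j 1 mod int p, j 2 mod int p, j 3 mod int p}"
      proof -
        have "{1..3::nat} = {1,2,3}" by auto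
        then show ?thesis by simp
      qed
      define a where "a = 1 - 1 / real p"
      have a: "a \<noteq> 0" using p by (simp add: a_def)
      have pw: "a powi - int 3 = 1 / (a * a * a)"
        by (simp add: power_int_minus power3_eq_cube field_simps)
      have "(1 - phi_weight h\<^sub>1 p) * (1 - ustar g h\<^sub>1 h\<^sub>2 p) = (1 - real (nu 3 j p) / real p) / a"
        unfolding nu_def img gh a_def by (rule local_factor_3[OF True])
      then have "1 - real (nu 3 j p) / real p = (1 - phi_weight h\<^sub>1 p) * (1 - ustar g h\<^sub>1 h\<^sub>2 p) * a"
        using a by (simp add: field_simps)
      then show ?thesis using True a unfolding a_def[symmetric] pw by simp
    qed simp
  qed
  also have "\<dots> = prodinf (?f (phi_weight h\<^sub>1)) * prodinf (?f (ustar g h\<^sub>1 h\<^sub>2))"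
    by (rule prodinf_mult[symmetric])
       (rule prodinf_Pconst[OF admissible_phi_weight] prodinf_Pconst[OF admissible_ustar], use pos in auto)+
  also have "prodinf (?f (phi_weight h\<^sub>1)) = Pconst (phi_weight h\<^sub>1)"
    by (rule prodinf_Pconst[OF admissible_phi_weight]) (use pos in auto)
  also have "prodinf (?f (ustar g h\<^sub>1 h\<^sub>2)) = Pconst (ustar g h\<^sub>1 h\<^sub>2)"
    by (rule prodinf_Pconst[OF admissible_ustar]) (use pos in auto)
  finally show ?thesis by (simp add: gh)
qed

section \<open>Error terms\<close>

definition divs :: "nat \<Rightarrow> nat" where "divs q = card {d. d dvd q}"

lemma divs_mult_le:
  assumes "a > 0" "b > 0"
  shows "divs (a * b) \<le> divs a * divs b"
proof -
  have "{d. d dvd a * b} \<subseteq> (\<lambda>(x,y). x * y) ` ({d. d dvd a} \<times> {d. d dvd b})"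
  proof
    fix d assume "d \<in> {d. d dvd a * b}"
    then obtain x y where "d = x * y" "x dvd a" "y dvd b" using division_decomp[of d a b] by auto
    then show "d \<in> (\<lambda>(x,y). x * y) ` ({d. d dvd a} \<times> {d. d dvd b})" by force
  qed
  moreover have fin: "finite ({d. d dvd a} \<times> {d. d dvd b})" using assms by auto
  ultimately have "card {d. d dvd a * b} \<le> card ({d. d dvd a} \<times> {d. d dvd b})"
    using card_mono card_image_le le_trans finite_imageI by meson
  then show ?thesis by (simp add: divs_def card_cartesian_product)
qed

lemma divs_ge_1: "q > 0 \<Longrightarrow> divs q \<ge> 1"
  unfolding divs_def by (simp add: Suc_le_eq card_gt_0_iff) (auto intro: exI[of _ 1])

lemma harmonic_le: "x \<ge> 1 \<Longrightarrow> (\<Sum>n\<in>nats_upto x. 1 / real n) \<le> 1 + ln x"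
proof -
  assume x: "x \<ge> 1"
  define N where "N = nat \<lfloor>x\<rfloor>"
  have N: "N \<ge> 1" "real N \<le> x" using x unfolding N_def by linarith+
  have "(\<Sum>n=1..N. 1 / real n) \<le> 1 + ln (real N)"
    using N(1)
  proof (induction N rule: dec_induct)
    case (step n)
    have "ln (real n / real (Suc n)) \<le> real n / real (Suc n) - 1" using step by (intro ln_le_minus_one) auto
    moreover have "ln (real n / real (Suc n)) = ln (real n) - ln (real (Suc n))" using step by (subst ln_div) auto
    moreover have "real n / real (Suc n) - 1 = - (1 / real (Suc n))" by (simp add: field_simps)
    ultimately have "1 / real (Suc n) \<le> ln (real (Suc n)) - ln (real n)" by linarith
    then show ?case using step by simp
  qed simp
  also have "\<dots> \<le> 1 + ln x" using N by simp
  finally show ?thesis by (simp add: nats_upto_eq N_def)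
qed

text \<open>One factor of the divisor function is opened as a sum over q = d e, and
  submultiplicativity separates d from e. Each induction step squares the bound, hence the exponent
  2^k.\<close>

lemma sum_divs_power:
  assumes x: "x \<ge> 1"
  shows "(\<Sum>q\<in>nats_upto x. real (divs q) ^ k / real q) \<le> (1 + ln x) ^ (2 ^ k)"
proof (induction k)
  case 0
  then show ?case using harmonic_le[OF x] by simp
next
  case (Suc k)
  have "(\<Sum>q\<in>nats_upto x. real (divs q) ^ Suc k / real q) =
      (\<Sum>q\<in>nats_upto x. \<Sum>d | d dvd q. real (divs (d * (q div d))) ^ k / (real d * real (q div d)))"
  proof (intro sum.cong refl)
    fix q assume "q \<in> nats_upto x"
    have "(\<Sum>d | d dvd q. real (divs (d * (q div d))) ^ k / (real d * real (q div d))) = (\<Sum>d | d dvd q. real (divs q) ^ k / real q)"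
      by (intro sum.cong refl) (auto simp flip: of_nat_mult)
    then show "real (divs q) ^ Suc k / real q = (\<Sum>d | d dvd q. real (divs (d * (q div d))) ^ k / (real d * real (q div d)))"
      by (simp add: divs_def)
  qed
  also have "\<dots> = (\<Sum>d\<in>nats_upto x. \<Sum>e\<in>nats_upto (x / real d). real (divs (d * e)) ^ k / (real d * real e))"
    by (rule sum_divisors_hyperbola)
  also have "\<dots> \<le> (\<Sum>d\<in>nats_upto x. \<Sum>e\<in>nats_upto x. (real (divs d) ^ k / real d) * (real (divs e) ^ k / real e))"
  proof (rule sum_mono)
    fix d assume d: "d \<in> nats_upto x"
    have "(\<Sum>e\<in>nats_upto (x / real d). real (divs (d * e)) ^ k / (real d * real e)) \<le>
      (\<Sum>e\<in>nats_upto (x / real d). (real (divs d) ^ k / real d) * (real (divs e) ^ k / real e))"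
    proof (rule sum_mono)
      fix e assume e: "e \<in> nats_upto (x / real d)"
      have "real (divs (d * e)) \<le> real (divs d) * real (divs e)"
        using divs_mult_le[of d e] d e by (simp flip: of_nat_mult)
      then have "real (divs (d * e)) ^ k \<le> (real (divs d) * real (divs e)) ^ k" by (intro power_mono) auto
      then have "real (divs (d * e)) ^ k / (real d * real e) \<le> (real (divs d) * real (divs e)) ^ k / (real d * real e)"
        by (intro divide_right_mono) auto
      then show "real (divs (d * e)) ^ k / (real d * real e) \<le> (real (divs d) ^ k / real d) * (real (divs e) ^ k / real e)"
        by (simp add: power_mult_distrib)
    qed
    also have "\<dots> \<le> (\<Sum>e\<in>nats_upto x. (real (divs d) ^ k / real d) * (real (divs e) ^ k / real e))"
    proof (rule sum_mono2)
      have "x / real d \<le> x / 1" using d x by (intro divide_left_mono) auto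
      then show "nats_upto (x / real d) \<subseteq> nats_upto x" by auto
    qed auto
    finally show "(\<Sum>e\<in>nats_upto (x / real d). real (divs (d * e)) ^ k / (real d * real e)) \<le>
       (\<Sum>e\<in>nats_upto x. (real (divs d) ^ k / real d) * (real (divs e) ^ k / real e))" .
  qed
  also have "\<dots> = (\<Sum>q\<in>nats_upto x. real (divs q) ^ k / real q) * (\<Sum>q\<in>nats_upto x. real (divs q) ^ k / real q)"
    by (simp add: sum_product)
  also have "\<dots> \<le> (1 + ln x) ^ (2 ^ k) * (1 + ln x) ^ (2 ^ k)"
    using Suc x by (intro mult_mono) (auto intro!: sum_nonneg add_nonneg_nonneg zero_le_power)
  also have "\<dots> = (1 + ln x) ^ (2 ^ Suc k)" by (simp add: mult_2 flip: power_add)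
  finally show ?case .
qed

text \<open>q/phi(q) is a product of factors at most 2, one for each prime factor, and the resulting
  power of 2 counts the squarefree divisors. The crude form fits the moments of
  \<open>sum_divs_power\<close>.\<close>

lemma inverse_totient_le:
  assumes "q > 0"
  shows "1 / real (totient q) \<le> real (divs q) / real q"
proof -
  have "real q = real (totient q) / (\<Prod>p\<in>prime_factors q. 1 - 1 / real p)"
  proof -
    have "(\<Prod>p\<in>prime_factors q. 1 - 1 / real p) \<noteq> 0"
      by (auto simp: in_prime_factors_iff)
    then show ?thesis by (simp add: totient_formula2)
  qed
  also have "\<dots> = real (totient q) * (\<Prod>p\<in>prime_factors q. 1 / (1 - 1 / real p))"
    by (simp add: prod_dividef)
  also have "\<dots> \<le> real (totient q) * (\<Prod>p\<in>prime_factors q. 2)"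
  proof (intro mult_left_mono prod_mono conjI)
    fix p assume "p \<in> prime_factors q"
    then have p: "real p \<ge> 2" using prime_ge_2_nat by (auto simp: in_prime_factors_iff)
    then show "0 \<le> 1 / (1 - 1 / real p)" by simp
    have "1 - 1 / real p \<ge> 1 / 2" using p by (simp add: field_simps)
    then have "1 / (1 - 1 / real p) \<le> 1 / (1 / 2)" by (intro divide_left_mono) auto
    then show "1 / (1 - 1 / real p) \<le> 2" by simp
  qed simp
  also have "(\<Prod>p\<in>prime_factors q. 2 :: real) = real (card (Pow (prime_factors q)))"
    by (simp add: card_Pow)
  also have "card (Pow (prime_factors q)) = card {d. d dvd q \<and> squarefree d}"
    by (rule bij_betw_same_card[OF bij_betw_squarefree_divisors[OF assms], symmetric])
  also have "real (totient q) * real (card {d. d dvd q \<and> squarefree d}) \<le> real (totient q) * real (divs q)"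
    unfolding divs_def using assms by (intro mult_left_mono of_nat_mono card_mono) auto
  finally show ?thesis using assms by (simp add: field_simps)
qed

section \<open>Primes in arithmetic progressions\<close>

lemma card_cong_le:
  assumes q: "q > (0::nat)" and x: "x \<ge> 0"
  shows "real (card {n. 1 \<le> n \<and> real n \<le> x \<and> [int n = b] (mod int q)}) \<le> x / real q + 1"
proof -
  define S where "S = {n. 1 \<le> n \<and> real n \<le> x \<and> [int n = b] (mod int q)}"
  have inj: "inj_on (\<lambda>n. n div q) S"
  proof (rule inj_onI)
    fix m n assume "m \<in> S" "n \<in> S" and eq: "m div q = n div q"
    then have "[int m = int n] (mod int q)" by (auto simp: S_def intro: cong_trans cong_sym)
    then have "m mod q = n mod q" unfolding cong_int_iff unfolding cong_def .
    then show "m = n" using eq by (metis div_mult_mod_eq)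
  qed
  have "(\<lambda>n. n div q) ` S \<subseteq> {0..nat \<lfloor>x / real q\<rfloor>}"
  proof
    fix m assume "m \<in> (\<lambda>n. n div q) ` S"
    then obtain n where n: "real n \<le> x" "m = n div q" by (auto simp: S_def)
    have "real m \<le> real n / real q" using n by (simp add: of_nat_div_le_of_nat)
    also have "\<dots> \<le> x / real q" using n by (intro divide_right_mono) auto
    finally show "m \<in> {0..nat \<lfloor>x / real q\<rfloor>}" using x by (simp add: le_nat_iff le_floor_iff)
  qed
  then have "card S \<le> card {0..nat \<lfloor>x / real q\<rfloor>}" using card_inj_on_le[OF inj] by blast
  also have "\<dots> = Suc (nat \<lfloor>x / real q\<rfloor>)" by simp
  finally have "real (card S) \<le> 1 + real (nat \<lfloor>x / real q\<rfloor>)" by linarith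
  also have "real (nat \<lfloor>x / real q\<rfloor>) \<le> x / real q" using x by simp
  finally show ?thesis by (simp add: S_def)
qed

lemma psi_prog_set_finite: "finite {n. 1 \<le> n \<and> real n \<le> x \<and> [int n = b] (mod int q)}"
  by (rule finite_subset[OF _ finite_nats_upto[of x]]) auto

lemma psi_prog_nonneg: "psi_prog x q b \<ge> 0"
  unfolding psi_prog_def by (intro sum_nonneg mangoldt_nonneg)

lemma psi_prog_le:
  assumes q: "q > 0" and x: "x \<ge> 1"
  shows "psi_prog x q b \<le> (x / real q + 1) * ln x"
proof -
  have "psi_prog x q b \<le> (\<Sum>n | 1 \<le> n \<and> real n \<le> x \<and> [int n = b] (mod int q). ln x)"
    unfolding psi_prog_def
  proof (rule sum_mono)
    fix n assume "n \<in> {n. 1 \<le> n \<and> real n \<le> x \<and> [int n = b] (mod int q)}"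
    then have n: "n > 0" "real n \<le> x" by auto
    then have "mangoldt n \<le> ln (real n)" by (intro mangoldt_le)
    also have "\<dots> \<le> ln x" using n by (subst ln_le_cancel_iff) auto
    finally show "mangoldt n \<le> ln x" .
  qed
  also have "\<dots> = real (card {n. 1 \<le> n \<and> real n \<le> x \<and> [int n = b] (mod int q)}) * ln x" by simp
  also have "\<dots> \<le> (x / real q + 1) * ln x" using x by (intro mult_right_mono card_cong_le q) auto
  finally show ?thesis .
qed

text \<open>In a non-reduced class only the powers of a single prime contribute.\<close>

lemma psi_prog_not_coprime:
  assumes nc: "\<not> coprime b (int q)" and x: "x \<ge> 1"
  shows "psi_prog x q b \<le> ln x"
proof -
  have "gcd b (int q) \<noteq> 1" using nc unfolding coprime_iff_gcd_eq_1 .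
  then have "nat (gcd b (int q)) \<noteq> 1" by (simp add: nat_eq_iff)
  then obtain p where p: "prime p" "p dvd nat (gcd b (int q))" using prime_factor_nat by blast
  then have "int p dvd gcd b (int q)" by (subst (asm) int_dvd_int_iff[symmetric]) simp
  then have pb: "int p dvd b" "int p dvd int q" by auto
  have p2: "p > 1" using p prime_gt_1_nat by blast
  define K where "K = nat \<lfloor>log (real p) x\<rfloor>"
  have pK: "real p ^ m \<le> x \<Longrightarrow> m \<le> K" for m
  proof -
    assume "real p ^ m \<le> x"
    then have "log (real p) (real p ^ m) \<le> log (real p) x" using p2 x by (subst log_le_cancel_iff) auto
    then have "real m \<le> log (real p) x" using p2 by (simp add: log_nat_power)
    then show "m \<le> K" unfolding K_def by (simp add: le_nat_iff le_floor_iff)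
  qed
  have "psi_prog x q b \<le> (\<Sum>n | n dvd p ^ K. mangoldt n)"
  proof -
    let ?S = "{n. 1 \<le> n \<and> real n \<le> x \<and> [int n = b] (mod int q)}"
    have "psi_prog x q b = (\<Sum>n\<in>{n\<in>?S. mangoldt n \<noteq> (0::real)}. mangoldt n)"
      unfolding psi_prog_def by (intro sum.mono_neutral_right psi_prog_set_finite) auto
    also have "\<dots> \<le> (\<Sum>n | n dvd p ^ K. mangoldt n)"
    proof (rule sum_mono2)
      show "finite {n. n dvd p ^ K}" using p2 by simp
      show "{n\<in>?S. mangoldt n \<noteq> (0::real)} \<subseteq> {n. n dvd p ^ K}"
      proof
        fix n assume n: "n \<in> {n\<in>?S. mangoldt n \<noteq> (0::real)}"
        then have "primepow n" by (auto simp: mangoldt_def split: if_splits)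
        then obtain r m where rm: "prime r" "m > 0" "n = r ^ m" by (auto simp: primepow_def)
        have "[int n = b] (mod int q)" using n by simp
        then have "[int n = b] (mod int p)" using pb(2) by (rule cong_dvd_modulus)
        then have "int p dvd int n" using pb(1) cong_dvd_iff by blast
        then have "p dvd n" unfolding int_dvd_int_iff .
        then have "p dvd r ^ m" using rm by simp
        then have "p dvd r" using p(1) prime_dvd_power by blast
        then have "p = r" using p(1) rm(1) primes_dvd_imp_eq by blast
        moreover have "real (r ^ m) \<le> x" using n rm by simp
        ultimately have "m \<le> K" using pK[of m] by simp
        then show "n \<in> {n. n dvd p ^ K}" using rm \<open>p = r\<close> by (simp add: le_imp_power_dvd)
      qed
    qed (simp add: mangoldt_nonneg)
    finally show ?thesis .
  qed
  also have "\<dots> = ln (real (p ^ K))" using p2 by (subst mangoldt_sum) auto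
  also have "\<dots> \<le> ln x"
  proof -
    have "real p ^ K = real p powr real K" using p2 by (simp add: powr_realpow)
    also have "\<dots> \<le> real p powr (log (real p) x)"
      using p2 x by (intro powr_mono) (auto simp: K_def zero_le_log_cancel_iff)
    also have "\<dots> = x" using p2 x by simp
    finally show ?thesis using p2 x by simp
  qed
  finally show ?thesis .
qed

definition Emax :: "real \<Rightarrow> nat \<Rightarrow> real" where
  "Emax x q = Max ((\<lambda>b. \<bar>E_prog x q b\<bar>) ` {b \<in> {1..int q}. coprime b (int q)})"

lemma Emax_set:
  assumes "q > 0"
  shows "finite {b \<in> {1..int q}. coprime b (int q)}" "{b \<in> {1..int q}. coprime b (int q)} \<noteq> {}"
proof -
  have "1 \<in> {b \<in> {1..int q}. coprime b (int q)}" using assms by simp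
  then show "{b \<in> {1..int q}. coprime b (int q)} \<noteq> {}" by blast
  show "finite {b \<in> {1..int q}. coprime b (int q)}" by (rule finite_subset[of _ "{1..int q}"]) auto
qed

lemma psi_prog_cong:
  assumes "[b = c] (mod int q)"
  shows "psi_prog x q b = psi_prog x q c"
proof -
  have "[int n = b] (mod int q) \<longleftrightarrow> [int n = c] (mod int q)" for n
    using assms cong_trans cong_sym by blast
  then show ?thesis by (simp add: psi_prog_def)
qed

lemma abs_E_prog_le_Emax:
  assumes q: "q > 0" and c: "coprime b (int q)"
  shows "\<bar>E_prog x q b\<bar> \<le> Emax x q"
proof -
  \<comment> \<open>The representative in \<open>{1..q}\<close> rather than in
    \<open>{0..q - 1}\<close>, to match the range in \<open>Emax\<close>; for q = 1 it is 1.\<close>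
  define b' where "b' = (b - 1) mod int q + 1"
  have "(b - 1) mod int q \<ge> 0" "(b - 1) mod int q < int q" using q by simp_all
  then have b': "b' \<in> {1..int q}" by (simp add: b'_def)
  have "[(b - 1) mod int q = b - 1] (mod int q)" by (simp add: cong_def)
  then have cong: "[b' = b] (mod int q)" unfolding b'_def
    using cong_add_rcancel[of "(b - 1) mod int q" 1 "b - 1" "int q"] by simp
  then have cb: "coprime b' (int q)" using c cong_imp_coprime[of b b' "int q"] cong_sym by blast
  have "E_prog x q b = E_prog x q b'"
    unfolding E_prog_def using psi_prog_cong[OF cong] c cb by simp
  moreover have "\<bar>E_prog x q b'\<bar> \<le> Emax x q"
    unfolding Emax_def using Emax_set[OF q] b' cb by (intro Max_ge) auto
  ultimately show ?thesis by simp
qed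

lemma Emax_nonneg:
  assumes "q > 0"
  shows "Emax x q \<ge> 0"
  using abs_E_prog_le_Emax[OF assms, of 1 x] by simp

text \<open>As q is at most x, the extra 1 in the count of a residue class is absorbed. The shape
  d(q)/q is chosen for use with the divisor moments.\<close>

lemma Emax_le:
  assumes q: "q > 0" "real q \<le> x"
  shows "Emax x q \<le> 3 * (1 + ln x) * x * (real (divs q) / real q)"
proof -
  have x: "x \<ge> 1" using q by linarith
  have d: "real (divs q) \<ge> 1" using divs_ge_1[OF q(1)] by simp
  have lnx: "ln x \<ge> 0" using x by simp
  have "\<bar>E_prog x q b\<bar> \<le> 3 * (1 + ln x) * x * (real (divs q) / real q)" for b
  proof -
    have "psi_prog x q b \<le> (x / real q + 1) * ln x" by (rule psi_prog_le[OF q(1) x])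
    also have "\<dots> \<le> (x / real q + x / real q) * (1 + ln x)"
      using q lnx by (intro mult_mono) (auto simp: field_simps)
    also have "\<dots> = 2 * (1 + ln x) * x * (1 / real q)" by simp
    also have "\<dots> \<le> 2 * (1 + ln x) * x * (real (divs q) / real q)"
      using lnx x d by (intro mult_left_mono divide_right_mono) auto
    finally have 1: "psi_prog x q b \<le> 2 * (1 + ln x) * x * (real (divs q) / real q)" .
    have "(if coprime b (int q) then 1 else 0) * x / real (totient q) \<le> x * (1 / real (totient q))"
      using x by simp
    also have "\<dots> \<le> x * (real (divs q) / real q)"
      using x inverse_totient_le[OF q(1)] by (intro mult_left_mono) auto
    also have "\<dots> \<le> (1 + ln x) * (x * (real (divs q) / real q))"
    proof -
      have "1 * (x * (real (divs q) / real q)) \<le> (1 + ln x) * (x * (real (divs q) / real q))"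
        using lnx x by (intro mult_right_mono) auto
      then show ?thesis by simp
    qed
    finally have 2: "(if coprime b (int q) then 1 else 0) * x / real (totient q) \<le> (1 + ln x) * (x * (real (divs q) / real q))" .
    have 3: "(if coprime b (int q) then 1 else 0) * x / real (totient q) \<ge> 0" using x by simp
    define D where "D = (1 + ln x) * (x * (real (divs q) / real q))"
    have "D \<ge> 0" using lnx x by (simp add: D_def)
    moreover have "2 * (1 + ln x) * x * (real (divs q) / real q) = 2 * D"
      "3 * (1 + ln x) * x * (real (divs q) / real q) = 3 * D" by (simp_all add: D_def)
    ultimately show ?thesis
      using 1 2 3 psi_prog_nonneg[of x q b] unfolding E_prog_def D_def[symmetric] by linarith
  qed
  then show ?thesis unfolding Emax_def using Emax_set[OF q(1)] by (subst Max_le_iff) auto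
qed

text \<open>The substitution m = n + j turns the class of s up to N into the class of s + j up to x.
  The only members missing on the left are those m that do not exceed j, at most |j| of
  them.\<close>

lemma sum_Lam_class:
  fixes j s :: int
  assumes q: "q > 0" and x: "x = real N + real_of_int j" "x \<ge> 1"
  shows "\<bar>(\<Sum>n\<in>{n\<in>{1..N}. [int n = s] (mod int q)}. Lam (int n + j)) - psi_prog x q (s + j)\<bar> \<le> \<bar>real_of_int j\<bar> * ln x"
    "(\<Sum>n\<in>{n\<in>{1..N}. [int n = s] (mod int q)}. Lam (int n + j)) \<le> psi_prog x q (s + j)"
proof -
  define S where "S = {m. 1 \<le> m \<and> real m \<le> x \<and> [int m = s + j] (mod int q)}"
  define A where "A = (\<Sum>n\<in>{n\<in>{1..N}. [int n = s] (mod int q)}. Lam (int n + j))"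
  have finS: "finite S" unfolding S_def by (rule psi_prog_set_finite)
  have "A = (\<Sum>n\<in>{n\<in>{1..N}. [int n = s] (mod int q) \<and> int n + j > 0}. mangoldt (nat (int n + j)))"
    unfolding A_def by (rule sum.mono_neutral_cong_right) (auto simp: Lam_def)
  also have "\<dots> = (\<Sum>m\<in>{m\<in>S. int m > j}. mangoldt m)"
  proof (rule sum.reindex_bij_witness[of _ "\<lambda>m. nat (int m - j)" "\<lambda>n. nat (int n + j)"], goal_cases)
    case (2 n)
    then have "[int n + j = s + j] (mod int q)" by (simp add: cong_add_rcancel)
    then show ?case using 2 x by (auto simp: S_def)
  next
    case (4 m)
    then have m: "1 \<le> m" "real m \<le> x" "[int m = s + j] (mod int q)" "int m > j" by (auto simp: S_def)
    have "[int m - j + j = s + j] (mod int q)" using m by simp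
    then have "[int m - j = s] (mod int q)" by (simp only: cong_add_rcancel)
    moreover have "nat (int m - j) \<le> N" using m x by linarith
    ultimately show ?case using m by auto
  qed auto
  finally have A: "A = (\<Sum>m\<in>{m\<in>S. int m > j}. mangoldt m)" .
  have psi: "psi_prog x q (s + j) = (\<Sum>m\<in>{m\<in>S. int m > j}. mangoldt m) + (\<Sum>m\<in>{m\<in>S. \<not> int m > j}. mangoldt m)"
  proof -
    have "S = {m\<in>S. int m > j} \<union> {m\<in>S. \<not> int m > j}" by auto
    then have "(\<Sum>m\<in>S. mangoldt m :: real) = (\<Sum>m\<in>{m\<in>S. int m > j} \<union> {m\<in>S. \<not> int m > j}. mangoldt m)" by simp
    also have "\<dots> = (\<Sum>m\<in>{m\<in>S. int m > j}. mangoldt m) + (\<Sum>m\<in>{m\<in>S. \<not> int m > j}. mangoldt m)"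
      using finS by (intro sum.union_disjoint) auto
    finally show ?thesis by (simp add: psi_prog_def S_def)
  qed
  have rest: "0 \<le> (\<Sum>m\<in>{m\<in>S. \<not> int m > j}. mangoldt m :: real)" by (intro sum_nonneg mangoldt_nonneg)
  have "(\<Sum>m\<in>{m\<in>S. \<not> int m > j}. mangoldt m) \<le> (\<Sum>m\<in>{m\<in>S. \<not> int m > j}. ln x)"
  proof (rule sum_mono)
    fix m assume "m \<in> {m\<in>S. \<not> int m > j}"
    then have m: "m > 0" "real m \<le> x" by (auto simp: S_def)
    then have "mangoldt m \<le> ln (real m)" by (intro mangoldt_le)
    also have "\<dots> \<le> ln x" using m by (subst ln_le_cancel_iff) auto
    finally show "mangoldt m \<le> ln x" .
  qed
  also have "\<dots> = real (card {m\<in>S. \<not> int m > j}) * ln x" by simp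
  also have "\<dots> \<le> \<bar>real_of_int j\<bar> * ln x"
  proof (intro mult_right_mono)
    have "card {m\<in>S. \<not> int m > j} \<le> card {1..nat \<bar>j\<bar>}" by (intro card_mono) (auto simp: S_def)
    then have "card {m\<in>S. \<not> int m > j} \<le> nat \<bar>j\<bar>" by simp
    then show "real (card {m\<in>S. \<not> int m > j}) \<le> \<bar>real_of_int j\<bar>" by linarith
  qed (use x in auto)
  finally have up: "(\<Sum>m\<in>{m\<in>S. \<not> int m > j}. mangoldt m) \<le> \<bar>real_of_int j\<bar> * ln x" .
  show "\<bar>(\<Sum>n\<in>{n\<in>{1..N}. [int n = s] (mod int q)}. Lam (int n + j)) - psi_prog x q (s + j)\<bar> \<le> \<bar>real_of_int j\<bar> * ln x"
    using up rest unfolding A_def[symmetric] psi A by simp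
  show "(\<Sum>n\<in>{n\<in>{1..N}. [int n = s] (mod int q)}. Lam (int n + j)) \<le> psi_prog x q (s + j)"
    using rest unfolding A_def[symmetric] psi A by simp
qed

lemma Lam_nonneg: "Lam n \<ge> 0"
  by (simp add: Lam_def mangoldt_nonneg)

lemma sum_Lam_class_main:
  fixes j s :: int
  assumes q: "q > 0" and x: "x = real N + real_of_int j" "x \<ge> 1"
  shows "\<bar>(\<Sum>n\<in>{n\<in>{1..N}. [int n = s] (mod int q)}. Lam (int n + j)) -
      (if coprime (s + j) (int q) then real N / real (totient q) else 0)\<bar> \<le> Emax x q + 2 * (\<bar>real_of_int j\<bar> + 1) * (1 + ln x)"
proof -
  define A where "A = (\<Sum>n\<in>{n\<in>{1..N}. [int n = s] (mod int q)}. Lam (int n + j))"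
  define J where "J = \<bar>real_of_int j\<bar>"
  have J: "J \<ge> 0" by (simp add: J_def)
  have lnx: "ln x \<ge> 0" using x by simp
  have prod: "J * ln x \<ge> 0" using J lnx by simp
  have bnd: "2 * (J + 1) * (1 + ln x) = 2 * J + 2 + 2 * ln x + 2 * (J * ln x)" by (simp add: algebra_simps)
  have E: "Emax x q \<ge> 0" by (rule Emax_nonneg[OF q])
  have A: "\<bar>A - psi_prog x q (s + j)\<bar> \<le> J * ln x" "A \<le> psi_prog x q (s + j)" "A \<ge> 0"
    using sum_Lam_class[OF assms, of s] unfolding A_def J_def by (auto intro: sum_nonneg Lam_nonneg)
  show ?thesis
  proof (cases "coprime (s + j) (int q)")
    case True
    have "\<bar>psi_prog x q (s + j) - x / real (totient q)\<bar> \<le> Emax x q"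
      using abs_E_prog_le_Emax[OF q True, of x] True by (simp add: E_prog_def)
    moreover have "\<bar>x / real (totient q) - real N / real (totient q)\<bar> \<le> J"
    proof -
      have t: "real (totient q) \<ge> 1" using q by (simp add: Suc_le_eq)
      have "\<bar>x / real (totient q) - real N / real (totient q)\<bar> = J / real (totient q)"
        unfolding x(1) diff_divide_distrib[symmetric] J_def by (simp add: abs_divide)
      also have "\<dots> \<le> J / 1" using t J q by (intro divide_left_mono) auto
      finally show ?thesis by simp
    qed
    ultimately show ?thesis using A prod lnx J True unfolding A_def[symmetric] J_def[symmetric] bnd by simp
  next
    case False
    then have "psi_prog x q (s + j) \<le> ln x" using psi_prog_not_coprime x by blast
    then show ?thesis using A prod lnx J False E unfolding A_def[symmetric] J_def[symmetric] bnd by simp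
  qed
qed

text \<open>Common to the one-divisor and the two-divisor case: V is a weighted count of the residue
  classes containing n. For n up to J a shifted argument can be nonpositive, where
  \<open>Lam_R\<close> is 0 by convention and the expansion may fail. This costs J ln x times the
  total weight and raises the constant from 2 to 3.\<close>

lemma weighted_sum_Lam:
  fixes I :: "'i set" and c :: "'i \<Rightarrow> real" and q :: "'i \<Rightarrow> nat" and s :: "'i \<Rightarrow> int" and V :: "nat \<Rightarrow> real"
  assumes I: "finite I" and q: "\<And>i. i \<in> I \<Longrightarrow> q i > 0"
    and x: "x = real N + real_of_int j" "x \<ge> 1" and J: "J \<ge> \<bar>real_of_int j\<bar>"
    and V: "\<And>n. n \<in> {1..N} \<Longrightarrow> real n > J \<Longrightarrow> V n = (\<Sum>i\<in>{i\<in>I. [int n = s i] (mod int (q i))}. c i)"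
    and V0: "\<And>n. n \<in> {1..N} \<Longrightarrow> real n \<le> J \<Longrightarrow> V n = 0 \<or> V n = (\<Sum>i\<in>{i\<in>I. [int n = s i] (mod int (q i))}. c i)"
  shows "\<bar>(\<Sum>n=1..N. V n * Lam (int n + j)) - real N * (\<Sum>i\<in>I. if coprime (s i + j) (int (q i)) then c i / real (totient (q i)) else 0)\<bar>
    \<le> (\<Sum>i\<in>I. \<bar>c i\<bar> * Emax x (q i)) + (\<Sum>i\<in>I. \<bar>c i\<bar>) * (3 * (J + 1) * (1 + ln x))"
proof -
  define W where "W = (\<lambda>n. \<Sum>i\<in>{i\<in>I. [int n = s i] (mod int (q i))}. c i)"
  define S where "S = (\<Sum>i\<in>I. \<bar>c i\<bar>)"
  have S: "S \<ge> 0" by (simp add: S_def sum_nonneg)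
  have J0: "J \<ge> 0" using J by linarith
  have lnx: "ln x \<ge> 0" using x by simp
  have Lam: "0 \<le> Lam (int n + j)" "Lam (int n + j) \<le> ln x" if "n \<in> {1..N}" for n
  proof -
    show "0 \<le> Lam (int n + j)" by (rule Lam_nonneg)
    show "Lam (int n + j) \<le> ln x"
    proof (cases "int n + j > 0")
      case True
      then have "mangoldt (nat (int n + j)) \<le> ln (real (nat (int n + j)))" by (intro mangoldt_le) simp
      also have "\<dots> \<le> ln x" using True that x by (subst ln_le_cancel_iff) auto
      finally show ?thesis using True by (simp add: Lam_def)
    qed (use lnx in \<open>simp add: Lam_def\<close>)
  qed
  have Wle: "\<bar>W n\<bar> \<le> S" for n
  proof -
    have "\<bar>W n\<bar> \<le> (\<Sum>i\<in>{i\<in>I. [int n = s i] (mod int (q i))}. \<bar>c i\<bar>)" unfolding W_def by (rule sum_abs)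
    also have "\<dots> \<le> S" unfolding S_def using I by (intro sum_mono2) auto
    finally show ?thesis .
  qed
  have 1: "\<bar>(\<Sum>n=1..N. V n * Lam (int n + j)) - (\<Sum>n=1..N. W n * Lam (int n + j))\<bar> \<le> S * (J * ln x)"
  proof -
    have "\<bar>(\<Sum>n=1..N. V n * Lam (int n + j)) - (\<Sum>n=1..N. W n * Lam (int n + j))\<bar> \<le>
      (\<Sum>n=1..N. \<bar>V n - W n\<bar> * Lam (int n + j))"
      unfolding sum_subtractf[symmetric] left_diff_distrib[symmetric]
      by (rule order_trans[OF sum_abs]) (simp add: abs_mult Lam_nonneg)
    also have "\<dots> \<le> (\<Sum>n=1..N. if real n \<le> J then S * ln x else 0)"
    proof (rule sum_mono)
      fix n assume n: "n \<in> {1..N}"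
      show "\<bar>V n - W n\<bar> * Lam (int n + j) \<le> (if real n \<le> J then S * ln x else 0)"
      proof (cases "real n \<le> J")
        case True
        have "\<bar>V n - W n\<bar> \<le> S" using V0[OF n True] Wle[of n] S by (auto simp: W_def)
        then show ?thesis using True Lam[OF n] S by (auto intro!: mult_mono)
      next
        case False
        then show ?thesis using V[OF n] by (simp add: W_def)
      qed
    qed
    also have "\<dots> = real (card {n\<in>{1..N}. real n \<le> J}) * (S * ln x)"
      by (simp add: sum.If_cases Int_def conj_commute)
    also have "\<dots> \<le> J * (S * ln x)"
    proof (intro mult_right_mono)
      have "card {n\<in>{1..N}. real n \<le> J} \<le> card {1..nat \<lfloor>J\<rfloor>}"
        using J0 by (intro card_mono) (auto simp: le_nat_iff le_floor_iff)
      then have "card {n\<in>{1..N}. real n \<le> J} \<le> nat \<lfloor>J\<rfloor>" by simp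
      then show "real (card {n\<in>{1..N}. real n \<le> J}) \<le> J" using J0 by linarith
    qed (use S lnx in auto)
    finally show ?thesis by (simp add: mult_ac)
  qed
  have "(\<Sum>n=1..N. W n * Lam (int n + j)) = (\<Sum>n=1..N. \<Sum>i\<in>I. if [int n = s i] (mod int (q i)) then c i * Lam (int n + j) else 0)"
    unfolding W_def using I by (simp add: sum_distrib_right sum.inter_filter[symmetric])
  also have "\<dots> = (\<Sum>i\<in>I. \<Sum>n=1..N. if [int n = s i] (mod int (q i)) then c i * Lam (int n + j) else 0)"
    by (rule sum.swap)
  also have "\<dots> = (\<Sum>i\<in>I. c i * (\<Sum>n\<in>{n\<in>{1..N}. [int n = s i] (mod int (q i))}. Lam (int n + j)))"
    by (simp add: sum_distrib_left sum.inter_filter[symmetric])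
  finally have W: "(\<Sum>n=1..N. W n * Lam (int n + j)) =
    (\<Sum>i\<in>I. c i * (\<Sum>n\<in>{n\<in>{1..N}. [int n = s i] (mod int (q i))}. Lam (int n + j)))" .
  have mainsum: "real N * (\<Sum>i\<in>I. if coprime (s i + j) (int (q i)) then c i / real (totient (q i)) else 0) =
    (\<Sum>i\<in>I. c i * (if coprime (s i + j) (int (q i)) then real N / real (totient (q i)) else 0))"
    unfolding sum_distrib_left by (intro sum.cong refl) simp
  have 2: "\<bar>(\<Sum>n=1..N. W n * Lam (int n + j)) - real N * (\<Sum>i\<in>I. if coprime (s i + j) (int (q i)) then c i / real (totient (q i)) else 0)\<bar>
    \<le> (\<Sum>i\<in>I. \<bar>c i\<bar> * (Emax x (q i) + 2 * (J + 1) * (1 + ln x)))"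
    unfolding W mainsum sum_subtractf[symmetric] right_diff_distrib[symmetric]
  proof (rule order_trans[OF sum_abs], rule sum_mono)
    fix i assume i: "i \<in> I"
    have "\<bar>(\<Sum>n\<in>{n\<in>{1..N}. [int n = s i] (mod int (q i))}. Lam (int n + j)) -
      (if coprime (s i + j) (int (q i)) then real N / real (totient (q i)) else 0)\<bar> \<le>
        Emax x (q i) + 2 * (\<bar>real_of_int j\<bar> + 1) * (1 + ln x)"
      by (rule sum_Lam_class_main[OF q[OF i] x])
    also have "\<dots> \<le> Emax x (q i) + 2 * (J + 1) * (1 + ln x)"
      using J lnx by (intro add_left_mono mult_right_mono) auto
    finally show "\<bar>c i * ((\<Sum>n\<in>{n\<in>{1..N}. [int n = s i] (mod int (q i))}. Lam (int n + j)) -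
      (if coprime (s i + j) (int (q i)) then real N / real (totient (q i)) else 0))\<bar>
      \<le> \<bar>c i\<bar> * (Emax x (q i) + 2 * (J + 1) * (1 + ln x))"
      unfolding abs_mult by (intro mult_left_mono) auto
  qed
  have "(\<Sum>i\<in>I. \<bar>c i\<bar> * (Emax x (q i) + 2 * (J + 1) * (1 + ln x))) =
     (\<Sum>i\<in>I. \<bar>c i\<bar> * Emax x (q i)) + S * (2 * (J + 1) * (1 + ln x))"
    unfolding S_def sum_distrib_right sum.distrib[symmetric] by (simp only: distrib_left)
  moreover have "S * (2 * (J + 1) * (1 + ln x)) + S * (J * ln x) \<le> S * (3 * (J + 1) * (1 + ln x))"
  proof -
    have "2 * (J + 1) * (1 + ln x) + J * ln x \<le> 3 * (J + 1) * (1 + ln x)" using J0 lnx by (simp add: algebra_simps)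
    from mult_left_mono[OF this S] show ?thesis by (simp only: distrib_left)
  qed
  ultimately show ?thesis using 1 2 unfolding S_def[symmetric] by linarith
qed

section \<open>Expanding the divisor sums into residue classes\<close>

definition dcoef :: "real \<Rightarrow> nat \<Rightarrow> real" where
  "dcoef R d = moebius d * ln (R / real d)"

lemma abs_dcoef_le:
  assumes "d \<in> nats_upto R"
  shows "\<bar>dcoef R d\<bar> \<le> ln R"
proof -
  have d: "d > 0" "real d \<le> R" using assms by auto
  then have "R / real d \<le> R / 1" by (intro divide_left_mono) auto
  moreover have "R / real d \<ge> 1" using d by simp
  ultimately have "0 \<le> ln (R / real d)" "ln (R / real d) \<le> ln R" using d by auto
  then have "\<bar>moebius d\<bar> * \<bar>ln (R / real d)\<bar> \<le> 1 * ln R"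
    using abs_moebius_le[of d] by (intro mult_mono) auto
  then show ?thesis by (simp add: dcoef_def abs_mult)
qed

lemma card_nats_upto_le: "R \<ge> 0 \<Longrightarrow> real (card (nats_upto R)) \<le> R"
  by (simp add: nats_upto_eq)

lemma sum_abs_dcoef_le:
  assumes "R \<ge> 1"
  shows "(\<Sum>d\<in>nats_upto R. \<bar>dcoef R d\<bar>) \<le> R * ln R"
proof -
  have "(\<Sum>d\<in>nats_upto R. \<bar>dcoef R d\<bar>) \<le> (\<Sum>d\<in>nats_upto R. ln R)"
    by (intro sum_mono abs_dcoef_le)
  also have "\<dots> \<le> R * ln R" using card_nats_upto_le[of R] assms by (simp add: mult_right_mono)
  finally show ?thesis .
qed

lemma Lam_R_eq:
  assumes "int n + j > 0"
  shows "Lam_R R (int n + j) = (\<Sum>d\<in>{d\<in>nats_upto R. [int n = - j] (mod int d)}. dcoef R d)"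
proof -
  have "{d. d dvd nat (int n + j) \<and> real d \<le> R} = {d\<in>nats_upto R. [int n = - j] (mod int d)}"
  proof -
    have "d dvd nat (int n + j) \<longleftrightarrow> [int n = - j] (mod int d)" for d
    proof -
      have "d dvd nat (int n + j) \<longleftrightarrow> int d dvd int n + j"
        using assms by (subst int_dvd_int_iff[symmetric]) simp
      then show ?thesis by (simp add: cong_iff_dvd_diff)
    qed
    moreover have "d > 0" if "d dvd nat (int n + j)" for d using that assms by (auto intro!: Nat.gr0I)
    ultimately show ?thesis by auto
  qed
  then show ?thesis using assms by (simp add: Lam_R_def dcoef_def)
qed

lemma coprime_int_nat_abs: "coprime (a - b) (int d) \<longleftrightarrow> coprime d (nat \<bar>b - a\<bar>)"
proof -
  have "coprime (a - b) (int d) \<longleftrightarrow> coprime (int (nat \<bar>b - a\<bar>)) (int d)"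
    by (simp add: abs_minus_commute[of b a])
  then show ?thesis by (simp only: coprime_int_iff coprime_commute)
qed

text \<open>The weight \<open>divs q ^ 2\<close> is at least 1 and is inserted so that the error has
  the same shape as in \<open>correlation_3\<close>; \<open>correlation_error_small\<close> then
  treats both.\<close>

lemma correlation_2:
  fixes j1 j3 :: int
  assumes R: "R \<ge> 1" and x: "x = real N + real_of_int j3" "x \<ge> 1"
    and J: "J \<ge> \<bar>real_of_int j1\<bar>" "J \<ge> \<bar>real_of_int j3\<bar>"
  shows "\<bar>(\<Sum>n=1..N. Lam_R R (int n + j1) * Lam (int n + j3)) - real N * Tsum (phi_weight (nat \<bar>j1 - j3\<bar>)) R\<bar>
    \<le> ln R * (\<Sum>q\<in>nats_upto R. real (divs q) ^ 2 * Emax x q) + (R * ln R) * (3 * (J + 1) * (1 + ln x))"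
proof -
  have pos: "int n + j1 > 0" if "real n > J" for n using that J(1) by linarith
  have "\<bar>(\<Sum>n=1..N. Lam_R R (int n + j1) * Lam (int n + j3)) -
     real N * (\<Sum>d\<in>nats_upto R. if coprime (- j1 + j3) (int d) then dcoef R d / real (totient d) else 0)\<bar>
    \<le> (\<Sum>d\<in>nats_upto R. \<bar>dcoef R d\<bar> * Emax x d) + (\<Sum>d\<in>nats_upto R. \<bar>dcoef R d\<bar>) * (3 * (J + 1) * (1 + ln x))"
  proof (rule weighted_sum_Lam[OF _ _ x J(2)])
    fix n show "real n > J \<Longrightarrow> Lam_R R (int n + j1) = (\<Sum>d\<in>{d\<in>nats_upto R. [int n = - j1] (mod int d)}. dcoef R d)"
      by (intro Lam_R_eq pos)
    show "Lam_R R (int n + j1) = 0 \<or> Lam_R R (int n + j1) = (\<Sum>d\<in>{d\<in>nats_upto R. [int n = - j1] (mod int d)}. dcoef R d)"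
    proof (cases "int n + j1 > 0")
      case False
      then show ?thesis by (simp add: Lam_R_def)
    qed (simp add: Lam_R_eq)
  qed auto
  also have "(\<Sum>d\<in>nats_upto R. if coprime (- j1 + j3) (int d) then dcoef R d / real (totient d) else 0) =
      Tsum (phi_weight (nat \<bar>j1 - j3\<bar>)) R"
    unfolding Tsum_def
  proof (intro sum.cong refl)
    fix d assume "d \<in> nats_upto R"
    then have d: "d > 0" by simp
    have c: "coprime (- j1 + j3) (int d) \<longleftrightarrow> coprime d (nat \<bar>j1 - j3\<bar>)"
      using coprime_int_nat_abs[of j3 j1 d] by (simp add: algebra_simps)
    show "(if coprime (- j1 + j3) (int d) then dcoef R d / real (totient d) else 0) =
      moebius d * (\<Prod>p\<in>prime_factors d. phi_weight (nat \<bar>j1 - j3\<bar>) p) * ln (R / real d)"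
      unfolding c prod_phi_weight[OF d]
      by (cases "squarefree d") (simp_all add: dcoef_def totient_squarefree, simp add: moebius_def)
  qed
  also have "(\<Sum>d\<in>nats_upto R. \<bar>dcoef R d\<bar> * Emax x d) \<le> ln R * (\<Sum>q\<in>nats_upto R. real (divs q) ^ 2 * Emax x q)"
    unfolding sum_distrib_left
  proof (rule sum_mono)
    fix d assume d: "d \<in> nats_upto R"
    then have d0: "d > 0" by simp
    have "1 ^ 2 \<le> real (divs d) ^ 2" using divs_ge_1[OF d0] by (intro power_mono) auto
    then have "1 * Emax x d \<le> real (divs d) ^ 2 * Emax x d"
      using Emax_nonneg[OF d0] by (intro mult_right_mono) auto
    then show "\<bar>dcoef R d\<bar> * Emax x d \<le> ln R * (real (divs d) ^ 2 * Emax x d)"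
      using abs_dcoef_le[OF d] Emax_nonneg[OF d0] by (intro mult_mono) auto
  qed
  also have "(\<Sum>d\<in>nats_upto R. \<bar>dcoef R d\<bar>) * (3 * (J + 1) * (1 + ln x)) \<le> (R * ln R) * (3 * (J + 1) * (1 + ln x))"
    using sum_abs_dcoef_le[OF R] J x by (intro mult_right_mono) auto
  finally show ?thesis by simp
qed

text \<open>The Chinese remainder theorem for moduli that need not be coprime: put s = a +
  \<open>d\<^sub>1\<close> t, where t solves a linear congruence modulo \<open>d\<^sub>2\<close>
  that is solvable by the gcd condition.\<close>

lemma cong_pair_solution:
  fixes a b :: int
  assumes d: "d\<^sub>1 > 0" "d\<^sub>2 > (0::nat)" and g: "gcd d\<^sub>1 d\<^sub>2 dvd nat \<bar>a - b\<bar>"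
  shows "\<exists>s. [s = a] (mod int d\<^sub>1) \<and> [s = b] (mod int d\<^sub>2)"
proof -
  have "int (gcd d\<^sub>1 d\<^sub>2) dvd b - a"
  proof -
    have "int (gcd d\<^sub>1 d\<^sub>2) dvd int (nat \<bar>a - b\<bar>)" using g by (subst int_dvd_int_iff)
    then show ?thesis by (simp add: dvd_diff_commute)
  qed
  then have "gcd (int d\<^sub>1) (int d\<^sub>2) dvd b - a" by (simp add: gcd_int_int_eq)
  then obtain t where "[int d\<^sub>1 * t = b - a] (mod int d\<^sub>2)" using cong_solve_dvd_int by blast
  then have "[a + int d\<^sub>1 * t = a + (b - a)] (mod int d\<^sub>2)" by (intro cong_add cong_refl)
  moreover have "[a + int d\<^sub>1 * t = a] (mod int d\<^sub>1)" by (simp add: cong_def)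
  ultimately show ?thesis by (intro exI[of _ "a + int d\<^sub>1 * t"]) simp
qed

text \<open>A compatible pair of divisors prescribes one class modulo the lcm, and an incompatible
  pair divides the shifted values for no n. At most \<open>divs k ^ 2\<close> pairs share the lcm k,
  which is at most R^2; this is where the divisor weight arises. \<open>j1 = j2\<close> is allowed
  and gives the squared case.\<close>

lemma correlation_3:
  fixes j1 j2 j3 :: int
  assumes R: "R \<ge> 1" and x: "x = real N + real_of_int j3" "x \<ge> 1"
    and J: "J \<ge> \<bar>real_of_int j1\<bar>" "J \<ge> \<bar>real_of_int j2\<bar>" "J \<ge> \<bar>real_of_int j3\<bar>"
  shows "\<bar>(\<Sum>n=1..N. Lam_R R (int n + j1) * Lam_R R (int n + j2) * Lam (int n + j3)) -
      real N * Msum R (nat \<bar>j1 - j2\<bar>) (nat \<bar>j1 - j3\<bar>) (nat \<bar>j2 - j3\<bar>)\<bar>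
    \<le> (ln R)\<^sup>2 * (\<Sum>q\<in>nats_upto (R\<^sup>2). real (divs q) ^ 2 * Emax x q) + (R * ln R)\<^sup>2 * (3 * (J + 1) * (1 + ln x))"
proof -
  define I where "I = {(d\<^sub>1,d\<^sub>2) \<in> nats_upto R \<times> nats_upto R. gcd d\<^sub>1 d\<^sub>2 dvd nat \<bar>(- j1) - (- j2)\<bar>}"
  define c where "c = (\<lambda>(d\<^sub>1,d\<^sub>2). dcoef R d\<^sub>1 * dcoef R d\<^sub>2)"
  define q where "q = (\<lambda>(d\<^sub>1,d\<^sub>2). lcm d\<^sub>1 d\<^sub>2 :: nat)"
  define s where "s = (\<lambda>(d\<^sub>1::nat,d\<^sub>2::nat). SOME s. [s = - j1] (mod int d\<^sub>1) \<and> [s = - j2] (mod int d\<^sub>2))"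
  have Iabs: "nat \<bar>(- j1) - (- j2)\<bar> = nat \<bar>j1 - j2\<bar>" by (simp add: abs_minus_commute)
  have Isub: "I \<subseteq> nats_upto R \<times> nats_upto R" by (auto simp: I_def)
  then have finI: "finite I" by (rule finite_subset) simp
  have s: "[s (d\<^sub>1,d\<^sub>2) = - j1] (mod int d\<^sub>1)" "[s (d\<^sub>1,d\<^sub>2) = - j2] (mod int d\<^sub>2)" if "(d\<^sub>1,d\<^sub>2) \<in> I" for d\<^sub>1 d\<^sub>2
  proof -
    have "\<exists>s. [s = - j1] (mod int d\<^sub>1) \<and> [s = - j2] (mod int d\<^sub>2)"
      using that by (intro cong_pair_solution) (auto simp: I_def)
    from someI_ex[OF this] show "[s (d\<^sub>1,d\<^sub>2) = - j1] (mod int d\<^sub>1)" "[s (d\<^sub>1,d\<^sub>2) = - j2] (mod int d\<^sub>2)"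
      by (simp_all add: s_def)
  qed
  have cls: "[int n = s (d\<^sub>1,d\<^sub>2)] (mod int (lcm d\<^sub>1 d\<^sub>2)) \<longleftrightarrow> [int n = - j1] (mod int d\<^sub>1) \<and> [int n = - j2] (mod int d\<^sub>2)"
    if "(d\<^sub>1,d\<^sub>2) \<in> I" for d\<^sub>1 d\<^sub>2 n
  proof
    assume *: "[int n = s (d\<^sub>1,d\<^sub>2)] (mod int (lcm d\<^sub>1 d\<^sub>2))"
    have "[int n = s (d\<^sub>1,d\<^sub>2)] (mod int d\<^sub>1)" "[int n = s (d\<^sub>1,d\<^sub>2)] (mod int d\<^sub>2)"
      by (rule cong_dvd_modulus[OF *]; simp)+
    then show "[int n = - j1] (mod int d\<^sub>1) \<and> [int n = - j2] (mod int d\<^sub>2)"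
      using s[OF that] cong_trans by blast
  next
    assume *: "[int n = - j1] (mod int d\<^sub>1) \<and> [int n = - j2] (mod int d\<^sub>2)"
    have "[int n = s (d\<^sub>1,d\<^sub>2)] (mod int d\<^sub>1)" using * s(1)[OF that] cong_sym cong_trans by blast
    moreover have "[int n = s (d\<^sub>1,d\<^sub>2)] (mod int d\<^sub>2)" using * s(2)[OF that] cong_sym cong_trans by blast
    ultimately have "[int n = s (d\<^sub>1,d\<^sub>2)] (mod lcm (int d\<^sub>1) (int d\<^sub>2))" by (rule cong_cong_lcm_int)
    then show "[int n = s (d\<^sub>1,d\<^sub>2)] (mod int (lcm d\<^sub>1 d\<^sub>2))" by (simp add: lcm_int_int_eq)
  qed
  have prod: "(\<Sum>i\<in>{i\<in>I. [int n = s i] (mod int (q i))}. c i) =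
     (\<Sum>d\<in>{d\<in>nats_upto R. [int n = - j1] (mod int d)}. dcoef R d) * (\<Sum>d\<in>{d\<in>nats_upto R. [int n = - j2] (mod int d)}. dcoef R d)" for n
  proof -
    have "{i\<in>I. [int n = s i] (mod int (q i))} =
      {d\<in>nats_upto R. [int n = - j1] (mod int d)} \<times> {d\<in>nats_upto R. [int n = - j2] (mod int d)}"
    proof (rule Set.set_eqI)
      fix i :: "nat \<times> nat"
      obtain d\<^sub>1 d\<^sub>2 where i: "i = (d\<^sub>1,d\<^sub>2)" by (cases i)
      have "(d\<^sub>1,d\<^sub>2) \<in> I" if "d\<^sub>1 \<in> nats_upto R" "d\<^sub>2 \<in> nats_upto R" "[int n = - j1] (mod int d\<^sub>1)" "[int n = - j2] (mod int d\<^sub>2)"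
      proof -
        have "int (gcd d\<^sub>1 d\<^sub>2) dvd int d\<^sub>1" "int (gcd d\<^sub>1 d\<^sub>2) dvd int d\<^sub>2" by simp_all
        then have "[int n = - j1] (mod int (gcd d\<^sub>1 d\<^sub>2))" "[int n = - j2] (mod int (gcd d\<^sub>1 d\<^sub>2))"
          using cong_dvd_modulus[OF that(3)] cong_dvd_modulus[OF that(4)] by blast+
        then have "[- j1 = - j2] (mod int (gcd d\<^sub>1 d\<^sub>2))" using cong_sym cong_trans by blast
        then have "gcd d\<^sub>1 d\<^sub>2 dvd nat \<bar>(- j1) - (- j2)\<bar>" unfolding nat_abs_dvd_iff cong_def .
        then show ?thesis using that by (simp add: I_def)
      qed
      then show "i \<in> {i\<in>I. [int n = s i] (mod int (q i))} \<longleftrightarrow>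
        i \<in> {d\<in>nats_upto R. [int n = - j1] (mod int d)} \<times> {d\<in>nats_upto R. [int n = - j2] (mod int d)}"
        using cls[of d\<^sub>1 d\<^sub>2 n] Isub unfolding i q_def by auto
    qed
    then show ?thesis by (simp add: sum_product sum.cartesian_product c_def)
  qed
  have pos: "int n + j1 > 0" "int n + j2 > 0" if "real n > J" for n using that J by linarith+
  have "\<bar>(\<Sum>n=1..N. Lam_R R (int n + j1) * Lam_R R (int n + j2) * Lam (int n + j3)) -
     real N * (\<Sum>i\<in>I. if coprime (s i + j3) (int (q i)) then c i / real (totient (q i)) else 0)\<bar>
    \<le> (\<Sum>i\<in>I. \<bar>c i\<bar> * Emax x (q i)) + (\<Sum>i\<in>I. \<bar>c i\<bar>) * (3 * (J + 1) * (1 + ln x))"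
  proof (rule weighted_sum_Lam[OF finI _ x J(3)])
    fix i assume "i \<in> I"
    then show "q i > 0" using Isub by (auto simp: q_def lcm_pos_nat)
  next
    fix n assume "real n > J"
    then show "Lam_R R (int n + j1) * Lam_R R (int n + j2) = (\<Sum>i\<in>{i\<in>I. [int n = s i] (mod int (q i))}. c i)"
      unfolding prod using pos by (simp add: Lam_R_eq)
  next
    fix n
    show "Lam_R R (int n + j1) * Lam_R R (int n + j2) = 0 \<or>
       Lam_R R (int n + j1) * Lam_R R (int n + j2) = (\<Sum>i\<in>{i\<in>I. [int n = s i] (mod int (q i))}. c i)"
    proof (cases "int n + j1 > 0 \<and> int n + j2 > 0")
      case True
      then show ?thesis unfolding prod by (simp add: Lam_R_eq)
    next
      case False
      then have "Lam_R R (int n + j1) = 0 \<or> Lam_R R (int n + j2) = 0" by (auto simp: Lam_R_def)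
      then show ?thesis by auto
    qed
  qed
  also have "(\<Sum>i\<in>I. if coprime (s i + j3) (int (q i)) then c i / real (totient (q i)) else 0) =
     Msum R (nat \<bar>j1 - j2\<bar>) (nat \<bar>j1 - j3\<bar>) (nat \<bar>j2 - j3\<bar>)"
  proof -
    have "Msum R (nat \<bar>j1 - j2\<bar>) (nat \<bar>j1 - j3\<bar>) (nat \<bar>j2 - j3\<bar>) =
      (\<Sum>(d\<^sub>1,d\<^sub>2)\<in>nats_upto R \<times> nats_upto R. if gcd d\<^sub>1 d\<^sub>2 dvd nat \<bar>j1 - j2\<bar> \<and> coprime d\<^sub>1 (nat \<bar>j1 - j3\<bar>) \<and> coprime d\<^sub>2 (nat \<bar>j2 - j3\<bar>)
        then dcoef R d\<^sub>1 * dcoef R d\<^sub>2 / real (totient (lcm d\<^sub>1 d\<^sub>2)) else 0)"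
      unfolding Msum_def dcoef_def by (rule sum.cartesian_product)
    also have "\<dots> = (\<Sum>i\<in>I. if coprime (s i + j3) (int (q i)) then c i / real (totient (q i)) else 0)"
    proof (rule sum.mono_neutral_cong_right)
      show "finite (nats_upto R \<times> nats_upto R)" by simp
      show "I \<subseteq> nats_upto R \<times> nats_upto R" by (rule Isub)
      show "\<forall>i\<in>nats_upto R \<times> nats_upto R - I. (case i of (d\<^sub>1,d\<^sub>2) \<Rightarrow> if gcd d\<^sub>1 d\<^sub>2 dvd nat \<bar>j1 - j2\<bar> \<and> coprime d\<^sub>1 (nat \<bar>j1 - j3\<bar>) \<and> coprime d\<^sub>2 (nat \<bar>j2 - j3\<bar>)
        then dcoef R d\<^sub>1 * dcoef R d\<^sub>2 / real (totient (lcm d\<^sub>1 d\<^sub>2)) else 0) = 0"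
      proof
        fix i assume i: "i \<in> nats_upto R \<times> nats_upto R - I"
        obtain d\<^sub>1 d\<^sub>2 where d: "i = (d\<^sub>1,d\<^sub>2)" by (cases i)
        have "\<not> gcd d\<^sub>1 d\<^sub>2 dvd nat \<bar>j1 - j2\<bar>" using i unfolding d I_def Iabs by blast
        then show "(case i of (d\<^sub>1,d\<^sub>2) \<Rightarrow> if gcd d\<^sub>1 d\<^sub>2 dvd nat \<bar>j1 - j2\<bar> \<and> coprime d\<^sub>1 (nat \<bar>j1 - j3\<bar>) \<and> coprime d\<^sub>2 (nat \<bar>j2 - j3\<bar>)
          then dcoef R d\<^sub>1 * dcoef R d\<^sub>2 / real (totient (lcm d\<^sub>1 d\<^sub>2)) else 0) = 0" unfolding d by (simp only: prod.case simp_thms if_False)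
      qed
      fix i assume iI: "i \<in> I"
      obtain d\<^sub>1 d\<^sub>2 where i: "i = (d\<^sub>1,d\<^sub>2)" by (cases i)
      have dd: "(d\<^sub>1,d\<^sub>2) \<in> I" using iI i by simp
      have "coprime (s i + j3) (int (lcm d\<^sub>1 d\<^sub>2)) \<longleftrightarrow> coprime (s i + j3) (int d\<^sub>1) \<and> coprime (s i + j3) (int d\<^sub>2)"
      proof
        assume *: "coprime (s i + j3) (int (lcm d\<^sub>1 d\<^sub>2))"
        show "coprime (s i + j3) (int d\<^sub>1) \<and> coprime (s i + j3) (int d\<^sub>2)"
          by (intro conjI coprime_divisors[OF dvd_refl _ *]) simp_all
      next
        assume "coprime (s i + j3) (int d\<^sub>1) \<and> coprime (s i + j3) (int d\<^sub>2)"
        then have *: "coprime (s i + j3) (int (d\<^sub>1 * d\<^sub>2))" by simp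
        have "lcm d\<^sub>1 d\<^sub>2 dvd d\<^sub>1 * d\<^sub>2" by simp
        then have "int (lcm d\<^sub>1 d\<^sub>2) dvd int (d\<^sub>1 * d\<^sub>2)" unfolding int_dvd_int_iff .
        then show "coprime (s i + j3) (int (lcm d\<^sub>1 d\<^sub>2))" by (rule coprime_divisors[OF dvd_refl _ *])
      qed
      \<comment> \<open>Modulo \<open>d\<^sub>1\<close> the representative is - j1, so adding j3
        gives a difference of shifts and the choice of the representative drops out.\<close>
      also have "coprime (s i + j3) (int d\<^sub>1) \<longleftrightarrow> coprime (j3 - j1) (int d\<^sub>1)"
      proof -
        have "[s i + j3 = - j1 + j3] (mod int d\<^sub>1)" using s(1)[OF dd] unfolding i by (intro cong_add cong_refl)
        then have "[s i + j3 = j3 - j1] (mod int d\<^sub>1)" by simp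
        then show ?thesis using cong_imp_coprime cong_sym by blast
      qed
      also have "coprime (s i + j3) (int d\<^sub>2) \<longleftrightarrow> coprime (j3 - j2) (int d\<^sub>2)"
      proof -
        have "[s i + j3 = - j2 + j3] (mod int d\<^sub>2)" using s(2)[OF dd] unfolding i by (intro cong_add cong_refl)
        then have "[s i + j3 = j3 - j2] (mod int d\<^sub>2)" by simp
        then show ?thesis using cong_imp_coprime cong_sym by blast
      qed
      finally have cp: "coprime (s i + j3) (int (lcm d\<^sub>1 d\<^sub>2)) \<longleftrightarrow> coprime d\<^sub>1 (nat \<bar>j1 - j3\<bar>) \<and> coprime d\<^sub>2 (nat \<bar>j2 - j3\<bar>)"
        unfolding coprime_int_nat_abs .
      have gg: "gcd d\<^sub>1 d\<^sub>2 dvd nat \<bar>j1 - j2\<bar>" using dd unfolding I_def Iabs by blast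
      show "(case i of (d\<^sub>1,d\<^sub>2) \<Rightarrow> if gcd d\<^sub>1 d\<^sub>2 dvd nat \<bar>j1 - j2\<bar> \<and> coprime d\<^sub>1 (nat \<bar>j1 - j3\<bar>) \<and> coprime d\<^sub>2 (nat \<bar>j2 - j3\<bar>)
        then dcoef R d\<^sub>1 * dcoef R d\<^sub>2 / real (totient (lcm d\<^sub>1 d\<^sub>2)) else 0) =
        (if coprime (s i + j3) (int (q i)) then c i / real (totient (q i)) else 0)"
        using cp gg unfolding i by (simp add: q_def c_def)
    qed
    finally show ?thesis by simp
  qed
  also have "(\<Sum>i\<in>I. \<bar>c i\<bar> * Emax x (q i)) \<le> (ln R)\<^sup>2 * (\<Sum>k\<in>nats_upto (R\<^sup>2). real (divs k) ^ 2 * Emax x k)"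
  proof -
    have q_in: "q i \<in> nats_upto (R\<^sup>2)" if iI: "i \<in> I" for i
    proof -
      obtain d\<^sub>1 d\<^sub>2 where i: "i = (d\<^sub>1,d\<^sub>2)" "d\<^sub>1 \<in> nats_upto R" "d\<^sub>2 \<in> nats_upto R" using subsetD[OF Isub iI] by (cases i) auto
      have "lcm d\<^sub>1 d\<^sub>2 \<le> d\<^sub>1 * d\<^sub>2" using i by (intro dvd_imp_le) auto
      then have "real (lcm d\<^sub>1 d\<^sub>2) \<le> real d\<^sub>1 * real d\<^sub>2" by (simp flip: of_nat_mult)
      also have "\<dots> \<le> R * R" using i R by (intro mult_mono) auto
      finally show ?thesis using i by (simp add: q_def power2_eq_square lcm_pos_nat)
    qed
    have "(\<Sum>i\<in>I. \<bar>c i\<bar> * Emax x (q i)) \<le> (\<Sum>i\<in>I. (ln R)\<^sup>2 * Emax x (q i))"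
    proof (rule sum_mono)
      fix i assume iI: "i \<in> I"
      obtain d\<^sub>1 d\<^sub>2 where i: "i = (d\<^sub>1,d\<^sub>2)" "d\<^sub>1 \<in> nats_upto R" "d\<^sub>2 \<in> nats_upto R"
        using subsetD[OF Isub iI] by (cases i) auto
      have "\<bar>dcoef R d\<^sub>1\<bar> * \<bar>dcoef R d\<^sub>2\<bar> \<le> ln R * ln R"
        using abs_dcoef_le[OF i(2)] abs_dcoef_le[OF i(3)] R by (intro mult_mono) auto
      then have "\<bar>c i\<bar> \<le> (ln R)\<^sup>2" by (simp add: c_def i(1) abs_mult power2_eq_square)
      moreover have "Emax x (q i) \<ge> 0" using q_in[OF iI] by (intro Emax_nonneg) simp
      ultimately show "\<bar>c i\<bar> * Emax x (q i) \<le> (ln R)\<^sup>2 * Emax x (q i)" by (intro mult_right_mono)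
    qed
    also have "\<dots> = (\<Sum>k\<in>nats_upto (R\<^sup>2). \<Sum>i\<in>{i\<in>I. q i = k}. (ln R)\<^sup>2 * Emax x (q i))"
      using q_in by (intro sum.group[symmetric] finI) auto
    also have "\<dots> \<le> (\<Sum>k\<in>nats_upto (R\<^sup>2). (ln R)\<^sup>2 * (real (divs k) ^ 2 * Emax x k))"
    proof (rule sum_mono)
      fix k assume "k \<in> nats_upto (R\<^sup>2)"
      then have k: "k > 0" by simp
      have "{i\<in>I. q i = k} \<subseteq> {d. d dvd k} \<times> {d. d dvd k}" by (auto simp: q_def)
      then have "card {i\<in>I. q i = k} \<le> card ({d. d dvd k} \<times> {d. d dvd k})" using k by (intro card_mono) auto
      then have "real (card {i\<in>I. q i = k}) \<le> real (divs k) ^ 2"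
        by (simp add: card_cartesian_product divs_def power2_eq_square flip: of_nat_mult)
      then have "real (card {i\<in>I. q i = k}) * Emax x k \<le> real (divs k) ^ 2 * Emax x k"
        using Emax_nonneg[OF k] by (intro mult_right_mono)
      then have "(ln R)\<^sup>2 * (real (card {i\<in>I. q i = k}) * Emax x k) \<le> (ln R)\<^sup>2 * (real (divs k) ^ 2 * Emax x k)"
        by (intro mult_left_mono) auto
      then show "(\<Sum>i\<in>{i\<in>I. q i = k}. (ln R)\<^sup>2 * Emax x (q i)) \<le> (ln R)\<^sup>2 * (real (divs k) ^ 2 * Emax x k)"
        by (simp add: mult.left_commute)
    qed
    finally show ?thesis by (simp add: sum_distrib_left)
  qed
  also have "(\<Sum>i\<in>I. \<bar>c i\<bar>) * (3 * (J + 1) * (1 + ln x)) \<le> (R * ln R)\<^sup>2 * (3 * (J + 1) * (1 + ln x))"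
  proof (rule mult_right_mono)
    have "(\<Sum>i\<in>I. \<bar>c i\<bar>) \<le> (\<Sum>i\<in>nats_upto R \<times> nats_upto R. \<bar>c i\<bar>)"
      using Isub by (intro sum_mono2) auto
    also have "\<dots> = (\<Sum>d\<in>nats_upto R. \<bar>dcoef R d\<bar>) * (\<Sum>d\<in>nats_upto R. \<bar>dcoef R d\<bar>)"
      by (simp add: c_def sum_product sum.cartesian_product abs_mult case_prod_beta)
    also have "\<dots> \<le> (R * ln R) * (R * ln R)"
      using sum_abs_dcoef_le[OF R] R by (intro mult_mono) (auto intro!: sum_nonneg)
    finally show "(\<Sum>i\<in>I. \<bar>c i\<bar>) \<le> (R * ln R)\<^sup>2" by (simp add: power2_eq_square)
  qed (use J x in auto)
  finally show ?thesis by simp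
qed

text \<open>
  Cauchy--Schwarz in the form \<open>2 d\<^sup>2 E \<le> \<lambda> E + d\<^sup>4 E / \<lambda>\<close> removes the divisor weight:
  the first term is handled by the level of distribution, the second by the trivial bound for \<open>E\<close>.
\<close>

lemma weighted_level:
  assumes \<theta>: "\<theta> \<le> 1" and e: "e > 0"
    and level: "\<And>A :: real. A > 0 \<Longrightarrow> (\<lambda>x. \<Sum>q\<in>nats_upto (x powr (\<theta> - e)). Emax x q) \<in> O[at_top](\<lambda>x. x / ln x powr A)"
  shows "\<exists>C. \<forall>\<^sub>F x in at_top. (\<Sum>q\<in>nats_upto (x powr (\<theta> - e)). real (divs q) ^ 2 * Emax x q) \<le> C * x / ln x ^ M"
proof -
  \<comment> \<open>The multiplier \<open>\<mu>\<close> will be (ln x)^(M + 33): the trivial bound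
    brings one logarithm and the fifth divisor moment 2^5 = 32 more, and M powers have to remain.
    The level must in turn beat \<open>\<mu>\<close> by M powers, hence 2 M + 33.\<close>
  have "(\<lambda>x. \<Sum>q\<in>nats_upto (x powr (\<theta> - e)). Emax x q) \<in> O[at_top](\<lambda>x. x / ln x powr real (2 * M + 33))"
    by (rule level) simp
  then obtain c where c: "c > 0" "\<forall>\<^sub>F x in at_top. norm (\<Sum>q\<in>nats_upto (x powr (\<theta> - e)). Emax x q) \<le>
     c * norm (x / ln x powr real (2 * M + 33))" using landau_o.bigE by blast
  show ?thesis
  proof (rule exI[of _ "c + 3 * 2 ^ 33"])
    show "\<forall>\<^sub>F x in at_top. (\<Sum>q\<in>nats_upto (x powr (\<theta> - e)). real (divs q) ^ 2 * Emax x q) \<le> (c + 3 * 2 ^ 33) * x / ln x ^ M"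
      using c(2) eventually_ge_at_top[of "exp 1 :: real"]
    proof eventually_elim
      case (elim x)
      have x0: "x > 0" using elim(2) by (meson exp_gt_zero less_le_trans)
      have lnx: "ln x \<ge> 1" using elim(2) x0 by (simp add: ln_ge_iff)
      then have x1: "x \<ge> 1" using x0 ln_ge_zero_iff[of x] by linarith
      define Q where "Q = nats_upto (x powr (\<theta> - e))"
      define \<mu> where "\<mu> = ln x ^ (M + 33)"
      have \<mu>: "\<mu> > 0" using lnx by (simp add: \<mu>_def)
      have Qx: "Q \<subseteq> nats_upto x"
      proof -
        have "x powr (\<theta> - e) \<le> x powr 1" using x1 \<theta> e by (intro powr_mono) auto
        then show ?thesis using x0 unfolding Q_def by auto
      qed
      have E0: "Emax x q \<ge> 0" if "q \<in> nats_upto x" for q using that by (intro Emax_nonneg) simp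
      have "(\<Sum>q\<in>Q. real (divs q) ^ 2 * Emax x q) \<le> (\<Sum>q\<in>Q. \<mu> * Emax x q + (real (divs q) ^ 4 * Emax x q) / \<mu>)"
      proof (rule sum_mono)
        fix q assume "q \<in> Q"
        then have E: "Emax x q \<ge> 0" using Qx E0 by blast
        define d where "d = real (divs q) ^ 2"
        have d0: "d \<ge> 0" by (simp add: d_def)
        have "d \<le> \<mu> + d * d / \<mu>"
        proof (cases "d \<le> \<mu>")
          case False
          then have "d * \<mu> \<le> d * d" using d0 by (intro mult_left_mono) auto
          then have "d \<le> d * d / \<mu>" using \<mu> by (simp add: pos_le_divide_eq)
          then show ?thesis using \<mu> by simp
        next
          case True
          have "d * d / \<mu> \<ge> 0" using \<mu> by simp
          with True show ?thesis by linarith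
        qed
        then have "d * Emax x q \<le> (\<mu> + d * d / \<mu>) * Emax x q" using E by (rule mult_right_mono)
        also have "\<dots> = \<mu> * Emax x q + (real (divs q) ^ 4 * Emax x q) / \<mu>"
          by (simp add: d_def algebra_simps flip: power_add)
        finally show "real (divs q) ^ 2 * Emax x q \<le> \<mu> * Emax x q + (real (divs q) ^ 4 * Emax x q) / \<mu>"
          by (simp add: d_def)
      qed
      also have "\<dots> = \<mu> * (\<Sum>q\<in>Q. Emax x q) + (\<Sum>q\<in>Q. real (divs q) ^ 4 * Emax x q) / \<mu>"
        by (simp add: sum.distrib sum_distrib_left sum_divide_distrib)
      also have "\<mu> * (\<Sum>q\<in>Q. Emax x q) \<le> c * x / ln x ^ M"
      proof -
        have "(\<Sum>q\<in>Q. Emax x q) \<le> c * (x / ln x powr real (2 * M + 33))"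
          using elim(1) x0 by (simp add: Q_def)
        also have "ln x powr real (2 * M + 33) = ln x ^ (M + 33) * ln x ^ M"
        proof -
          have e: "2 * M + 33 = (M + 33) + M" by simp
          have "ln x powr real ((M + 33) + M) = ln x ^ ((M + 33) + M)" using lnx by (intro powr_realpow) linarith
          then show ?thesis unfolding e power_add .
        qed
        finally have "\<mu> * (\<Sum>q\<in>Q. Emax x q) \<le> \<mu> * (c * (x / (\<mu> * ln x ^ M)))"
          using \<mu> by (intro mult_left_mono) (auto simp: \<mu>_def)
        then show ?thesis using \<mu> by simp
      qed
      also have "(\<Sum>q\<in>Q. real (divs q) ^ 4 * Emax x q) / \<mu> \<le> 3 * 2 ^ 33 * x / ln x ^ M"
      proof -
        have "(\<Sum>q\<in>Q. real (divs q) ^ 4 * Emax x q) \<le> (\<Sum>q\<in>nats_upto x. real (divs q) ^ 4 * Emax x q)"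
          using Qx E0 by (intro sum_mono2) auto
        also have "\<dots> \<le> (\<Sum>q\<in>nats_upto x. 3 * (1 + ln x) * x * (real (divs q) ^ 5 / real q))"
        proof (rule sum_mono)
          fix q assume q: "q \<in> nats_upto x"
          have "real (divs q) ^ 4 * Emax x q \<le> real (divs q) ^ 4 * (3 * (1 + ln x) * x * (real (divs q) / real q))"
            using q by (intro mult_left_mono Emax_le) auto
          also have "\<dots> = 3 * (1 + ln x) * x * (real (divs q) ^ 5 / real q)"
            by (simp add: power_Suc[of _ 4, simplified] mult_ac)
          finally show "real (divs q) ^ 4 * Emax x q \<le> 3 * (1 + ln x) * x * (real (divs q) ^ 5 / real q)" .
        qed
        also have "\<dots> = 3 * (1 + ln x) * x * (\<Sum>q\<in>nats_upto x. real (divs q) ^ 5 / real q)"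
          by (simp add: sum_distrib_left)
        also have "\<dots> \<le> 3 * (1 + ln x) * x * (1 + ln x) ^ (2 ^ 5)"
          using lnx x0 x1 by (intro mult_left_mono sum_divs_power) auto
        also have "\<dots> = 3 * x * (1 + ln x) ^ 33"
        proof -
          have "(1 + ln x) ^ 33 = (1 + ln x) * (1 + ln x) ^ 32" by (simp flip: power_Suc)
          then show ?thesis by simp
        qed
        also have "\<dots> \<le> 3 * x * (2 * ln x) ^ 33"
          using lnx x0 by (intro mult_left_mono power_mono) auto
        also have "\<dots> = (3 * 2 ^ 33 * x) * ln x ^ 33" by (simp add: power_mult_distrib)
        finally have "(\<Sum>q\<in>Q. real (divs q) ^ 4 * Emax x q) / \<mu> \<le> (3 * 2 ^ 33 * x) * ln x ^ 33 / \<mu>"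
          using \<mu> by (intro divide_right_mono) auto
        also have "\<dots> = 3 * 2 ^ 33 * x / ln x ^ M"
          using lnx by (simp add: \<mu>_def power_add)
        finally show ?thesis .
      qed
      finally show ?case by (simp add: Q_def add_divide_distrib distrib_right)
    qed
  qed
qed

text \<open>The modulus 1 is one term of a sum of nonnegative terms. The choice \<epsilon> =
  \<theta>/2 keeps it in the range of moduli, and A = 2 gives the saving required by the locale.
  Small x are covered by enlarging the constant.\<close>

lemma prime_number_estimate_of_level:
  assumes \<theta>: "\<theta> > 0"
    and level: "\<And>\<epsilon> A :: real. \<epsilon> > 0 \<Longrightarrow> A > 0 \<Longrightarrow> (\<lambda>x. \<Sum>q\<in>nats_upto (x powr (\<theta> - \<epsilon>)). Emax x q) \<in> O[at_top](\<lambda>x. x / ln x powr A)"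
  shows "\<exists>C. prime_number_estimate C"
proof -
  have "(\<lambda>x. \<Sum>q\<in>nats_upto (x powr (\<theta> - \<theta> / 2)). Emax x q) \<in> O[at_top](\<lambda>x. x / ln x powr 2)"
    by (rule level) (use \<theta> in auto)
  then obtain c where c: "c > 0" "\<forall>\<^sub>F x in at_top. norm (\<Sum>q\<in>nats_upto (x powr (\<theta> - \<theta> / 2)). Emax x q) \<le>
     c * norm (x / ln x powr 2)" using landau_o.bigE by blast
  then obtain X where X: "\<forall>x\<ge>X. norm (\<Sum>q\<in>nats_upto (x powr (\<theta> - \<theta> / 2)). Emax x q) \<le> c * norm (x / ln x powr 2)"
    by (auto simp: eventually_at_top_linorder)
  have psi: "psi_prog x 1 1 = (\<Sum>n\<in>nats_upto x. mangoldt n)" for x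
    unfolding psi_prog_def by (intro sum.cong) auto
  have large: "\<bar>(\<Sum>n\<in>nats_upto x. mangoldt n) - x\<bar> \<le> c * x / (ln x)\<^sup>2" if x: "x \<ge> X" "x \<ge> 2" for x
  proof -
    have "(\<Sum>n\<in>nats_upto x. mangoldt n) - x = E_prog x 1 1"
      unfolding E_prog_def psi by simp
    then have "\<bar>(\<Sum>n\<in>nats_upto x. mangoldt n) - x\<bar> \<le> Emax x 1"
      using abs_E_prog_le_Emax[of 1 1 x] by simp
    also have "\<dots> \<le> (\<Sum>q\<in>nats_upto (x powr (\<theta> - \<theta> / 2)). Emax x q)"
    proof (rule member_le_sum)
      show "1 \<in> nats_upto (x powr (\<theta> - \<theta> / 2))" using x \<theta> by (simp add: ge_one_powr_ge_zero)
    qed (auto intro: Emax_nonneg)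
    also have "\<dots> \<le> c * norm (x / ln x powr 2)" using X x(1) by (simp add: abs_le_iff)
    also have "\<dots> = c * x / (ln x)\<^sup>2" using x by (simp add: powr_numeral)
    finally show ?thesis .
  qed
  define Y where "Y = max X 2"
  define C where "C = c + (2 * (2 * ln Y) + 1) * (ln Y)\<^sup>2"
  have Y: "Y \<ge> 2" "Y \<ge> X" "ln Y > 0" by (auto simp: Y_def less_max_iff_disj)
  have "prime_number_estimate C"
  proof
    fix x :: real assume x: "x \<ge> 2"
    have lnx: "ln x > 0" using x by simp
    show "\<bar>(\<Sum>n\<in>nats_upto x. mangoldt n) - x\<bar> \<le> C * x / (ln x)\<^sup>2"
    proof (cases "x \<ge> Y")
      case True
      have "\<bar>(\<Sum>n\<in>nats_upto x. mangoldt n) - x\<bar> \<le> c * x / (ln x)\<^sup>2" using large True Y x by simp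
      also have "\<dots> \<le> C * x / (ln x)\<^sup>2" using x Y by (intro divide_right_mono mult_right_mono) (auto simp: C_def)
      finally show ?thesis .
    next
      case False
      have lnxY: "ln x \<le> ln Y" using False x by simp
      have "0 \<le> (\<Sum>n\<in>nats_upto x. mangoldt n :: real)" by (intro sum_nonneg mangoldt_nonneg)
      moreover have "(\<Sum>n\<in>nats_upto x. mangoldt n) \<le> (x + 1) * ln x"
        using psi_prog_le[of 1 x 1] x unfolding psi by simp
      moreover have "ln x \<le> 2 * ln Y" using lnxY Y by linarith
      then have "(x + 1) * ln x \<le> (2 * x) * (2 * ln Y)" using x lnx by (intro mult_mono) auto
      ultimately have "\<bar>(\<Sum>n\<in>nats_upto x. mangoldt n) - x\<bar> \<le> (2 * x) * (2 * ln Y) + x" using x by linarith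
      also have "\<dots> = (2 * (2 * ln Y) + 1) * x" by (simp add: algebra_simps)
      also have "\<dots> \<le> (2 * (2 * ln Y) + 1) * x * ((ln Y)\<^sup>2 / (ln x)\<^sup>2)"
      proof -
        have "(ln x)\<^sup>2 \<le> (ln Y)\<^sup>2" using lnx lnxY by (intro power_mono) auto
        then have "1 \<le> (ln Y)\<^sup>2 / (ln x)\<^sup>2" using lnx by simp
        moreover have "(2 * (2 * ln Y) + 1) * x \<ge> 0" using x Y by simp
        ultimately show ?thesis using mult_left_mono[of 1 "(ln Y)\<^sup>2 / (ln x)\<^sup>2" "(2 * (2 * ln Y) + 1) * x"] by simp
      qed
      also have "\<dots> = (2 * (2 * ln Y) + 1) * (ln Y)\<^sup>2 * x / (ln x)\<^sup>2" by simp
      also have "\<dots> \<le> C * x / (ln x)\<^sup>2" using x c(1) by (intro divide_right_mono mult_right_mono) (auto simp: C_def)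
      finally show ?thesis .
    qed
  qed
  then show ?thesis by blast
qed

text \<open>All size requirements in one place. \<open>t\<close> is the number of
  \<open>Lam_R\<close> factors and \<open>x\<close> the end N + j of the range of primes. The
  conclusions put the moduli up to R^t within the level, let three saved logarithms beat (ln R)^t
  with t at most 2, and make the error from classes and shifts small against N.\<close>

lemma parameter_range:
  fixes \<theta> \<epsilon> c\<^sub>1 c\<^sub>2 c\<^sub>3 \<eta> L\<^sub>0 C X :: real and t :: nat
  assumes \<theta>: "\<theta> \<le> 1" and \<epsilon>: "\<epsilon> > 0" and c: "0 < c\<^sub>1" "0 < c\<^sub>2" "0 < c\<^sub>3"
    and t: "1 \<le> t" "t \<le> 2" and \<eta>: "\<eta> > 0" and C: "C \<ge> 0"
  shows "\<forall>\<^sub>F N in at_top. \<forall>R x. 1 \<le> R \<longrightarrow> c\<^sub>1 * N powr \<epsilon> \<le> R \<longrightarrow> R \<le> c\<^sub>2 * N powr (\<theta> / real t - \<epsilon>) \<longrightarrow>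
     \<bar>x - N\<bar> \<le> c\<^sub>3 * R powr \<epsilon> \<longrightarrow> L\<^sub>0 \<le> ln R \<and> 1 \<le> x \<and> X \<le> x \<and> R ^ t \<le> x powr (\<theta> - \<epsilon> / 2) \<and>
     ln R ^ t * (C * x / ln x ^ 3) \<le> \<eta> * N \<and> (R * ln R) ^ t * (3 * (c\<^sub>3 * R powr \<epsilon> + 1) * (1 + ln x)) \<le> \<eta> * N"
proof (cases "\<theta> / real t - \<epsilon> \<le> 0")
  \<comment> \<open>For a nonpositive exponent the two bounds on R contradict each other when N is
    large, so the claim is vacuous.\<close>
  case True
  have "\<forall>\<^sub>F N in at_top. ((c\<^sub>2 + 1) / c\<^sub>1) * N powr 0 \<le> N powr \<epsilon>" by (rule eventually_powr_le) (use \<epsilon> in simp)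
  then show ?thesis using eventually_ge_at_top[of 1]
  proof eventually_elim
    case (elim N)
    have "c\<^sub>2 + 1 \<le> c\<^sub>1 * N powr \<epsilon>" using elim c by (simp add: pos_divide_le_eq mult.commute)
    moreover have "N powr (\<theta> / real t - \<epsilon>) \<le> N powr 0" using elim(2) True by (intro powr_mono) auto
    then have "c\<^sub>2 * N powr (\<theta> / real t - \<epsilon>) \<le> c\<^sub>2" using elim(2) c by (simp add: mult_left_le)
    ultimately show ?case by (intro allI impI) linarith
  qed
next
  case False
  define \<alpha> where "\<alpha> = \<theta> / real t - \<epsilon>"
  have \<alpha>: "\<alpha> > 0" using False by (simp add: \<alpha>_def)
  have t1: "real t \<ge> 1" "real t > 0" using t by auto
  have "\<theta> > \<epsilon> * real t" using \<alpha> t1 by (simp add: \<alpha>_def field_simps)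
  moreover have "\<epsilon> * 1 \<le> \<epsilon> * real t" using t1 \<epsilon> by (intro mult_left_mono) auto
  ultimately have \<theta>\<epsilon>: "\<theta> > \<epsilon>" "\<epsilon> \<le> \<epsilon> * real t" by auto
  have \<theta>t: "\<theta> / real t \<le> 1"
  proof -
    have "\<theta> \<le> real t" using \<theta> t1 by linarith
    then show ?thesis using t1 by simp
  qed
  have \<alpha>1: "\<alpha> \<le> 1" using \<theta>t \<epsilon> by (simp add: \<alpha>_def)
  \<comment> \<open>The decisive inequality, from \<theta>/t <= 1 <= t: up to constants and
    logarithms, R^(t + \<epsilon>) bounds the total weight of the coefficients times the shift. It
    stays below N by a factor N^(\<epsilon>^2), which absorbs every logarithm.\<close>
  have expo: "\<alpha> * (real t + \<epsilon>) \<le> 1 - \<epsilon>\<^sup>2"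
  proof -
    define v where "v = \<theta> / real t"
    have "v * real t = \<theta>" using t1 by (simp add: v_def)
    moreover have "(v - \<epsilon>) * (real t + \<epsilon>) = v * real t + v * \<epsilon> - \<epsilon> * real t - \<epsilon>\<^sup>2"
      by (simp add: algebra_simps power2_eq_square)
    ultimately have "\<alpha> * (real t + \<epsilon>) = \<theta> + (\<theta> / real t) * \<epsilon> - \<epsilon> * real t - \<epsilon>\<^sup>2"
      unfolding \<alpha>_def v_def by simp
    moreover have "(\<theta> / real t) * \<epsilon> \<le> 1 * \<epsilon>" using \<theta>t \<epsilon> by (intro mult_right_mono) auto
    ultimately show ?thesis using \<theta> \<theta>\<epsilon> by simp
  qed
  define D where "D = (c\<^sub>3 + 1) * c\<^sub>2 powr (real t + \<epsilon>)"
  have D: "D \<ge> 0" using c by (simp add: D_def)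
  have e1: "\<forall>\<^sub>F N in at_top. (exp L\<^sub>0 / c\<^sub>1) * N powr 0 \<le> N powr \<epsilon>" by (rule eventually_powr_le) (use \<epsilon> in simp)
  have e2: "\<forall>\<^sub>F N in at_top. c\<^sub>2 * N powr 1 \<le> N powr 2" by (rule eventually_powr_le) simp
  have e3: "\<forall>\<^sub>F N in at_top. (2 * D) * N powr (1 - \<epsilon>\<^sup>2) \<le> N powr 1" by (rule eventually_powr_le) (use \<epsilon> in simp)
  have e4: "\<forall>\<^sub>F N in at_top. (c\<^sub>2 ^ t * 2 powr (\<theta> - \<epsilon> / 2)) * N powr (\<theta> - \<epsilon>) \<le> N powr (\<theta> - \<epsilon> / 2)"
    by (rule eventually_powr_le) (use \<epsilon> in simp)
  have e5: "\<forall>\<^sub>F N in at_top. 36 * D * (ln N) ^ 3 \<le> \<eta> * N powr (\<epsilon>\<^sup>2)"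
  proof -
    define a where "a = \<epsilon>\<^sup>2"
    have a: "a > 0" using \<epsilon> by (simp add: a_def)
    have "((\<lambda>N. (ln N) ^ 3 / N powr a) \<longlongrightarrow> 0) at_top" using a by real_asymp
    then have "((\<lambda>N. 36 * D * ((ln N) ^ 3 / N powr a)) \<longlongrightarrow> 36 * D * 0) at_top" by (intro tendsto_intros)
    then have "\<forall>\<^sub>F N in at_top. 36 * D * ((ln N) ^ 3 / N powr a) < \<eta>" using \<eta> by (intro order_tendstoD) auto
    then show ?thesis using eventually_gt_at_top[of 0]
      by eventually_elim (simp add: a_def[symmetric] field_simps)
  qed
  have e6: "\<forall>\<^sub>F N::real in at_top. 64 * C \<le> \<eta> * ln N"
  proof -
    have "filterlim (\<lambda>N. \<eta> * ln N) at_top at_top"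
      by (rule filterlim_tendsto_pos_mult_at_top[OF tendsto_const \<eta> ln_at_top])
    then show ?thesis by (simp add: filterlim_at_top)
  qed
  show ?thesis using e1 e2 e3 e4 e5 e6 eventually_ge_at_top[of "max 16 (2 * X)"]
  proof eventually_elim
    case (elim N)
    have N: "N \<ge> 16" "N \<ge> 2 * X" using elim(7) by auto
    have lnN: "ln N \<ge> 2 * ln 4" "ln N > 0"
    proof -
      have "ln (4 * 4 :: real) \<le> ln N" using N by (subst ln_le_cancel_iff) auto
      moreover have "ln (4 * 4 :: real) = 2 * ln 4" by (simp only: ln_mult) simp
      ultimately show "ln N \<ge> 2 * ln 4" by simp
      show "ln N > 0" using N by simp
    qed
    have ln4: "ln 4 = 2 * ln (2::real)"
    proof -
      have "ln (2 * 2 :: real) = 2 * ln 2" by (simp only: ln_mult) simp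
      then show ?thesis by simp
    qed
    have ln2: "ln (2::real) \<ge> 2/3" by (rule ln2_ge_two_thirds)
    show ?case
    proof (intro allI impI)
      fix R x :: real
      assume R: "1 \<le> R" "c\<^sub>1 * N powr \<epsilon> \<le> R" "R \<le> c\<^sub>2 * N powr (\<theta> / real t - \<epsilon>)" and x: "\<bar>x - N\<bar> \<le> c\<^sub>3 * R powr \<epsilon>"
      have Ra: "R \<le> c\<^sub>2 * N powr \<alpha>" using R(3) by (simp add: \<alpha>_def)
      have L0: "L\<^sub>0 \<le> ln R"
      proof -
        have "exp L\<^sub>0 \<le> c\<^sub>1 * N powr \<epsilon>" using elim(1) N c by (simp add: pos_divide_le_eq mult.commute)
        then have "exp L\<^sub>0 \<le> R" using R(2) by linarith
        then show ?thesis using R(1) by (subst ln_ge_iff) auto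
      qed
      have lnR: "0 \<le> ln R" "ln R \<le> 2 * ln N"
      proof -
        show "0 \<le> ln R" using R by simp
        have "c\<^sub>2 * N powr \<alpha> \<le> c\<^sub>2 * N powr 1" using \<alpha>1 N c by (intro mult_left_mono powr_mono) auto
        then have "R \<le> N powr 2" using Ra elim(2) by linarith
        then have "ln R \<le> ln (N powr 2)" using R N by (subst ln_le_cancel_iff) auto
        moreover have "ln (N powr 2) = 2 * ln N" using N by (subst ln_powr) auto
        ultimately show "ln R \<le> 2 * ln N" by linarith
      qed
      have Re: "R powr \<epsilon> \<ge> 1" using R \<epsilon> by (simp add: ge_one_powr_ge_zero)
      have RJ: "R ^ t * (c\<^sub>3 * R powr \<epsilon> + 1) \<le> D * N powr (1 - \<epsilon>\<^sup>2)"
      proof -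
        have "R ^ t * (c\<^sub>3 * R powr \<epsilon> + 1) \<le> R ^ t * ((c\<^sub>3 + 1) * R powr \<epsilon>)"
          using R Re by (intro mult_left_mono) (auto simp: algebra_simps)
        also have "\<dots> = (c\<^sub>3 + 1) * R powr (real t + \<epsilon>)" using R by (simp add: powr_add powr_realpow)
        also have "\<dots> \<le> (c\<^sub>3 + 1) * (c\<^sub>2 * N powr \<alpha>) powr (real t + \<epsilon>)"
          using Ra R c \<epsilon> by (intro mult_left_mono powr_mono2) auto
        also have "\<dots> = D * N powr (\<alpha> * (real t + \<epsilon>))"
          using c N by (simp add: D_def powr_mult powr_powr)
        also have "\<dots> \<le> D * N powr (1 - \<epsilon>\<^sup>2)" using expo D N by (intro mult_left_mono powr_mono) auto
        finally show ?thesis .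
      qed
      \<comment> \<open>As R^t is at least 1, \<open>RJ\<close> bounds the shift as well; x
        therefore lies between N/2 and 2 N.\<close>
      have J: "c\<^sub>3 * R powr \<epsilon> \<le> N / 2"
      proof -
        have "1 * (c\<^sub>3 * R powr \<epsilon> + 1) \<le> R ^ t * (c\<^sub>3 * R powr \<epsilon> + 1)"
          using R c by (intro mult_right_mono one_le_power) auto
        then show ?thesis using RJ elim(3) N by simp
      qed
      have xN: "N / 2 \<le> x" "x \<le> 2 * N" "x \<ge> 8" "X \<le> x" using x J N by (auto simp: abs_le_iff)
      have lnx: "ln x \<ge> ln N / 2" "ln x \<le> 2 * ln N" "1 + ln x \<le> 3 * ln N"
      proof -
        have "ln (N / 2) \<le> ln x" using xN N by (subst ln_le_cancel_iff) auto
        moreover have "ln (N / 2) = ln N - ln 2" using N by (simp add: ln_div)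
        ultimately show "ln x \<ge> ln N / 2" using lnN ln4 ln2 by linarith
        have "ln x \<le> ln (2 * N)" using xN N by (subst ln_le_cancel_iff) auto
        moreover have "ln (2 * N) = ln 2 + ln N" using N by (simp add: ln_mult)
        ultimately have "ln x \<le> ln 2 + ln N" by simp
        then show "ln x \<le> 2 * ln N" "1 + ln x \<le> 3 * ln N" using lnN ln4 ln2 by linarith+
      qed
      have Lt: "ln R ^ t \<le> 4 * (ln N)\<^sup>2"
      proof -
        have "2 * ln N \<ge> 1" using lnN ln4 ln2 by linarith
        have "ln R ^ t \<le> (2 * ln N) ^ t" using lnR by (intro power_mono) auto
        also have "\<dots> \<le> (2 * ln N) ^ 2" using \<open>2 * ln N \<ge> 1\<close> t by (intro power_increasing) auto
        finally show ?thesis by (simp add: power_mult_distrib)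
      qed
      show "L\<^sub>0 \<le> ln R \<and> 1 \<le> x \<and> X \<le> x \<and> R ^ t \<le> x powr (\<theta> - \<epsilon> / 2) \<and>
        ln R ^ t * (C * x / ln x ^ 3) \<le> \<eta> * N \<and> (R * ln R) ^ t * (3 * (c\<^sub>3 * R powr \<epsilon> + 1) * (1 + ln x)) \<le> \<eta> * N"
      proof (intro conjI)
        show "L\<^sub>0 \<le> ln R" "1 \<le> x" "X \<le> x" using L0 xN by auto
        show "R ^ t \<le> x powr (\<theta> - \<epsilon> / 2)"
        proof -
          have "R ^ t \<le> (c\<^sub>2 * N powr \<alpha>) ^ t" using Ra R by (intro power_mono) auto
          also have "\<dots> = c\<^sub>2 ^ t * N powr (\<alpha> * real t)" using N by (simp add: power_mult_distrib powr_power mult.commute)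
          also have "\<alpha> * real t = \<theta> - \<epsilon> * real t" using t1 by (simp add: \<alpha>_def field_simps)
          also have "c\<^sub>2 ^ t * N powr (\<theta> - \<epsilon> * real t) \<le> c\<^sub>2 ^ t * N powr (\<theta> - \<epsilon>)"
            using \<theta>\<epsilon> N c by (intro mult_left_mono powr_mono) auto
          also have "\<dots> \<le> (N / 2) powr (\<theta> - \<epsilon> / 2)" using elim(4) N by (simp add: powr_divide field_simps)
          also have "\<dots> \<le> x powr (\<theta> - \<epsilon> / 2)" using xN N \<theta>\<epsilon> \<epsilon> by (intro powr_mono2) auto
          finally show ?thesis .
        qed
        show "ln R ^ t * (C * x / ln x ^ 3) \<le> \<eta> * N"
        proof -
          have l3: "(ln N / 2) ^ 3 \<le> ln x ^ 3" using lnx lnN by (intro power_mono) auto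
          have "ln R ^ t * (C * x / ln x ^ 3) \<le> (4 * (ln N)\<^sup>2) * (C * (2 * N) / (ln N / 2) ^ 3)"
            using C N lnN(2) xN lnR(1) by (intro mult_mono Lt frac_le l3) auto
          also have "\<dots> = (64 * C / ln N) * N" using lnN(2) by (simp add: power2_eq_square power3_eq_cube)
          also have "\<dots> \<le> \<eta> * N" using elim(6) lnN(2) N by (intro mult_right_mono) (auto simp: pos_divide_le_eq)
          finally show ?thesis .
        qed
        show "(R * ln R) ^ t * (3 * (c\<^sub>3 * R powr \<epsilon> + 1) * (1 + ln x)) \<le> \<eta> * N"
        proof -
          have "(R * ln R) ^ t * (3 * (c\<^sub>3 * R powr \<epsilon> + 1) * (1 + ln x)) =
            (R ^ t * (c\<^sub>3 * R powr \<epsilon> + 1)) * (ln R ^ t * (3 * (1 + ln x)))"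
            by (simp only: power_mult_distrib mult_ac)
          also have "\<dots> \<le> (D * N powr (1 - \<epsilon>\<^sup>2)) * ((4 * (ln N)\<^sup>2) * (3 * (3 * ln N)))"
          proof (rule mult_mono[OF RJ])
            have "0 \<le> ln x" using xN by simp
            then show "ln R ^ t * (3 * (1 + ln x)) \<le> (4 * (ln N)\<^sup>2) * (3 * (3 * ln N))"
              using lnx(3) lnR(1) by (intro mult_mono[OF Lt]) auto
            show "0 \<le> ln R ^ t * (3 * (1 + ln x))" using lnR(1) \<open>0 \<le> ln x\<close> by simp
          qed (use D in simp)
          also have "\<dots> = (36 * D * (ln N) ^ 3) * N powr (1 - \<epsilon>\<^sup>2)" by (simp add: power2_eq_square power3_eq_cube)
          also have "\<dots> \<le> (\<eta> * N powr (\<epsilon>\<^sup>2)) * N powr (1 - \<epsilon>\<^sup>2)" using elim(5) by (intro mult_right_mono) auto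
          also have "\<dots> = \<eta> * N" using N by (simp add: mult.assoc flip: powr_add)
          finally show ?thesis .
        qed
      qed
    qed
  qed
qed

lemma correlation_error_small:
  fixes \<theta> \<epsilon> c\<^sub>1 c\<^sub>2 c\<^sub>3 \<eta> L\<^sub>0 :: real and t :: nat
  assumes \<theta>: "\<theta> \<le> 1" and \<epsilon>: "\<epsilon> > 0" and c: "0 < c\<^sub>1" "0 < c\<^sub>2" "0 < c\<^sub>3"
    and t: "1 \<le> t" "t \<le> 2" and \<eta>: "\<eta> > 0"
    and level: "\<And>\<epsilon> A :: real. \<epsilon> > 0 \<Longrightarrow> A > 0 \<Longrightarrow> (\<lambda>x. \<Sum>q\<in>nats_upto (x powr (\<theta> - \<epsilon>)). Emax x q) \<in> O[at_top](\<lambda>x. x / ln x powr A)"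
  shows "\<forall>\<^sub>F N in sequentially. \<forall>R x. 1 \<le> R \<longrightarrow> c\<^sub>1 * real N powr \<epsilon> \<le> R \<longrightarrow> R \<le> c\<^sub>2 * real N powr (\<theta> / real t - \<epsilon>) \<longrightarrow>
     \<bar>x - real N\<bar> \<le> c\<^sub>3 * R powr \<epsilon> \<longrightarrow> L\<^sub>0 \<le> ln R \<and> 1 \<le> x \<and>
     ln R ^ t * (\<Sum>q\<in>nats_upto (R ^ t). real (divs q) ^ 2 * Emax x q) +
     (R * ln R) ^ t * (3 * (c\<^sub>3 * R powr \<epsilon> + 1) * (1 + ln x)) \<le> \<eta> * real N"
proof -
  have "\<exists>C. \<forall>\<^sub>F x in at_top. (\<Sum>q\<in>nats_upto (x powr (\<theta> - \<epsilon> / 2)). real (divs q) ^ 2 * Emax x q) \<le> C * x / ln x ^ 3"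
    by (rule weighted_level[OF \<theta> _ level]) (use \<epsilon> in auto)
  then obtain C\<^sub>1 X where CX: "\<forall>x\<ge>X. (\<Sum>q\<in>nats_upto (x powr (\<theta> - \<epsilon> / 2)). real (divs q) ^ 2 * Emax x q) \<le> C\<^sub>1 * x / ln x ^ 3"
    by (auto simp: eventually_at_top_linorder)
  define C where "C = max C\<^sub>1 0"
  have "\<forall>\<^sub>F N in at_top. \<forall>R x. 1 \<le> R \<longrightarrow> c\<^sub>1 * N powr \<epsilon> \<le> R \<longrightarrow> R \<le> c\<^sub>2 * N powr (\<theta> / real t - \<epsilon>) \<longrightarrow>
     \<bar>x - N\<bar> \<le> c\<^sub>3 * R powr \<epsilon> \<longrightarrow> L\<^sub>0 \<le> ln R \<and> 1 \<le> x \<and> X \<le> x \<and> R ^ t \<le> x powr (\<theta> - \<epsilon> / 2) \<and>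
     ln R ^ t * (C * x / ln x ^ 3) \<le> (\<eta> / 2) * N \<and> (R * ln R) ^ t * (3 * (c\<^sub>3 * R powr \<epsilon> + 1) * (1 + ln x)) \<le> (\<eta> / 2) * N"
    by (rule parameter_range[OF \<theta> \<epsilon> c t]) (use \<eta> in \<open>auto simp: C_def\<close>)
  then have "\<forall>\<^sub>F N in sequentially. \<forall>R x. 1 \<le> R \<longrightarrow> c\<^sub>1 * real N powr \<epsilon> \<le> R \<longrightarrow> R \<le> c\<^sub>2 * real N powr (\<theta> / real t - \<epsilon>) \<longrightarrow>
     \<bar>x - real N\<bar> \<le> c\<^sub>3 * R powr \<epsilon> \<longrightarrow> L\<^sub>0 \<le> ln R \<and> 1 \<le> x \<and> X \<le> x \<and> R ^ t \<le> x powr (\<theta> - \<epsilon> / 2) \<and>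
     ln R ^ t * (C * x / ln x ^ 3) \<le> (\<eta> / 2) * real N \<and> (R * ln R) ^ t * (3 * (c\<^sub>3 * R powr \<epsilon> + 1) * (1 + ln x)) \<le> (\<eta> / 2) * real N"
    by (rule eventually_compose_filterlim[OF _ filterlim_real_sequentially])
  then show ?thesis
  proof (rule eventually_mono, intro allI impI)
    fix N :: nat and R x :: real
    assume H: "\<forall>R x. 1 \<le> R \<longrightarrow> c\<^sub>1 * real N powr \<epsilon> \<le> R \<longrightarrow> R \<le> c\<^sub>2 * real N powr (\<theta> / real t - \<epsilon>) \<longrightarrow>
     \<bar>x - real N\<bar> \<le> c\<^sub>3 * R powr \<epsilon> \<longrightarrow> L\<^sub>0 \<le> ln R \<and> 1 \<le> x \<and> X \<le> x \<and> R ^ t \<le> x powr (\<theta> - \<epsilon> / 2) \<and>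
     ln R ^ t * (C * x / ln x ^ 3) \<le> (\<eta> / 2) * real N \<and> (R * ln R) ^ t * (3 * (c\<^sub>3 * R powr \<epsilon> + 1) * (1 + ln x)) \<le> (\<eta> / 2) * real N"
      and R: "1 \<le> R" "c\<^sub>1 * real N powr \<epsilon> \<le> R" "R \<le> c\<^sub>2 * real N powr (\<theta> / real t - \<epsilon>)" and x: "\<bar>x - real N\<bar> \<le> c\<^sub>3 * R powr \<epsilon>"
    from H[rule_format, OF R x] have H: "L\<^sub>0 \<le> ln R" "1 \<le> x" "X \<le> x" "R ^ t \<le> x powr (\<theta> - \<epsilon> / 2)"
     "ln R ^ t * (C * x / ln x ^ 3) \<le> (\<eta> / 2) * real N" "(R * ln R) ^ t * (3 * (c\<^sub>3 * R powr \<epsilon> + 1) * (1 + ln x)) \<le> (\<eta> / 2) * real N"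
      by auto
    have "(\<Sum>q\<in>nats_upto (R ^ t). real (divs q) ^ 2 * Emax x q) \<le> (\<Sum>q\<in>nats_upto (x powr (\<theta> - \<epsilon> / 2)). real (divs q) ^ 2 * Emax x q)"
      using H(4) by (intro sum_mono2) (auto intro!: mult_nonneg_nonneg Emax_nonneg)
    also have "\<dots> \<le> C\<^sub>1 * x / ln x ^ 3" using CX H(3) by blast
    also have "\<dots> \<le> C * x / ln x ^ 3" using H(2) by (intro divide_right_mono mult_right_mono) (auto simp: C_def)
    finally have "ln R ^ t * (\<Sum>q\<in>nats_upto (R ^ t). real (divs q) ^ 2 * Emax x q) \<le> ln R ^ t * (C * x / ln x ^ 3)"
      using R(1) by (intro mult_left_mono) auto
    moreover have "\<eta> / 2 * real N + \<eta> / 2 * real N = \<eta> * real N" by simp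
    ultimately show "L\<^sub>0 \<le> ln R \<and> 1 \<le> x \<and>
     ln R ^ t * (\<Sum>q\<in>nats_upto (R ^ t). real (divs q) ^ 2 * Emax x q) +
     (R * ln R) ^ t * (3 * (c\<^sub>3 * R powr \<epsilon> + 1) * (1 + ln x)) \<le> \<eta> * real N"
      using H(1,2,5,6) by (intro conjI) linarith+
  qed
qed

text \<open>The difference is at most 2 c R^\<epsilon>, and 2 c is at most R. This is the origin of
  K = 1 + \<epsilon> in the final argument.\<close>

lemma ln_shift_le:
  fixes a b :: int
  assumes "a \<noteq> b" "\<bar>real_of_int a\<bar> \<le> c * R powr \<epsilon>" "\<bar>real_of_int b\<bar> \<le> c * R powr \<epsilon>" "c > 0" "R \<ge> 1" "ln (2 * c) \<le> ln R"
  shows "nat \<bar>a - b\<bar> > 0" "ln (real (nat \<bar>a - b\<bar>)) \<le> (1 + \<epsilon>) * ln R"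
proof -
  show pos: "nat \<bar>a - b\<bar> > 0" using assms(1) by simp
  have "real (nat \<bar>a - b\<bar>) = \<bar>real_of_int a - real_of_int b\<bar>" by simp
  also have "\<dots> \<le> 2 * c * R powr \<epsilon>" using assms(2,3) by linarith
  finally have "ln (real (nat \<bar>a - b\<bar>)) \<le> ln ((2 * c) * R powr \<epsilon>)" using pos assms(4,5) by (subst ln_le_cancel_iff) auto
  also have "\<dots> = ln (2 * c) + \<epsilon> * ln R" using assms(4,5) by (subst ln_mult) (auto simp: ln_powr)
  also have "\<dots> \<le> (1 + \<epsilon>) * ln R" using assms(6) by (simp add: algebra_simps)
  finally show "ln (real (nat \<bar>a - b\<bar>)) \<le> (1 + \<epsilon>) * ln R" .
qed

text \<open>Signs do not affect parity, and (a - b) + (a - c) + (b - c) = 2 (a - c). It supplies the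
  parity hypothesis of the estimate for distinct shifts.\<close>

lemma even_pairwise_distances:
  fixes a b c :: int
  shows "even (nat \<bar>a - b\<bar> + nat \<bar>a - c\<bar> + nat \<bar>b - c\<bar>)"
proof -
  have "even (nat \<bar>z\<bar>) \<longleftrightarrow> even z" for z :: int by (simp add: even_nat_iff)
  then show ?thesis by (cases "even a"; cases "even b"; cases "even c") simp_all
qed

section \<open>The correlation asymptotics\<close>

lemma eventually_powr_small:
  assumes "a < b" "\<eta> > (0::real)"
  shows "\<forall>\<^sub>F L in at_top. L powr a \<le> \<eta> * L powr b"
proof -
  have "\<forall>\<^sub>F L in at_top. (1 / \<eta>) * L powr a \<le> L powr b" by (rule eventually_powr_le[OF assms(1)])
  then show ?thesis by eventually_elim (use assms(2) in \<open>simp add: field_simps\<close>)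
qed

text \<open>The constants \<open>c\<^sub>1\<close>, \<open>c\<^sub>2\<close>,
  \<open>c\<^sub>3\<close> are the implied constants in the conditions on R and on the shifts, and
  \<open>\<eta>\<close> expresses o(1), uniformly in R and j. The error is additive because the
  singular series may be 0.\<close>

theorem theorem3:
  fixes \<theta> \<epsilon> c\<^sub>1 c\<^sub>2 c\<^sub>3 :: real and k r :: nat and a :: "nat \<Rightarrow> nat"
  assumes theta: "0 < \<theta>" "\<theta> \<le> 1"
    and level: "\<And>\<epsilon>' A :: real. \<epsilon>' > 0 \<Longrightarrow> A > 0 \<Longrightarrow>
      (\<lambda>x. \<Sum>q = 1..nat \<lfloor>x powr (\<theta> - \<epsilon>')\<rfloor>.
         Max ((\<lambda>b. \<bar>E_prog x q b\<bar>) ` {b \<in> {1..int q}. coprime b (int q)}))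
      \<in> O[at_top](\<lambda>x. x / ln x powr A)"
    and k: "2 \<le> k" "k \<le> 3"
    and r: "2 \<le> r"
    and exps: "\<And>i. i \<in> {1..r} \<Longrightarrow> 1 \<le> a i" "a r = 1" "(\<Sum>i = 1..r. a i) = k"
    and eps: "0 < \<epsilon>"
    and constants: "0 < c\<^sub>1" "0 < c\<^sub>2" "0 < c\<^sub>3"
  shows "\<forall>\<eta>>0. \<forall>\<^sub>F N in sequentially. \<forall>(R::real) (j :: nat \<Rightarrow> int).
      1 \<le> R \<longrightarrow>
      c\<^sub>1 * real N powr \<epsilon> \<le> R \<longrightarrow>
      R \<le> c\<^sub>2 * real N powr (\<theta> / (real k - 1) - \<epsilon>) \<longrightarrow>
      inj_on j {1..r} \<longrightarrow>
      (\<forall>i\<in>{1..r}. \<bar>real_of_int (j i)\<bar> \<le> c\<^sub>3 * R powr \<epsilon>) \<longrightarrow>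
      \<bar>S_tilde R N r j a - sing_series r j * real N * ln R ^ (k - r)\<bar>
        \<le> \<eta> * (real N * ln R ^ (k - r))"
proof (intro allI impI)
  fix \<eta> :: real assume \<eta>: "\<eta> > 0"
  have lev: "(\<lambda>x. \<Sum>q\<in>nats_upto (x powr (\<theta> - \<epsilon>')). Emax x q) \<in> O[at_top](\<lambda>x. x / ln x powr A)"
    if "\<epsilon>' > 0" "A > 0" for \<epsilon>' A :: real
    using level[OF that] unfolding nats_upto_eq Emax_def .
  obtain C where "prime_number_estimate C" using prime_number_estimate_of_level[OF theta(1) lev] by blast
  then interpret prime_number_estimate C .
  define K where "K = 1 + \<epsilon>"
  have K: "K > 0" using eps by (simp add: K_def)
  \<comment> \<open>One half of \<open>\<eta>\<close> goes to the error from the progressions, the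
    other to the evaluation of the main term. The latter fixes a threshold for ln R, which is
    reached for large N because R is at least a multiple of a power of N.\<close>
  define Err where "Err = (\<lambda>(t::nat) L\<^sub>0 (N::nat). \<forall>R x. 1 \<le> R \<longrightarrow> c\<^sub>1 * real N powr \<epsilon> \<le> R \<longrightarrow>
     R \<le> c\<^sub>2 * real N powr (\<theta> / real t - \<epsilon>) \<longrightarrow> \<bar>x - real N\<bar> \<le> c\<^sub>3 * R powr \<epsilon> \<longrightarrow> L\<^sub>0 \<le> ln R \<and> 1 \<le> x \<and>
     ln R ^ t * (\<Sum>q\<in>nats_upto (R ^ t). real (divs q) ^ 2 * Emax x q) +
     (R * ln R) ^ t * (3 * (c\<^sub>3 * R powr \<epsilon> + 1) * (1 + ln x)) \<le> \<eta> / 2 * real N)"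
  have err_ev: "\<forall>\<^sub>F N in sequentially. Err t L\<^sub>0 N" if "1 \<le> t" "t \<le> 2" for t L\<^sub>0
    unfolding Err_def by (rule correlation_error_small[OF theta(2) eps constants that half_gt_zero[OF \<eta>] lev])
  have "r = (\<Sum>i=1..r. 1)" by simp
  also have "\<dots> \<le> (\<Sum>i=1..r. a i)" by (intro sum_mono exps(1))
  also have "\<dots> = k" by (rule exps(3))
  finally have "r \<le> k" .
  \<comment> \<open>Exponents at least 1 give r <= k and leave three shapes: a single
    \<open>Lam_R\<close>, two with different shifts, and a square.\<close>
  with k r consider "k = 2" "r = 2" | "k = 3" "r = 3" | "k = 3" "r = 2" by linarith
  then show "\<forall>\<^sub>F N in sequentially. \<forall>(R::real) (j :: nat \<Rightarrow> int).
      1 \<le> R \<longrightarrow>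
      c\<^sub>1 * real N powr \<epsilon> \<le> R \<longrightarrow>
      R \<le> c\<^sub>2 * real N powr (\<theta> / (real k - 1) - \<epsilon>) \<longrightarrow>
      inj_on j {1..r} \<longrightarrow>
      (\<forall>i\<in>{1..r}. \<bar>real_of_int (j i)\<bar> \<le> c\<^sub>3 * R powr \<epsilon>) \<longrightarrow>
      \<bar>S_tilde R N r j a - sing_series r j * real N * ln R ^ (k - r)\<bar>
        \<le> \<eta> * (real N * ln R ^ (k - r))"
  proof cases
    case 1
    have a1: "a 1 = 1" using exps(2,3) 1 by (simp add: numeral_2_eq_2)
    have "\<forall>\<^sub>F L in at_top. (\<forall>Q u. Q > 0 \<longrightarrow> ln (real Q) \<le> K * L \<longrightarrow> admissible 2 Q u \<longrightarrow>
       \<bar>Pconst u\<bar> \<le> L powr 1 \<and> (\<forall>x\<ge>1. \<bar>Tsum u x\<bar> \<le> L powr 1) \<and>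
       (\<forall>x>0. L powr (3/4) \<le> ln x \<longrightarrow> \<bar>Tsum u x - Pconst u\<bar> \<le> L powr (- 1/8))) \<and>
       L powr (- 1/8) \<le> \<eta> / 2 * L powr 0 \<and> max 1 (ln (2 * c\<^sub>3)) \<le> L"
      by (intro eventually_conj Tsum_uniform eventually_powr_small eventually_ge_at_top) (use K \<eta> in auto)
    then obtain L\<^sub>0 where L0: "\<forall>L\<ge>L\<^sub>0. (\<forall>Q u. Q > 0 \<longrightarrow> ln (real Q) \<le> K * L \<longrightarrow> admissible 2 Q u \<longrightarrow>
       \<bar>Pconst u\<bar> \<le> L powr 1 \<and> (\<forall>x\<ge>1. \<bar>Tsum u x\<bar> \<le> L powr 1) \<and>
       (\<forall>x>0. L powr (3/4) \<le> ln x \<longrightarrow> \<bar>Tsum u x - Pconst u\<bar> \<le> L powr (- 1/8))) \<and>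
       L powr (- 1/8) \<le> \<eta> / 2 * L powr 0 \<and> max 1 (ln (2 * c\<^sub>3)) \<le> L"
      unfolding eventually_at_top_linorder by blast
    show ?thesis
    proof (rule eventually_mono[OF err_ev[of 1 L\<^sub>0]], simp, simp, intro allI impI)
      fix N :: nat and R :: real and j :: "nat \<Rightarrow> int"
      assume E: "Err 1 L\<^sub>0 N"
        and R: "1 \<le> R" "c\<^sub>1 * real N powr \<epsilon> \<le> R" "R \<le> c\<^sub>2 * real N powr (\<theta> / (real k - 1) - \<epsilon>)"
        and inj: "inj_on j {1..r}" and J: "\<forall>i\<in>{1..r}. \<bar>real_of_int (j i)\<bar> \<le> c\<^sub>3 * R powr \<epsilon>"
      have ne: "j 1 \<noteq> j 2" using inj_onD[OF inj, of 1 2] 1 by auto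
      have J12: "\<bar>real_of_int (j 1)\<bar> \<le> c\<^sub>3 * R powr \<epsilon>" "\<bar>real_of_int (j 2)\<bar> \<le> c\<^sub>3 * R powr \<epsilon>" using J 1 by auto
      define x where "x = real N + real_of_int (j 2)"
      have "L\<^sub>0 \<le> ln R \<and> 1 \<le> x \<and>
         ln R ^ 1 * (\<Sum>q\<in>nats_upto (R ^ 1). real (divs q) ^ 2 * Emax x q) +
         (R * ln R) ^ 1 * (3 * (c\<^sub>3 * R powr \<epsilon> + 1) * (1 + ln x)) \<le> \<eta> / 2 * real N"
        using R 1 J12 by (intro E[unfolded Err_def, rule_format]) (simp_all add: x_def)
      then have L: "L\<^sub>0 \<le> ln R" and x: "1 \<le> x" and err: "ln R * (\<Sum>q\<in>nats_upto R. real (divs q) ^ 2 * Emax x q) +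
         (R * ln R) * (3 * (c\<^sub>3 * R powr \<epsilon> + 1) * (1 + ln x)) \<le> \<eta> / 2 * real N" by simp_all
      define h where "h = nat \<bar>j 1 - j 2\<bar>"
      have LL: "ln R \<ge> 1" "ln (2 * c\<^sub>3) \<le> ln R" "ln R powr (- 1/8) \<le> \<eta> / 2" using L0[rule_format, OF L] by auto
      have h: "h > 0" "ln (real h) \<le> K * ln R"
        using ln_shift_le[OF ne J12 constants(3) R(1) LL(2)] by (simp_all add: h_def K_def)
      have "ln R powr (3/4) \<le> ln R" using LL powr_mono[of "3/4" 1 "ln R"] by simp
      then have "\<bar>Tsum (phi_weight h) R - Pconst (phi_weight h)\<bar> \<le> ln R powr (- 1/8)"
        using L0[rule_format, OF L] h admissible_phi_weight[of h] R(1) by auto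
      then have T: "\<bar>Tsum (phi_weight h) R - Pconst (phi_weight h)\<bar> \<le> \<eta> / 2" using LL by linarith
      have "\<bar>(\<Sum>n=1..N. Lam_R R (int n + j 1) * Lam (int n + j 2)) - real N * Tsum (phi_weight h) R\<bar> \<le> \<eta> / 2 * real N"
        unfolding h_def by (rule order_trans[OF correlation_2[OF R(1) x_def x J12] err])
      moreover have sing: "sing_series r j = Pconst (phi_weight h)" using sing_series_2[OF ne] 1 by (simp add: h_def)
      moreover have "S_tilde R N r j a = (\<Sum>n=1..N. Lam_R R (int n + j 1) * Lam (int n + j 2))"
        using a1 1 by (simp add: S_tilde_def)
      moreover have "\<bar>real N * Tsum (phi_weight h) R - sing_series r j * real N\<bar> \<le> real N * (\<eta> / 2)"
      proof -
        have "\<bar>real N * Tsum (phi_weight h) R - sing_series r j * real N\<bar> = real N * \<bar>Tsum (phi_weight h) R - Pconst (phi_weight h)\<bar>"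
          unfolding sing by (simp add: abs_mult mult.commute[of _ "real N"] flip: right_diff_distrib)
        with mult_left_mono[OF T, of "real N"] show ?thesis by linarith
      qed
      moreover have "\<eta> * (real N * ln R ^ (k - r)) = \<eta> / 2 * real N + real N * (\<eta> / 2)" using 1 by simp
      moreover have "sing_series r j * real N * ln R ^ (k - r) = sing_series r j * real N" using 1 by simp
      ultimately show "\<bar>S_tilde R N r j a - sing_series r j * real N * ln R ^ (k - r)\<bar> \<le> \<eta> * (real N * ln R ^ (k - r))"
        by linarith
    qed
  next
    case 2
    have a12: "a 1 = 1" "a 2 = 1"
    proof -
      have "a 1 + a 2 + a 3 = 3" using exps(3) 2 by (simp add: numeral_3_eq_3 numeral_2_eq_2)
      moreover have "1 \<le> a 1" "1 \<le> a 2" "a 3 = 1" using exps(1)[of 1] exps(1)[of 2] exps(2) 2 by auto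
      ultimately show "a 1 = 1" "a 2 = 1" by auto
    qed
    have "\<forall>\<^sub>F L in at_top. (\<forall>R g h\<^sub>1 h\<^sub>2. R > 0 \<longrightarrow> ln R = L \<longrightarrow> g > 0 \<longrightarrow> h\<^sub>1 > 0 \<longrightarrow> h\<^sub>2 > 0 \<longrightarrow>
       even (g + h\<^sub>1 + h\<^sub>2) \<longrightarrow> ln (real g) \<le> K * L \<longrightarrow> ln (real h\<^sub>1) \<le> K * L \<longrightarrow> ln (real h\<^sub>2) \<le> K * L \<longrightarrow>
       \<bar>Msum R g h\<^sub>1 h\<^sub>2 - Pconst (phi_weight h\<^sub>1) * Pconst (ustar g h\<^sub>1 h\<^sub>2)\<bar> \<le> L powr (- 1/16)) \<and>
       L powr (- 1/16) \<le> \<eta> / 2 * L powr 0 \<and> max 1 (ln (2 * c\<^sub>3)) \<le> L"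
      by (intro eventually_conj Msum_asymptotics_distinct eventually_powr_small eventually_ge_at_top) (use K \<eta> in auto)
    then obtain L\<^sub>0 where L0: "\<forall>L\<ge>L\<^sub>0. (\<forall>R g h\<^sub>1 h\<^sub>2. R > 0 \<longrightarrow> ln R = L \<longrightarrow> g > 0 \<longrightarrow> h\<^sub>1 > 0 \<longrightarrow> h\<^sub>2 > 0 \<longrightarrow>
       even (g + h\<^sub>1 + h\<^sub>2) \<longrightarrow> ln (real g) \<le> K * L \<longrightarrow> ln (real h\<^sub>1) \<le> K * L \<longrightarrow> ln (real h\<^sub>2) \<le> K * L \<longrightarrow>
       \<bar>Msum R g h\<^sub>1 h\<^sub>2 - Pconst (phi_weight h\<^sub>1) * Pconst (ustar g h\<^sub>1 h\<^sub>2)\<bar> \<le> L powr (- 1/16)) \<and>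
       L powr (- 1/16) \<le> \<eta> / 2 * L powr 0 \<and> max 1 (ln (2 * c\<^sub>3)) \<le> L"
      unfolding eventually_at_top_linorder by blast
    show ?thesis
    proof (rule eventually_mono[OF err_ev[of 2 L\<^sub>0]], simp, simp, intro allI impI)
      fix N :: nat and R :: real and j :: "nat \<Rightarrow> int"
      assume E: "Err 2 L\<^sub>0 N"
        and R: "1 \<le> R" "c\<^sub>1 * real N powr \<epsilon> \<le> R" "R \<le> c\<^sub>2 * real N powr (\<theta> / (real k - 1) - \<epsilon>)"
        and inj: "inj_on j {1..r}" and J: "\<forall>i\<in>{1..r}. \<bar>real_of_int (j i)\<bar> \<le> c\<^sub>3 * R powr \<epsilon>"
      have ne: "j 1 \<noteq> j 2" "j 1 \<noteq> j 3" "j 2 \<noteq> j 3"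
        using inj_onD[OF inj, of 1 2] inj_onD[OF inj, of 1 3] inj_onD[OF inj, of 2 3] 2 by auto
      have JJ: "\<bar>real_of_int (j 1)\<bar> \<le> c\<^sub>3 * R powr \<epsilon>" "\<bar>real_of_int (j 2)\<bar> \<le> c\<^sub>3 * R powr \<epsilon>"
        "\<bar>real_of_int (j 3)\<bar> \<le> c\<^sub>3 * R powr \<epsilon>" using J 2 by auto
      define x where "x = real N + real_of_int (j 3)"
      have "L\<^sub>0 \<le> ln R \<and> 1 \<le> x \<and>
         ln R ^ 2 * (\<Sum>q\<in>nats_upto (R ^ 2). real (divs q) ^ 2 * Emax x q) +
         (R * ln R) ^ 2 * (3 * (c\<^sub>3 * R powr \<epsilon> + 1) * (1 + ln x)) \<le> \<eta> / 2 * real N"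
        using R 2 JJ by (intro E[unfolded Err_def, rule_format]) (simp_all add: x_def)
      then have L: "L\<^sub>0 \<le> ln R" and x: "1 \<le> x" and err: "(ln R)\<^sup>2 * (\<Sum>q\<in>nats_upto (R\<^sup>2). real (divs q) ^ 2 * Emax x q) +
         (R * ln R)\<^sup>2 * (3 * (c\<^sub>3 * R powr \<epsilon> + 1) * (1 + ln x)) \<le> \<eta> / 2 * real N" by blast+
      define g h\<^sub>1 h\<^sub>2 where gh: "g = nat \<bar>j 1 - j 2\<bar>" "h\<^sub>1 = nat \<bar>j 1 - j 3\<bar>" "h\<^sub>2 = nat \<bar>j 2 - j 3\<bar>"
      have LL: "ln R \<ge> 1" "ln (2 * c\<^sub>3) \<le> ln R" "ln R powr (- 1/16) \<le> \<eta> / 2" using L0[rule_format, OF L] by auto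
      have g: "g > 0" "ln (real g) \<le> K * ln R"
        using ln_shift_le[OF ne(1) JJ(1,2) constants(3) R(1) LL(2)] by (simp_all add: gh K_def)
      have h1: "h\<^sub>1 > 0" "ln (real h\<^sub>1) \<le> K * ln R"
        using ln_shift_le[OF ne(2) JJ(1,3) constants(3) R(1) LL(2)] by (simp_all add: gh K_def)
      have h2: "h\<^sub>2 > 0" "ln (real h\<^sub>2) \<le> K * ln R"
        using ln_shift_le[OF ne(3) JJ(2,3) constants(3) R(1) LL(2)] by (simp_all add: gh K_def)
      have par: "even (g + h\<^sub>1 + h\<^sub>2)" unfolding gh by (rule even_pairwise_distances)
      have R0: "R > 0" using R(1) by simp
      have "\<bar>Msum R g h\<^sub>1 h\<^sub>2 - Pconst (phi_weight h\<^sub>1) * Pconst (ustar g h\<^sub>1 h\<^sub>2)\<bar> \<le> ln R powr (- 1/16)"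
        using L0[rule_format, OF L, THEN conjunct1, rule_format, OF R0 refl g(1) h1(1) h2(1) par g(2) h1(2) h2(2)] .
      then have T: "\<bar>Msum R g h\<^sub>1 h\<^sub>2 - sing_series 3 j\<bar> \<le> \<eta> / 2"
        using LL sing_series_3[OF ne] by (simp add: gh)
      have "\<bar>(\<Sum>n=1..N. Lam_R R (int n + j 1) * Lam_R R (int n + j 2) * Lam (int n + j 3)) - real N * Msum R g h\<^sub>1 h\<^sub>2\<bar> \<le> \<eta> / 2 * real N"
        unfolding gh by (rule order_trans[OF correlation_3[OF R(1) x_def x JJ] err])
      moreover have "S_tilde R N r j a = (\<Sum>n=1..N. Lam_R R (int n + j 1) * Lam_R R (int n + j 2) * Lam (int n + j 3))"
        using a12 2 by (simp add: S_tilde_def numeral_2_eq_2)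
      moreover have "\<bar>real N * Msum R g h\<^sub>1 h\<^sub>2 - sing_series r j * real N\<bar> \<le> real N * (\<eta> / 2)"
      proof -
        have "\<bar>real N * Msum R g h\<^sub>1 h\<^sub>2 - sing_series r j * real N\<bar> = real N * \<bar>Msum R g h\<^sub>1 h\<^sub>2 - sing_series 3 j\<bar>"
          using 2 by (simp add: abs_mult mult.commute[of _ "real N"] flip: right_diff_distrib)
        with mult_left_mono[OF T, of "real N"] show ?thesis by linarith
      qed
      moreover have "\<eta> * (real N * ln R ^ (k - r)) = \<eta> / 2 * real N + real N * (\<eta> / 2)" using 2 by simp
      moreover have "sing_series r j * real N * ln R ^ (k - r) = sing_series r j * real N" using 2 by simp
      ultimately show "\<bar>S_tilde R N r j a - sing_series r j * real N * ln R ^ (k - r)\<bar> \<le> \<eta> * (real N * ln R ^ (k - r))"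
        by linarith
    qed
  next
    case 3
    have a1: "a 1 = 2" using exps(2,3) 3 by (simp add: numeral_2_eq_2)
    have "\<forall>\<^sub>F L in at_top. (\<forall>R h. R > 0 \<longrightarrow> ln R = L \<longrightarrow> h > 0 \<longrightarrow> ln (real h) \<le> K * L \<longrightarrow>
       \<bar>Msum R 0 h h - Pconst (phi_weight h) * L\<bar> \<le> L powr (15/16)) \<and>
       L powr (15/16) \<le> \<eta> / 2 * L powr 1 \<and> max 1 (ln (2 * c\<^sub>3)) \<le> L"
      by (intro eventually_conj Msum_asymptotics_equal eventually_powr_small eventually_ge_at_top) (use K \<eta> in auto)
    then obtain L\<^sub>0 where L0: "\<forall>L\<ge>L\<^sub>0. (\<forall>R h. R > 0 \<longrightarrow> ln R = L \<longrightarrow> h > 0 \<longrightarrow> ln (real h) \<le> K * L \<longrightarrow>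
       \<bar>Msum R 0 h h - Pconst (phi_weight h) * L\<bar> \<le> L powr (15/16)) \<and>
       L powr (15/16) \<le> \<eta> / 2 * L powr 1 \<and> max 1 (ln (2 * c\<^sub>3)) \<le> L"
      unfolding eventually_at_top_linorder by blast
    show ?thesis
    proof (rule eventually_mono[OF err_ev[of 2 L\<^sub>0]], simp, simp, intro allI impI)
      fix N :: nat and R :: real and j :: "nat \<Rightarrow> int"
      assume E: "Err 2 L\<^sub>0 N"
        and R: "1 \<le> R" "c\<^sub>1 * real N powr \<epsilon> \<le> R" "R \<le> c\<^sub>2 * real N powr (\<theta> / (real k - 1) - \<epsilon>)"
        and inj: "inj_on j {1..r}" and J: "\<forall>i\<in>{1..r}. \<bar>real_of_int (j i)\<bar> \<le> c\<^sub>3 * R powr \<epsilon>"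
      have ne: "j 1 \<noteq> j 2" using inj_onD[OF inj, of 1 2] 3 by auto
      have J12: "\<bar>real_of_int (j 1)\<bar> \<le> c\<^sub>3 * R powr \<epsilon>" "\<bar>real_of_int (j 2)\<bar> \<le> c\<^sub>3 * R powr \<epsilon>" using J 3 by auto
      define x where "x = real N + real_of_int (j 2)"
      have "L\<^sub>0 \<le> ln R \<and> 1 \<le> x \<and>
         ln R ^ 2 * (\<Sum>q\<in>nats_upto (R ^ 2). real (divs q) ^ 2 * Emax x q) +
         (R * ln R) ^ 2 * (3 * (c\<^sub>3 * R powr \<epsilon> + 1) * (1 + ln x)) \<le> \<eta> / 2 * real N"
        using R 3 J12 by (intro E[unfolded Err_def, rule_format]) (simp_all add: x_def)
      then have L: "L\<^sub>0 \<le> ln R" and x: "1 \<le> x" and err: "(ln R)\<^sup>2 * (\<Sum>q\<in>nats_upto (R\<^sup>2). real (divs q) ^ 2 * Emax x q) +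
         (R * ln R)\<^sup>2 * (3 * (c\<^sub>3 * R powr \<epsilon> + 1) * (1 + ln x)) \<le> \<eta> / 2 * real N" by blast+
      define h where "h = nat \<bar>j 1 - j 2\<bar>"
      have LL: "ln R \<ge> 1" "ln (2 * c\<^sub>3) \<le> ln R" "ln R powr (15/16) \<le> \<eta> / 2 * ln R" using L0[rule_format, OF L] by auto
      have h: "h > 0" "ln (real h) \<le> K * ln R"
        using ln_shift_le[OF ne J12 constants(3) R(1) LL(2)] by (simp_all add: h_def K_def)
      have R0: "R > 0" using R(1) by simp
      have "\<bar>Msum R 0 h h - Pconst (phi_weight h) * ln R\<bar> \<le> ln R powr (15/16)"
        using L0[rule_format, OF L, THEN conjunct1, rule_format, OF R0 refl h] .
      then have T: "\<bar>Msum R 0 h h - Pconst (phi_weight h) * ln R\<bar> \<le> \<eta> / 2 * ln R" using LL by linarith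
      \<comment> \<open>The square is treated as two factors with equal shifts, so that the first
        distance is 0.\<close>
      have "\<bar>(\<Sum>n=1..N. Lam_R R (int n + j 1) * Lam_R R (int n + j 1) * Lam (int n + j 2)) - real N * Msum R 0 h h\<bar> \<le> \<eta> / 2 * real N"
        using order_trans[OF correlation_3[OF R(1) x_def x J12(1) J12(1) J12(2)] err] by (simp add: h_def)
      \<comment> \<open>The main term carries an extra factor ln R here; the threshold for ln R
        includes ln R >= 1.\<close>
      also have "\<eta> / 2 * real N \<le> \<eta> / 2 * real N * ln R"
        using \<eta> LL(1) mult_left_mono[of 1 "ln R" "\<eta> / 2 * real N"] by simp
      finally have "\<bar>(\<Sum>n=1..N. Lam_R R (int n + j 1) * Lam_R R (int n + j 1) * Lam (int n + j 2)) - real N * Msum R 0 h h\<bar>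
         \<le> \<eta> / 2 * real N * ln R" .
      moreover have sing: "sing_series r j = Pconst (phi_weight h)" using sing_series_2[OF ne] 3 by (simp add: h_def)
      moreover have "S_tilde R N r j a = (\<Sum>n=1..N. Lam_R R (int n + j 1) * Lam_R R (int n + j 1) * Lam (int n + j 2))"
        using a1 3 by (simp add: S_tilde_def power2_eq_square)
      moreover have "\<bar>real N * Msum R 0 h h - sing_series r j * real N * ln R\<bar> \<le> real N * (\<eta> / 2 * ln R)"
      proof -
        have "real N * Msum R 0 h h - sing_series r j * real N * ln R = real N * (Msum R 0 h h - Pconst (phi_weight h) * ln R)"
          unfolding sing by (simp add: algebra_simps)
        then have "\<bar>real N * Msum R 0 h h - sing_series r j * real N * ln R\<bar> = real N * \<bar>Msum R 0 h h - Pconst (phi_weight h) * ln R\<bar>"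
          by (simp only: abs_mult abs_of_nat)
        with mult_left_mono[OF T, of "real N"] show ?thesis by linarith
      qed
      moreover have "\<eta> * (real N * ln R ^ (k - r)) = \<eta> / 2 * real N * ln R + real N * (\<eta> / 2 * ln R)" using 3 by simp
      moreover have "sing_series r j * real N * ln R ^ (k - r) = sing_series r j * real N * ln R" using 3 by simp
      ultimately show "\<bar>S_tilde R N r j a - sing_series r j * real N * ln R ^ (k - r)\<bar> \<le> \<eta> * (real N * ln R ^ (k - r))"
        by linarith
    qed
  qed
qed

end
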